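(* Let $R$ be an NR ring, and let $G$ be a non-trivial locally solvable group. Then the group ring $RG$ is generalized $t$-fine if and only if $R$ is generalized $t$-fine and $G$ is a $p$-group for some prime $p$ with $p\in \mathrm{Nil}(R)$.
   Context: Rings are associative with identity $1$ (not necessarily commutative). For a ring $R$: $\mathrm{J}(R)$ is the Jacobson radical, $\mathrm{Nil}(R)$ the set of nilpotent elements, and $\mathcal{T}(R)$ the set of torsion units, i.e. units $u$ with $u^m=1$ for some $m\ge 1$. $R$ is generalized $t$-fine if $R\setminus \mathrm{J}(R)=\mathcal{T}(R)+\mathrm{Nil}(R)$. $R$ is an NR ring if $\mathrm{Nil}(R)$ is an (additive) subgroup of $R$. "$p\in \mathrm{Nil}(R)$" refers to the element $p\cdot 1_R$. A group is locally solvable if every finitely generated subgroup is solvable. A $p$-group is a (possibly infinite) group in which every element has order a power of $p$. *)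

theory Defs
  imports "HOL-Algebra.Algebra"
begin

section \<open>Jacobson radical, nilpotent elements, torsion units\<close>

definition left_ideal :: "'a set \<Rightarrow> ('a, 'm) ring_scheme \<Rightarrow> bool" where
  "left_ideal I R \<longleftrightarrow> additive_subgroup I R \<and>
     (\<forall>a\<in>carrier R. \<forall>x\<in>I. a \<otimes>\<^bsub>R\<^esub> x \<in> I)"

definition maximal_left_ideal :: "'a set \<Rightarrow> ('a, 'm) ring_scheme \<Rightarrow> bool" where
  "maximal_left_ideal I R \<longleftrightarrow> left_ideal I R \<and> I \<noteq> carrier R \<and>
     (\<forall>J. left_ideal J R \<and> I \<subseteq> J \<longrightarrow> J = I \<or> J = carrier R)"

text \<open>In the zero ring there is no maximal left ideal, and the radical is the whole ring.\<close>

definition jacobson_radical :: "('a, 'm) ring_scheme \<Rightarrow> 'a set" where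
  "jacobson_radical R = {x \<in> carrier R. \<forall>I. maximal_left_ideal I R \<longrightarrow> x \<in> I}"

definition nilpotents :: "('a, 'm) ring_scheme \<Rightarrow> 'a set" where
  "nilpotents R = {x \<in> carrier R. \<exists>n::nat. n \<ge> 1 \<and> x [^]\<^bsub>R\<^esub> n = \<zero>\<^bsub>R\<^esub>}"

definition torsion_units :: "('a, 'm) ring_scheme \<Rightarrow> 'a set" where
  "torsion_units R = {u \<in> Units R. \<exists>m::nat. m \<ge> 1 \<and> u [^]\<^bsub>R\<^esub> m = \<one>\<^bsub>R\<^esub>}"

definition generalized_t_fine :: "('a, 'm) ring_scheme \<Rightarrow> bool" where
  "generalized_t_fine R \<longleftrightarrow>
     carrier R - jacobson_radical R = torsion_units R <+>\<^bsub>R\<^esub> nilpotents R"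

definition NR_ring :: "('a, 'm) ring_scheme \<Rightarrow> bool" where
  "NR_ring R \<longleftrightarrow> ring R \<and> additive_subgroup (nilpotents R) R"

section \<open>Locally solvable groups and p-groups\<close>

definition locally_solvable :: "('g, 'n) monoid_scheme \<Rightarrow> bool" where
  "locally_solvable G \<longleftrightarrow> group G \<and>
     (\<forall>S. finite S \<and> S \<subseteq> carrier G \<longrightarrow> solvable (G\<lparr>carrier := generate G S\<rparr>))"

text \<open>Elements of infinite order are excluded, since \<open>group.ord\<close> is 0 for them.\<close>

definition p_group :: "nat \<Rightarrow> ('g, 'n) monoid_scheme \<Rightarrow> bool" where
  "p_group p G \<longleftrightarrow> group G \<and> (\<forall>x\<in>carrier G. \<exists>k::nat. group.ord G x = p ^ k)"

section \<open>Group rings\<close>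

text \<open>
  The formal sum of the \<open>f g \<cdot> g\<close> is represented by its coefficient function
  \<open>f\<close>, extended by zero outside \<open>carrier G\<close>. The product is convolution; the sum
  ranges over the finite support of \<open>f\<close>, because \<open>finsum\<close> over an infinite
  set is zero.
\<close>

definition group_ring :: "('a, 'm) ring_scheme \<Rightarrow> ('g, 'n) monoid_scheme \<Rightarrow> ('g \<Rightarrow> 'a) ring" where
  "group_ring R G =
     \<lparr>carrier = {f. (\<forall>g\<in>carrier G. f g \<in> carrier R) \<and> (\<forall>g. g \<notin> carrier G \<longrightarrow> f g = \<zero>\<^bsub>R\<^esub>) \<and>
                    finite {g \<in> carrier G. f g \<noteq> \<zero>\<^bsub>R\<^esub>}},
      monoid.mult = (\<lambda>f h x. if x \<in> carrier G
                then \<Oplus>\<^bsub>R\<^esub>y\<in>{y \<in> carrier G. f y \<noteq> \<zero>\<^bsub>R\<^esub>}. f y \<otimes>\<^bsub>R\<^esub> h (inv\<^bsub>G\<^esub> y \<otimes>\<^bsub>G\<^esub> x)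
                else \<zero>\<^bsub>R\<^esub>),
      one = (\<lambda>x. if x = \<one>\<^bsub>G\<^esub> then \<one>\<^bsub>R\<^esub> else \<zero>\<^bsub>R\<^esub>),
      ring.zero = (\<lambda>x. \<zero>\<^bsub>R\<^esub>),
      ring.add = (\<lambda>f h x. if x \<in> carrier G then f x \<oplus>\<^bsub>R\<^esub> h x else \<zero>\<^bsub>R\<^esub>)\<rparr>"

end

theory Submission
  imports Defs "HOL-Computational_Algebra.Polynomial"
begin

text \<open>
  Let \<open>R\<close> be an NR ring that is generalized t-fine. If \<open>a\<^sup>2\<close> lies in the largest nil ideal, then
  \<open>(1 + a) b (1 - a)\<close> is nilpotent modulo that ideal for nilpotent \<open>b\<close>, which makes \<open>a b\<close>, and also
  \<open>u a\<close> for a torsion unit \<open>u\<close>, nilpotent; so \<open>x a\<close> is nilpotent for every \<open>x\<close> outside the Jacobson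
  radical, hence for every \<open>x\<close>, and \<open>a\<close> is in the nil ideal. Therefore the nilpotent elements form an
  ideal. Then some prime \<open>p\<close> is nilpotent, and every element of \<open>R\<close> is a torsion unit or nilpotent.
  Conversely, this dichotomy implies that an NR ring is generalized t-fine.

  If \<open>RG\<close> is generalized t-fine, the augmentation carries the decompositions over to \<open>R\<close>, and the
  augmentation ideal lies in the Jacobson radical because a torsion unit of \<open>R\<close> plus a nilpotent is
  nonzero. For \<open>g\<close> of infinite order this makes \<open>1 - g + g\<^sup>2\<close> left invertible, and for \<open>g\<close> of
  prime order \<open>q \<noteq> p\<close> it makes \<open>1 + g + \<dots> + g\<^bsup>q-1\<^esup>\<close> left invertible; both are impossible.

  If \<open>G\<close> is a locally solvable \<open>p\<close>-group and \<open>p\<close> is nilpotent, an element of augmentation zero lives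
  over a finitely generated solvable torsion group, which is built from the trivial group by finitely
  many cyclic extensions inside its derived series. Along each of them the augmentation ideal stays
  nilpotent, so the kernel of the augmentation is nil and the dichotomy lifts from \<open>R\<close> to \<open>RG\<close>.
\<close>

section \<open>Evaluating integer polynomials in a ring\<close>

text \<open>The identities behind torsion and nilpotence involve one ring element at a time, so they
  are proved in the commutative type \<open>int poly\<close> and carried by \<open>poly_eval\<close>
  into noncommutative rings. In the forward direction \<open>RG\<close> is not known to be an NR
  ring; the structure theory is therefore carried out in \<open>R\<close>, and \<open>RG\<close>
  contributes decompositions outside its radical and the position of the augmentation kernel. The
  test elements must have augmentation \<open>1\<close>: \<open>1 - g + g^2\<close> has it, and its
  outer coefficients are \<open>1\<close>, so extreme coefficients of a product survive even if
  \<open>R\<close> has zero divisors; the sum of the powers of an element of order \<open>q\<close>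
  has augmentation \<open>q\<close> and is first scaled by an integer inverse of \<open>q\<close>
  modulo a vanishing power of \<open>p\<close>. In the backward direction the nilpotence exponent
  grows with every cyclic extension, so finitely many extensions must suffice; this needs finitely
  generated derived subgroups, which torsion provides through finite index. Annihilator levels
  inside \<open>RG\<close> replace powers of augmentation ideals, so that no group rings of
  subgroups occur.\<close>

definition poly_eval :: "('a, 'm) ring_scheme \<Rightarrow> 'a \<Rightarrow> int poly \<Rightarrow> 'a" where
  "poly_eval R x P =
     fold_coeffs (\<lambda>a y. add_pow R a \<one>\<^bsub>R\<^esub> \<oplus>\<^bsub>R\<^esub> x \<otimes>\<^bsub>R\<^esub> y) P \<zero>\<^bsub>R\<^esub>"

context ring
begin

abbreviation int_embed :: "int \<Rightarrow> 'a" where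
  "int_embed k \<equiv> add_pow R k \<one>"

lemma of_int_mult: "int_embed (a * b) = int_embed a \<otimes> int_embed b"
proof -
  have "int_embed a \<otimes> int_embed b = add_pow R a (int_embed b)"
    using add_pow_ldistr_int[of \<one> "int_embed b" a] by simp
  then show ?thesis
    using add.int_pow_pow[of \<one> a b] by (simp add: mult.commute[of b a])
qed

lemma of_int_central:
  assumes "x \<in> carrier R"
  shows "int_embed a \<otimes> x = x \<otimes> int_embed a"
  using add_pow_ldistr_int[of \<one> x a] add_pow_rdistr_int[of x \<one> a] assms by simp

lemma of_int_add: "int_embed (a + b) = int_embed a \<oplus> int_embed b"
  using add.int_pow_mult[of \<one> a b] by simp

lemma of_int_0 [simp]: "add_pow R (0 :: int) x = \<zero>"
  by (simp add: add_pow_int_ge)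

lemma of_int_of_nat: "add_pow R (int n) x = add_pow R n x"
  by (simp add: add_pow_int_ge)

lemma poly_eval_0 [simp]: "poly_eval R x 0 = \<zero>"
  by (simp add: poly_eval_def)

lemma poly_eval_pCons:
  assumes "x \<in> carrier R"
  shows "poly_eval R x (pCons a P) = int_embed a \<oplus> x \<otimes> poly_eval R x P"
\<comment> \<open>\<open>pCons 0 0\<close> is \<open>0\<close>, where \<open>fold_coeffs\<close>
  does not unfold, so this case is separate.\<close>
proof (cases "a = 0 \<and> P = 0")
  case True
  then show ?thesis using assms by (simp add: poly_eval_def)
next
  case False
  then show ?thesis by (auto simp add: poly_eval_def)
qed

lemma poly_eval_closed [simp, intro]:
  assumes "x \<in> carrier R"
  shows "poly_eval R x P \<in> carrier R"
  by (induction P) (auto simp: poly_eval_pCons assms)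

lemma poly_eval_add:
  assumes x: "x \<in> carrier R"
  shows "poly_eval R x (P + Q) = poly_eval R x P \<oplus> poly_eval R x Q"
proof (induction P Q rule: poly_induct2)
  case (pCons a P b Q)
  have "int_embed a \<in> carrier R" "int_embed b \<in> carrier R" by simp_all
  moreover have "poly_eval R x P \<in> carrier R" "poly_eval R x Q \<in> carrier R" using x by auto
  ultimately show ?case using pCons x
    by (simp add: poly_eval_pCons of_int_add r_distr a_ac)
qed (simp add: x)

lemma poly_eval_smult:
  assumes x: "x \<in> carrier R"
  shows "poly_eval R x (smult a P) = int_embed a \<otimes> poly_eval R x P"
proof (induction P)
  case (pCons b P)
  have "int_embed a \<otimes> (x \<otimes> poly_eval R x P) = x \<otimes> (int_embed a \<otimes> poly_eval R x P)"
    using x of_int_central[OF x, of a] by (simp add: m_assoc[symmetric])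
  then show ?case using pCons x
    by (simp add: poly_eval_pCons of_int_mult r_distr)
qed (simp add: x)

text \<open>Holds over a noncommutative ring because integers are central and powers of
  \<open>x\<close> commute with each other.\<close>

lemma poly_eval_mult:
  assumes x: "x \<in> carrier R"
  shows "poly_eval R x (P * Q) = poly_eval R x P \<otimes> poly_eval R x Q"
proof (induction P)
  case (pCons a P)
  then show ?case using x
    by (simp add: poly_eval_pCons poly_eval_add poly_eval_smult l_distr m_assoc)
qed (simp add: x)

lemma poly_eval_const [simp]:
  assumes "x \<in> carrier R"
  shows "poly_eval R x [:a:] = int_embed a"
  using assms by (simp add: poly_eval_pCons)

lemma poly_eval_1 [simp]:
  assumes "x \<in> carrier R"
  shows "poly_eval R x 1 = \<one>"
  using assms by (simp add: one_pCons)

lemma poly_eval_X [simp]: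
  assumes "x \<in> carrier R"
  shows "poly_eval R x [:0, 1:] = x"
  using assms by (simp add: poly_eval_pCons)

lemma poly_eval_power:
  assumes "x \<in> carrier R"
  shows "poly_eval R x (P ^ n) = poly_eval R x P [^] n"
proof (induction n)
  case (Suc n)
  have "poly_eval R x (P ^ Suc n) = poly_eval R x (P ^ n * P)" by (simp add: mult.commute)
  then show ?case using assms Suc by (simp add: poly_eval_mult)
qed (simp add: assms)

lemma poly_eval_X_power:
  assumes "x \<in> carrier R"
  shows "poly_eval R x ([:0, 1:] ^ n) = x [^] n"
  using assms by (simp add: poly_eval_power)

lemma poly_eval_1_plus_X:
  assumes "x \<in> carrier R"
  shows "poly_eval R x (1 + [:0, 1:]) = \<one> \<oplus> x"
  using assms by (simp only: poly_eval_add poly_eval_1 poly_eval_X)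

lemma poly_eval_commute:
  assumes "x \<in> carrier R"
  shows "poly_eval R x P \<otimes> poly_eval R x Q = poly_eval R x Q \<otimes> poly_eval R x P"
  by (metis assms poly_eval_mult mult.commute)

lemma poly_eval_uminus:
  assumes x: "x \<in> carrier R"
  shows "poly_eval R x (- P) = \<ominus> poly_eval R x P"
proof -
  have "poly_eval R x (- P) \<oplus> poly_eval R x P = \<zero>"
    using poly_eval_add[OF x, of "- P" P] by simp
  then show ?thesis using x by (simp add: minus_equality)
qed

lemma poly_eval_diff:
  assumes x: "x \<in> carrier R"
  shows "poly_eval R x (P - Q) = poly_eval R x P \<ominus> poly_eval R x Q"
  using poly_eval_add[OF x, of P "- Q"] poly_eval_uminus[OF x, of Q] by (simp add: minus_eq)

end

section \<open>Binomial congruences modulo a prime and its powers\<close>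

lemma prime_dvd_add_power_prime:
  fixes u v :: "'a :: comm_ring_1"
  assumes "Factorial_Ring.prime p"
  shows "of_nat p dvd (u + v) ^ p - u ^ p - v ^ p"
proof -
  have p: "p > 0" using assms prime_gt_0_nat by blast
  have "(u + v) ^ p = (\<Sum>k\<le>p. of_nat (p choose k) * u ^ k * v ^ (p - k))"
    by (rule binomial_ring)
  also have "{..p} = insert 0 (insert p {0<..<p})" using p by auto
  finally have "(u + v) ^ p - u ^ p - v ^ p = (\<Sum>k\<in>{0<..<p}. of_nat (p choose k) * u ^ k * v ^ (p - k))"
    using p by (simp add: algebra_simps)
  moreover have "of_nat p dvd (of_nat (p choose k) * u ^ k * v ^ (p - k) :: 'a)" if "k \<in> {0<..<p}" for k
  proof -
    have "p dvd (p choose k)" using that assms by (intro dvd_choose_prime) auto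
    then obtain c where "p choose k = p * c" by (elim dvdE)
    then show ?thesis by (simp add: dvd_mult2)
  qed
  ultimately show ?thesis by (auto intro: dvd_sum)
qed

text \<open>Iterated Frobenius: \<open>a - b\<close> divides \<open>a^p - b^p\<close>, so an error
  divisible by \<open>p\<close> stays divisible by \<open>p\<close>. The error is kept as a multiple
  of \<open>p\<close> because \<open>p\<close> will be nilpotent in the ring, not zero.\<close>

lemma prime_dvd_add_power_prime_power:
  fixes u v :: "'a :: comm_ring_1"
  assumes "Factorial_Ring.prime p"
  shows "of_nat p dvd (u + v) ^ (p ^ k) - u ^ (p ^ k) - v ^ (p ^ k)"
proof (induction k)
  case (Suc k)
  let ?a = "(u + v) ^ (p ^ k)" and ?b = "u ^ (p ^ k) + v ^ (p ^ k)"
  have "?a - ?b dvd ?a ^ p - ?b ^ p"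
    by (metis dvd_triv_left power_diff_sumr2)
  moreover have "of_nat p dvd ?a - ?b" using Suc by (simp add: diff_diff_eq)
  ultimately have "of_nat p dvd ?a ^ p - ?b ^ p" by (rule dvd_trans[rotated])
  moreover have "of_nat p dvd ?b ^ p - (u ^ (p ^ k)) ^ p - (v ^ (p ^ k)) ^ p"
    by (rule prime_dvd_add_power_prime[OF assms])
  ultimately have "of_nat p dvd (?a ^ p - ?b ^ p) + (?b ^ p - (u ^ (p ^ k)) ^ p - (v ^ (p ^ k)) ^ p)"
    by (rule dvd_add)
  then show ?case
    by (simp only: power_mult[symmetric] mult.commute[of _ p] power_Suc) (simp add: algebra_simps)
qed simp

text \<open>Each further \<open>p\<close>-th power gains a factor \<open>p\<close>:
  \<open>(1 + y)^p - 1\<close> is \<open>y\<close> times a sum of \<open>p\<close> terms, each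
  congruent to \<open>1\<close> modulo \<open>p\<close>. Hence \<open>1 + p v\<close> becomes
  \<open>1\<close> once a power of \<open>p\<close> vanishes.\<close>

lemma prime_power_dvd_one_plus_power:
  fixes v :: "'a :: comm_ring_1"
  assumes "Factorial_Ring.prime p"
  shows "of_nat (p ^ Suc k) dvd (1 + of_nat p * v) ^ (p ^ k) - 1"
proof (induction k)
  case (Suc k)
  then obtain w where "(1 + of_nat p * v) ^ (p ^ k) - 1 = of_nat (p ^ Suc k) * w" by (auto elim: dvdE)
  then have w: "(1 + of_nat p * v) ^ (p ^ k) = 1 + of_nat (p ^ Suc k) * w" by (simp add: algebra_simps)
  let ?y = "of_nat (p ^ Suc k) * w"
  have "p \<ge> 2" using assms prime_ge_2_nat by blast
  have "(1 + ?y) ^ p - 1 = (\<Sum>i<p. (1 + ?y) ^ i) * ?y"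
    using power_diff_1_eq[of "1 + ?y" p] by simp
  moreover have "of_nat p dvd (\<Sum>i<p. (1 + ?y) ^ i)"
  proof -
    have "of_nat p dvd (1 + ?y) ^ i - 1" for i
    proof -
      have "?y dvd (1 + ?y) ^ i - 1"
        using power_diff_1_eq[of "1 + ?y" i] by simp
      moreover have "of_nat p dvd ?y" by simp
      ultimately show ?thesis by (rule dvd_trans[rotated])
    qed
    then have "of_nat p dvd (\<Sum>i<p. (1 + ?y) ^ i - 1)" by (intro dvd_sum) auto
    then have "of_nat p dvd (\<Sum>i<p. (1 + ?y) ^ i) - of_nat p" by (simp add: sum_subtractf)
    then show ?thesis by (metis diff_add_cancel dvd_add dvd_refl)
  qed
  ultimately have "of_nat p * ?y dvd (1 + ?y) ^ p - 1" by (simp add: mult_dvd_mono)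
  moreover have "of_nat p * ?y = of_nat (p ^ Suc (Suc k)) * w" by (simp add: algebra_simps)
  moreover have "(1 + of_nat p * v) ^ (p ^ Suc k) = (1 + ?y) ^ p"
    by (metis w power_mult power_Suc2)
  ultimately show ?case by (metis dvd_mult_left)
qed simp

section \<open>Nilpotent elements, torsion units and the Jacobson radical\<close>

lemma (in monoid) nat_pow_mod:
  assumes "t \<in> carrier G" "t [^] (m::nat) = \<one>"
  shows "t [^] (i::nat) = t [^] (i mod m)"
proof -
  have "t [^] i = t [^] (m * (i div m) + i mod m)" by simp
  also have "\<dots> = (t [^] m) [^] (i div m) \<otimes> t [^] (i mod m)"
    using assms(1) by (simp only: nat_pow_mult[symmetric] nat_pow_pow[symmetric])
  finally show ?thesis using assms by simp
qed

context ring
begin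

lemma nilpotents_iff: "x \<in> nilpotents R \<longleftrightarrow> x \<in> carrier R \<and> (\<exists>n::nat. x [^] n = \<zero>)"
proof -
  have "\<exists>m::nat. m \<ge> 1 \<and> x [^] m = \<zero>" if x: "x \<in> carrier R" and n: "x [^] n = \<zero>" for n :: nat
  proof -
    have "x [^] Suc n = \<zero>" using x n by simp
    then show ?thesis by (intro exI[of _ "Suc n"]) simp
  qed
  then show ?thesis unfolding nilpotents_def by blast
qed

lemma nilpotents_carrier: "x \<in> nilpotents R \<Longrightarrow> x \<in> carrier R"
  by (simp add: nilpotents_iff)

lemma zero_nilpotent [simp]: "\<zero> \<in> nilpotents R"
  unfolding nilpotents_iff by (metis nat_pow_eone zero_closed)

lemma nilpotent_of_pow:
  assumes "x \<in> carrier R" "x [^] (n::nat) \<in> nilpotents R"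
  shows "x \<in> nilpotents R"
  using assms unfolding nilpotents_iff by (metis nat_pow_pow)

lemma pow_zero_mono:
  assumes "x \<in> carrier R" "x [^] (n::nat) = \<zero>" "n \<le> m"
  shows "x [^] m = \<zero>"
proof -
  have "x [^] n \<otimes> x [^] (m - n) = x [^] m" using assms(1,3) by (simp add: nat_pow_mult)
  then show ?thesis using assms by simp
qed

lemma pow_mult_swap:
  assumes "a \<in> carrier R" "b \<in> carrier R"
  shows "(b \<otimes> a) [^] Suc n = b \<otimes> (a \<otimes> b) [^] n \<otimes> a"
proof (induction n)
  case (Suc n)
  have "(b \<otimes> a) [^] Suc (Suc n) = (b \<otimes> a) [^] Suc n \<otimes> (b \<otimes> a)" by simp
  also have "\<dots> = b \<otimes> ((a \<otimes> b) [^] n \<otimes> (a \<otimes> b)) \<otimes> a"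
    using assms by (subst Suc) (simp add: m_assoc)
  finally show ?case by simp
qed (use assms in simp)

lemma nilpotent_swap:
  assumes "a \<in> carrier R" "b \<in> carrier R" "a \<otimes> b \<in> nilpotents R"
  shows "b \<otimes> a \<in> nilpotents R"
proof -
  obtain n :: nat where "(a \<otimes> b) [^] n = \<zero>" using assms by (auto simp: nilpotents_iff)
  then have "(b \<otimes> a) [^] Suc n = \<zero>" using assms pow_mult_swap[of a b n] by simp
  then show ?thesis using assms unfolding nilpotents_iff by blast
qed

text \<open>\<open>w (u a)\<close> equals \<open>a\<close>, and \<open>nilpotent_swap\<close> moves
  \<open>w\<close> to the other side.\<close>

lemma nilpotent_conj:
  assumes "a \<in> nilpotents R" "u \<in> carrier R" "w \<in> carrier R" "w \<otimes> u = \<one>"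
  shows "u \<otimes> a \<otimes> w \<in> nilpotents R"
proof -
  have a: "a \<in> carrier R" using assms nilpotents_carrier by auto
  then have "w \<otimes> (u \<otimes> a) = a" using assms by (simp add: m_assoc[symmetric])
  then show ?thesis using nilpotent_swap[of w "u \<otimes> a"] assms a by simp
qed

text \<open>The products \<open>y^k x^k\<close> collapse from the inside, without any
  commutation.\<close>

lemma not_nilpotent_of_left_inverse:
  assumes "x \<in> nilpotents R" "y \<in> carrier R" "y \<otimes> x = \<one>"
  shows "\<one> = \<zero>"
proof -
  have x: "x \<in> carrier R" using assms nilpotents_carrier by auto
  obtain n :: nat where n: "x [^] n = \<zero>" using assms by (auto simp: nilpotents_iff)
  have "y [^] k \<otimes> x [^] k = \<one>" for k :: nat
  proof (induction k)
    case (Suc k)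
    have "y [^] Suc k \<otimes> x [^] Suc k = y [^] k \<otimes> y \<otimes> (x \<otimes> x [^] k)"
      using nat_pow_Suc2[OF x, of k] by simp
    also have "\<dots> = y [^] k \<otimes> (y \<otimes> x) \<otimes> x [^] k"
      using assms(2) x by (simp only: m_assoc m_closed nat_pow_closed)
    finally show ?case using Suc assms by simp
  qed simp
  from this[of n] n show ?thesis using assms by simp
qed

lemma torsion_unitI:
  assumes "x \<in> carrier R" "x [^] (m::nat) = \<one>" "m \<ge> 1"
  shows "x \<in> torsion_units R"
proof -
  obtain k where k: "m = Suc k" using assms by (cases m) auto
  have "x [^] k \<otimes> x = \<one>" using assms k by simp
  moreover have "x \<otimes> x [^] k = \<one>" using assms k nat_pow_Suc2 by metis
  ultimately have "x \<in> Units R" using assms by (auto simp: Units_def)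
  then show ?thesis using assms by (auto simp: torsion_units_def)
qed

lemma torsion_unit_not_nilpotent:
  assumes "x \<in> torsion_units R" "x \<in> nilpotents R"
  shows "\<one> = \<zero>"
  using assms not_nilpotent_of_left_inverse[of x "inv x"] by (auto simp: torsion_units_def)

text \<open>The inverse is the geometric series in \<open>- x\<close>, cut off where the powers of
  \<open>x\<close> vanish.\<close>

lemma one_plus_nilpotent_unit:
  assumes "x \<in> nilpotents R"
  shows "\<exists>w\<in>carrier R. w \<otimes> (\<one> \<oplus> x) = \<one> \<and> (\<one> \<oplus> x) \<otimes> w = \<one>"
proof -
  have x: "x \<in> carrier R" using assms nilpotents_carrier by auto
  obtain n :: nat where n: "x [^] n = \<zero>" using assms by (auto simp: nilpotents_iff)
  define Z :: "int poly" where "Z = [:0, 1:]"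
  define S where "S = (\<Sum>i<n. (- Z) ^ i)"
  have "(1 + Z) * S = 1 - (- 1) ^ n * Z ^ n"
    using power_diff_1_eq[of "- Z" n] power_minus[of Z n] unfolding S_def by (simp add: algebra_simps)
  then have "poly_eval R x ((1 + Z) * S) = poly_eval R x (1 - (- 1) ^ n * Z ^ n)" by simp
  then have *: "(\<one> \<oplus> x) \<otimes> poly_eval R x S = \<one>"
    using x n unfolding Z_def
    by (simp only: poly_eval_mult poly_eval_1_plus_X poly_eval_diff poly_eval_X_power poly_eval_1)
      (simp add: minus_eq)
  moreover have "poly_eval R x S \<otimes> (\<one> \<oplus> x) = (\<one> \<oplus> x) \<otimes> poly_eval R x S"
    using poly_eval_commute[OF x, of S "1 + Z"] x unfolding Z_def by (simp only: poly_eval_1_plus_X)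
  ultimately show ?thesis using x by (intro bexI[of _ "poly_eval R x S"]) auto
qed

lemma of_int_power: "int_embed (a ^ n) = int_embed a [^] n"
  by (induction n) (simp_all add: of_int_mult of_int_central)

lemma of_int_nilpotent_mult:
  assumes "int_embed a \<in> nilpotents R" "y \<in> carrier R"
  shows "int_embed a \<otimes> y \<in> nilpotents R"
proof -
  obtain n :: nat where n: "int_embed a [^] n = \<zero>" using assms by (auto simp: nilpotents_iff)
  have "(int_embed a \<otimes> y) [^] n = int_embed a [^] n \<otimes> y [^] n"
    using assms by (intro pow_mult_distrib) (simp_all add: of_int_central)
  then have "(int_embed a \<otimes> y) [^] n = \<zero>" using n assms by simp
  then show ?thesis using assms by (auto simp: nilpotents_iff)
qed

text \<open>Frobenius for the commuting pair \<open>1\<close>, \<open>x\<close>. The error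
  \<open>p y\<close> is a central integer times a ring element, hence nilpotent as soon as
  \<open>p\<close> is.\<close>

lemma one_plus_power_prime_power:
  assumes "Factorial_Ring.prime p" "x \<in> carrier R"
  shows "\<exists>y\<in>carrier R. (\<one> \<oplus> x) [^] (p ^ k) = \<one> \<oplus> x [^] (p ^ k) \<oplus> int_embed (int p) \<otimes> y"
proof -
  let ?X = "[:0, 1:] :: int poly"
  obtain Q where "(1 + ?X) ^ (p ^ k) - 1 ^ (p ^ k) - ?X ^ (p ^ k) = of_nat p * Q"
    using prime_dvd_add_power_prime_power[OF assms(1), of 1 ?X k] by (auto elim: dvdE)
  then have "(1 + ?X) ^ (p ^ k) = 1 + ?X ^ (p ^ k) + smult (int p) Q"
    by (simp add: algebra_simps of_nat_poly)
  then have "poly_eval R x ((1 + ?X) ^ (p ^ k)) = poly_eval R x (1 + ?X ^ (p ^ k) + smult (int p) Q)"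
    by simp
  then have "(\<one> \<oplus> x) [^] (p ^ k) = \<one> \<oplus> x [^] (p ^ k) \<oplus> int_embed (int p) \<otimes> poly_eval R x Q"
    using assms(2)
    by (simp only: poly_eval_power poly_eval_1_plus_X poly_eval_smult poly_eval_add poly_eval_1 poly_eval_X)
  then show ?thesis using assms(2) by blast
qed

text \<open>Frobenius leaves \<open>x^(p^k) + p y = 0\<close>, so a power of \<open>x\<close> is a
  multiple of the nilpotent integer \<open>p\<close>.\<close>

lemma nilpotent_of_one_plus_torsion:
  assumes p: "Factorial_Ring.prime p" "int_embed (int p) \<in> nilpotents R"
    and x: "x \<in> carrier R" "(\<one> \<oplus> x) [^] (p ^ k) = \<one>"
  shows "x \<in> nilpotents R"
proof -
  obtain y where y: "y \<in> carrier R"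
    "(\<one> \<oplus> x) [^] (p ^ k) = \<one> \<oplus> x [^] (p ^ k) \<oplus> int_embed (int p) \<otimes> y"
    using one_plus_power_prime_power[OF p(1) x(1)] by blast
  let ?z = "x [^] (p ^ k)" and ?c = "int_embed (int p)"
  have c: "?z \<in> carrier R" "?c \<otimes> y \<in> carrier R" using x y by auto
  have "\<one> \<oplus> (?z \<oplus> ?c \<otimes> y) = \<one> \<oplus> \<zero>" using y(2) x(2) c by (simp add: a_assoc)
  then have "?z \<oplus> ?c \<otimes> y = \<zero>" using c by (simp only: a_closed zero_closed one_closed add.l_cancel)
  then have "?z = ?c \<otimes> (\<ominus> y)" using c y(1) by (simp add: minus_equality r_minus)
  moreover have "?c \<otimes> (\<ominus> y) \<in> nilpotents R" using of_int_nilpotent_mult p(2) y(1) by simp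
  ultimately show ?thesis using nilpotent_of_pow[OF x(1)] by metis
qed

text \<open>Two stages: an exponent \<open>p^n\<close> makes the power of \<open>x\<close> vanish
  and leaves \<open>1 + p y\<close>; a second exponent \<open>p^c\<close>, with
  \<open>p^c = 0\<close> in the ring, removes \<open>p y\<close> by
  \<open>prime_power_dvd_one_plus_power\<close>.\<close>

lemma one_plus_nilpotent_torsion:
  assumes p: "Factorial_Ring.prime p" "int_embed (int p) \<in> nilpotents R"
    and x: "x \<in> nilpotents R"
  shows "\<exists>k. (\<one> \<oplus> x) [^] (p ^ k) = \<one>"
proof -
  have xc: "x \<in> carrier R" using x nilpotents_carrier by auto
  have p1: "p > 1" using p(1) prime_gt_1_nat by blast
  obtain n :: nat where n: "x [^] n = \<zero>" using x by (auto simp: nilpotents_iff)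
  have "x [^] (p ^ n) = \<zero>"
    using pow_zero_mono[OF xc n, of "p ^ n"] p1 by (simp add: less_imp_le less_exp power_strict_mono)
  with one_plus_power_prime_power[OF p(1) xc, of n]
  obtain y where y: "y \<in> carrier R" "(\<one> \<oplus> x) [^] (p ^ n) = \<one> \<oplus> int_embed (int p) \<otimes> y"
    by auto
  obtain c :: nat where c: "int_embed (int p) [^] c = \<zero>" using p(2) by (auto simp: nilpotents_iff)
  let ?X = "[:0, 1:] :: int poly"
  obtain Q where "(1 + of_nat p * ?X) ^ (p ^ c) - 1 = of_nat (p ^ Suc c) * Q"
    using prime_power_dvd_one_plus_power[OF p(1), of c ?X] by (auto elim: dvdE)
  then have "(1 + smult (int p) ?X) ^ (p ^ c) = 1 + smult (int p ^ Suc c) Q"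
    by (simp add: algebra_simps of_nat_poly)
  then have "poly_eval R y ((1 + smult (int p) ?X) ^ (p ^ c)) = poly_eval R y (1 + smult (int p ^ Suc c) Q)"
    by simp
  then have "(\<one> \<oplus> int_embed (int p) \<otimes> y) [^] (p ^ c) = \<one> \<oplus> int_embed (int p ^ Suc c) \<otimes> poly_eval R y Q"
    using y(1)
    by (simp only: poly_eval_power poly_eval_smult poly_eval_add poly_eval_1 poly_eval_X)
  moreover have "int_embed (int p ^ Suc c) = \<zero>"
    using c by (simp only: of_int_power nat_pow_Suc) simp
  ultimately have "(\<one> \<oplus> int_embed (int p) \<otimes> y) [^] (p ^ c) = \<one>" using y(1) by simp
  then have "(\<one> \<oplus> x) [^] (p ^ n * p ^ c) = \<one>" using y(2) xc nat_pow_pow[of "\<one> \<oplus> x" "p ^ n" "p ^ c"] by simp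
  then show ?thesis by (metis power_add)
qed

section \<open>Maximal left ideals and invertibility modulo the Jacobson radical\<close>

lemma left_ideal_extends_to_maximal:
  assumes "left_ideal L R" "\<one> \<notin> L"
  shows "\<exists>M. maximal_left_ideal M R \<and> L \<subseteq> M"
proof -
  \<comment> \<open>Properness is expressed by \<open>\<one> \<notin> I\<close>, a condition that
    passes to unions of chains.\<close>
  let ?A = "{I. left_ideal I R \<and> L \<subseteq> I \<and> \<one> \<notin> I}"
  have "\<exists>M\<in>?A. \<forall>I\<in>?A. M \<subseteq> I \<longrightarrow> I = M"
  proof (rule subset_Zorn_nonempty)
    show "?A \<noteq> {}" using assms by auto
  next
    fix C assume C: "C \<noteq> {}" "subset.chain ?A C"
    then have CA: "\<And>I. I \<in> C \<Longrightarrow> left_ideal I R \<and> L \<subseteq> I \<and> \<one> \<notin> I"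
      by (auto simp: subset.chain_def)
    have lin: "\<And>I J. I \<in> C \<Longrightarrow> J \<in> C \<Longrightarrow> I \<subseteq> J \<or> J \<subseteq> I"
      using C(2) by (auto simp: subset.chain_def)
    have "additive_subgroup (\<Union>C) R"
    proof (rule additive_subgroup.intro, rule add.subgroupI)
      show "\<Union>C \<subseteq> carrier R" using CA additive_subgroup.a_subset unfolding left_ideal_def by blast
      show "\<Union>C \<noteq> {}" using C(1) CA by (auto simp: left_ideal_def dest!: additive_subgroup.zero_closed)
      show "\<ominus> a \<in> \<Union>C" if "a \<in> \<Union>C" for a
        using that CA add.subgroupE(3)[OF additive_subgroup.a_subgroup]
        unfolding left_ideal_def a_inv_def by blast
      fix a b assume "a \<in> \<Union>C" "b \<in> \<Union>C"
      then obtain I J where IJ: "I \<in> C" "J \<in> C" "a \<in> I" "b \<in> J" by auto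
      then obtain K where "K \<in> C" "a \<in> K" "b \<in> K" using lin by blast
      then show "a \<oplus> b \<in> \<Union>C" using CA
        unfolding left_ideal_def by (metis Union_iff additive_subgroup.a_closed)
    qed
    then have "left_ideal (\<Union>C) R" using CA unfolding left_ideal_def by blast
    moreover have "L \<subseteq> \<Union>C" using C(1) CA by auto
    ultimately show "\<Union>C \<in> ?A" using CA by auto
  qed
  then obtain M where M: "left_ideal M R" "L \<subseteq> M" "\<one> \<notin> M"
    and max: "\<And>I. left_ideal I R \<Longrightarrow> L \<subseteq> I \<Longrightarrow> \<one> \<notin> I \<Longrightarrow> M \<subseteq> I \<Longrightarrow> I = M" by auto
  have "J = M \<or> J = carrier R" if J: "left_ideal J R" "M \<subseteq> J" for J
  proof (cases "\<one> \<in> J")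
    case True
    have "r \<in> J" if "r \<in> carrier R" for r
      using J(1) True that unfolding left_ideal_def by (metis r_one)
    moreover have "J \<subseteq> carrier R"
      using J(1) unfolding left_ideal_def by (auto dest: additive_subgroup.a_Hcarr)
    ultimately show ?thesis by auto
  next
    case False
    then show ?thesis using max J M(2) by blast
  qed
  moreover have "M \<noteq> carrier R" using M(3) by auto
  ultimately show ?thesis using M unfolding maximal_left_ideal_def by blast
qed

lemma left_idealI:
  assumes "L \<subseteq> carrier R" "\<zero> \<in> L" "\<And>x y. x \<in> L \<Longrightarrow> y \<in> L \<Longrightarrow> x \<oplus> y \<in> L"
    and mult: "\<And>a x. a \<in> carrier R \<Longrightarrow> x \<in> L \<Longrightarrow> a \<otimes> x \<in> L"
  shows "left_ideal L R"
proof -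
  have "\<ominus> x \<in> L" if "x \<in> L" for x
    using mult[of "\<ominus> \<one>" x] that assms(1) by (auto simp: l_minus)
  then have "subgroup L (add_monoid R)"
    using assms by (intro add.subgroupI) auto
  then show ?thesis using mult by (auto simp: left_ideal_def intro: additive_subgroup.intro)
qed

lemma principal_left_ideal:
  assumes "z \<in> carrier R"
  shows "left_ideal {y \<otimes> z |y. y \<in> carrier R} R"
proof (rule left_idealI)
  show "\<zero> \<in> {y \<otimes> z |y. y \<in> carrier R}" using assms by (auto intro!: exI[of _ "\<zero>"])
next
  fix x y assume "x \<in> {y \<otimes> z |y. y \<in> carrier R}" "y \<in> {y \<otimes> z |y. y \<in> carrier R}"
  then obtain a b where "a \<in> carrier R" "b \<in> carrier R" "x = a \<otimes> z" "y = b \<otimes> z" by auto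
  then show "x \<oplus> y \<in> {y \<otimes> z |y. y \<in> carrier R}"
    using assms by (auto intro!: exI[of _ "a \<oplus> b"] simp: l_distr)
next
  fix a x assume "a \<in> carrier R" "x \<in> {y \<otimes> z |y. y \<in> carrier R}"
  then show "a \<otimes> x \<in> {y \<otimes> z |y. y \<in> carrier R}"
    using assms by (auto simp: m_assoc[symmetric])
qed (use assms in auto)

lemma jacobson_radical_carrier: "x \<in> jacobson_radical R \<Longrightarrow> x \<in> carrier R"
  by (simp add: jacobson_radical_def)

lemma left_ideal_jacobson_radical: "left_ideal (jacobson_radical R) R"
  by (rule left_idealI)
    (auto simp: jacobson_radical_def maximal_left_ideal_def left_ideal_def
      intro: additive_subgroup.zero_closed additive_subgroup.a_closed)

text \<open>Otherwise the left ideal generated by \<open>1 + x\<close> lies in a maximal one; that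
  one contains \<open>x\<close> as well, hence \<open>1\<close>.\<close>

lemma jacobson_radical_left_inverse:
  assumes "x \<in> jacobson_radical R"
  shows "\<exists>y\<in>carrier R. y \<otimes> (\<one> \<oplus> x) = \<one>"
proof (rule ccontr)
  assume no: "\<not> ?thesis"
  have x: "x \<in> carrier R" using assms jacobson_radical_carrier by auto
  let ?L = "{y \<otimes> (\<one> \<oplus> x) |y. y \<in> carrier R}"
  have "\<one> \<notin> ?L" using no by auto
  then obtain M where M: "maximal_left_ideal M R" "?L \<subseteq> M"
    using left_ideal_extends_to_maximal principal_left_ideal[of "\<one> \<oplus> x"] x by blast
  have "x \<in> M" using assms M(1) by (auto simp: jacobson_radical_def)
  moreover have "\<one> \<oplus> x \<in> M" using M(2) x by (auto intro!: set_mp[OF M(2)] exI[of _ "\<one>"])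
  ultimately have "(\<one> \<oplus> x) \<oplus> (\<ominus> \<one>) \<otimes> x \<in> M"
    using M(1) unfolding maximal_left_ideal_def left_ideal_def
    by (meson additive_subgroup.a_closed a_inv_closed one_closed)
  moreover have "(\<one> \<oplus> x) \<oplus> (\<ominus> \<one>) \<otimes> x = \<one>" using x by algebra
  ultimately have "\<one> \<in> M" by simp
  then have "carrier R \<subseteq> M"
    using M(1) unfolding maximal_left_ideal_def left_ideal_def by (metis r_one subsetI)
  then show False using M(1) unfolding maximal_left_ideal_def left_ideal_def
    by (metis additive_subgroup.a_subset subset_antisym)
qed

text \<open>If \<open>x\<close> avoids a maximal left ideal \<open>M\<close>, then
  \<open>M + R x\<close> is the whole ring, so \<open>1 = m + a x\<close>. Then
  \<open>m = 1 - a x\<close> is left invertible and lies in \<open>M\<close>, a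
  contradiction.\<close>

lemma jacobson_radicalI:
  assumes x: "x \<in> carrier R" and inv: "\<And>a. a \<in> carrier R \<Longrightarrow> \<exists>y\<in>carrier R. y \<otimes> (\<one> \<oplus> a \<otimes> x) = \<one>"
  shows "x \<in> jacobson_radical R"
  unfolding jacobson_radical_def
proof (intro CollectI conjI allI impI, rule x)
  fix M assume M: "maximal_left_ideal M R"
  then have L: "left_ideal M R" and M': "M \<noteq> carrier R" unfolding maximal_left_ideal_def by auto
  have Mc: "M \<subseteq> carrier R" using L by (simp add: left_ideal_def additive_subgroup.a_subset)
  have zM: "\<zero> \<in> M" using L by (simp add: left_ideal_def additive_subgroup.zero_closed)
  have addM: "\<And>a b. a \<in> M \<Longrightarrow> b \<in> M \<Longrightarrow> a \<oplus> b \<in> M" using L by (simp add: left_ideal_def additive_subgroup.a_closed)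
  have mulM: "\<And>a b. a \<in> carrier R \<Longrightarrow> b \<in> M \<Longrightarrow> a \<otimes> b \<in> M" using L by (simp add: left_ideal_def)
  let ?J = "{m \<oplus> a \<otimes> x |m a. m \<in> M \<and> a \<in> carrier R}"
  have "left_ideal ?J R"
  proof (rule left_idealI)
    show "?J \<subseteq> carrier R" using x Mc by auto
    show "\<zero> \<in> ?J" using zM x by (intro CollectI exI[of _ "\<zero>"]) simp
  next
    fix u v assume "u \<in> ?J" "v \<in> ?J"
    then obtain m a n b where *: "m \<in> M" "a \<in> carrier R" "n \<in> M" "b \<in> carrier R"
      "u = m \<oplus> a \<otimes> x" "v = n \<oplus> b \<otimes> x" by auto
    then have "m \<in> carrier R" "n \<in> carrier R" using Mc by auto
    then have "u \<oplus> v = (m \<oplus> n) \<oplus> (a \<oplus> b) \<otimes> x" using * x by algebra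
    then show "u \<oplus> v \<in> ?J" using * addM by blast
  next
    fix c u assume c: "c \<in> carrier R" and "u \<in> ?J"
    then obtain m a where *: "m \<in> M" "a \<in> carrier R" "u = m \<oplus> a \<otimes> x" by auto
    then have "m \<in> carrier R" using Mc by auto
    then have "c \<otimes> u = c \<otimes> m \<oplus> (c \<otimes> a) \<otimes> x" using * x c by algebra
    then show "c \<otimes> u \<in> ?J" using * mulM c by blast
  qed
  moreover have MJ: "M \<subseteq> ?J"
  proof
    fix m assume "m \<in> M"
    then show "m \<in> ?J" using x Mc by (intro CollectI exI[of _ m] exI[of _ "\<zero>"]) auto
  qed
  ultimately have "?J = M \<or> ?J = carrier R" using M unfolding maximal_left_ideal_def by blast
  then show "x \<in> M"
  proof
    assume "?J = M"
    moreover have "x \<in> ?J" using x zM by (intro CollectI exI[of _ "\<zero>"] exI[of _ "\<one>"]) simp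
    ultimately show ?thesis by simp
  next
    assume "?J = carrier R"
    then obtain m a where *: "m \<in> M" "a \<in> carrier R" "\<one> = m \<oplus> a \<otimes> x" using one_closed by blast
    then have mc: "m \<in> carrier R" using Mc by auto
    obtain y where y: "y \<in> carrier R" "y \<otimes> (\<one> \<oplus> (\<ominus> a) \<otimes> x) = \<one>" using inv[of "\<ominus> a"] * by auto
    have "\<one> \<oplus> (\<ominus> a) \<otimes> x = m" using * x mc by (simp add: l_minus a_assoc r_neg)
    then have "\<one> \<in> M" using y mulM * by metis
    then have "carrier R \<subseteq> M" using mulM by (metis r_one subsetI)
    then show ?thesis using Mc M' by auto
  qed
qed

lemma one_not_in_jacobson_radical:
  assumes "\<one> \<noteq> \<zero>"
  shows "\<one> \<notin> jacobson_radical R"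
proof
  assume "\<one> \<in> jacobson_radical R"
  then have "\<ominus> \<one> \<otimes> \<one> \<in> jacobson_radical R"
    using left_ideal_jacobson_radical unfolding left_ideal_def by blast
  then show False using jacobson_radical_left_inverse[of "\<ominus> \<one>"] assms by (auto simp: r_neg)
qed

lemma zero_in_jacobson_radical: "\<zero> \<in> jacobson_radical R"
  using left_ideal_jacobson_radical unfolding left_ideal_def
  by (auto intro: additive_subgroup.zero_closed)

text \<open>This shift carries facts proved outside the radical over to its elements, since
  \<open>x = (1 + x) - 1\<close>.\<close>

lemma one_plus_not_in_jacobson_radical:
  assumes "\<one> \<noteq> \<zero>" "x \<in> jacobson_radical R"
  shows "\<one> \<oplus> x \<notin> jacobson_radical R"
proof
  assume *: "\<one> \<oplus> x \<in> jacobson_radical R"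
  have x: "x \<in> carrier R" using assms jacobson_radical_carrier by auto
  have "(\<one> \<oplus> x) \<oplus> (\<ominus> \<one>) \<otimes> x \<in> jacobson_radical R"
    using left_ideal_jacobson_radical assms(2) * unfolding left_ideal_def
    by (meson additive_subgroup.a_closed a_inv_closed one_closed)
  moreover have "(\<one> \<oplus> x) \<oplus> (\<ominus> \<one>) \<otimes> x = \<one>" using x by algebra
  ultimately show False using one_not_in_jacobson_radical assms by simp
qed

end

section \<open>Rings in which the nilpotent elements form a subgroup\<close>

locale nr_ring = ring +
  assumes nilpotents_subgroup: "additive_subgroup (nilpotents R) R"
begin

lemma nilpotents_add: "x \<in> nilpotents R \<Longrightarrow> y \<in> nilpotents R \<Longrightarrow> x \<oplus> y \<in> nilpotents R"
  using nilpotents_subgroup by (rule additive_subgroup.a_closed)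

lemma nilpotents_uminus: "x \<in> nilpotents R \<Longrightarrow> \<ominus> x \<in> nilpotents R"
  using add.subgroupE(3)[OF additive_subgroup.a_subgroup[OF nilpotents_subgroup]]
  unfolding a_inv_def by blast

lemma nilpotents_minus: "x \<in> nilpotents R \<Longrightarrow> y \<in> nilpotents R \<Longrightarrow> x \<ominus> y \<in> nilpotents R"
  unfolding minus_eq by (intro nilpotents_add nilpotents_uminus)

text \<open>A left multiple of a nilpotent element cannot be a unit, since the nilpotent element
  would be left invertible; so the nilpotents form a left ideal. A proper left ideal contains no
  unit and hence lies in it. It is therefore the only maximal left ideal and equals the radical, and
  a torsion unit plus a nilpotent stays outside it.\<close>

lemma generalized_t_fineI:
  assumes one_zero: "\<one> \<noteq> \<zero>" and cover: "carrier R = torsion_units R \<union> nilpotents R"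
  shows "generalized_t_fine R"
proof -
  let ?N = "nilpotents R" and ?T = "torsion_units R"
  have disj: "?T \<inter> ?N = {}" using torsion_unit_not_nilpotent one_zero by blast
  have mult: "a \<otimes> x \<in> ?N" if "a \<in> carrier R" "x \<in> ?N" for a x
  proof (rule ccontr)
    have xc: "x \<in> carrier R" using that nilpotents_carrier by auto
    assume "a \<otimes> x \<notin> ?N"
    then have "a \<otimes> x \<in> Units R" using cover that(1) xc by (auto simp: torsion_units_def)
    then have w: "inv (a \<otimes> x) \<in> carrier R" "inv (a \<otimes> x) \<otimes> (a \<otimes> x) = \<one>"
      by (rule Units_inv_closed, rule Units_l_inv)
    then have "inv (a \<otimes> x) \<otimes> a \<otimes> x = \<one>" using that(1) xc by (simp only: m_assoc)
    then have "\<one> = \<zero>"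
      by (rule not_nilpotent_of_left_inverse[OF that(2) m_closed[OF w(1) that(1)]])
    then show False using one_zero by simp
  qed
  have left: "left_ideal ?N R" using nilpotents_subgroup mult by (auto simp: left_ideal_def)
  have proper: "L \<subseteq> ?N" if L: "left_ideal L R" "L \<noteq> carrier R" for L
  proof
    fix x assume x: "x \<in> L"
    have Lc: "L \<subseteq> carrier R" using L(1) by (simp add: left_ideal_def additive_subgroup.a_subset)
    have "x \<notin> Units R"
    proof
      assume "x \<in> Units R"
      then have "inv x \<otimes> x = \<one>" "inv x \<in> carrier R" by auto
      then have "\<one> \<in> L" using L(1) x unfolding left_ideal_def by metis
      then have "carrier R \<subseteq> L" using L(1) unfolding left_ideal_def by (metis r_one subsetI)
      then show False using L(2) Lc by auto
    qed
    then show "x \<in> ?N" using x Lc cover by (auto simp: torsion_units_def)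
  qed
  have "\<one> \<notin> ?N" using not_nilpotent_of_left_inverse[OF _ one_closed r_one] one_zero by blast
  then have "?N \<noteq> carrier R" by auto
  have "maximal_left_ideal ?N R"
    unfolding maximal_left_ideal_def using left \<open>?N \<noteq> carrier R\<close> proper by blast
  moreover have "\<And>M. maximal_left_ideal M R \<Longrightarrow> M = ?N"
    using proper left \<open>?N \<noteq> carrier R\<close> unfolding maximal_left_ideal_def by metis
  ultimately have J: "jacobson_radical R = ?N"
    unfolding jacobson_radical_def using nilpotents_carrier by blast
  have "?T <+>\<^bsub>R\<^esub> ?N = ?T"
  proof
    show "?T \<subseteq> ?T <+>\<^bsub>R\<^esub> ?N"
    proof
      fix u assume u: "u \<in> ?T"
      then have "u = u \<oplus> \<zero>" by (auto simp: torsion_units_def)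
      then show "u \<in> ?T <+>\<^bsub>R\<^esub> ?N" using u zero_nilpotent unfolding set_add_def' by blast
    qed
    show "?T <+>\<^bsub>R\<^esub> ?N \<subseteq> ?T"
    proof
      fix x assume "x \<in> ?T <+>\<^bsub>R\<^esub> ?N"
      then obtain u n where un: "u \<in> ?T" "n \<in> ?N" "x = u \<oplus> n" by (auto simp: set_add_def')
      have c: "u \<in> carrier R" "n \<in> carrier R" using un nilpotents_carrier by (auto simp: torsion_units_def)
      have "x \<notin> ?N"
      proof
        assume "x \<in> ?N"
        then have "x \<oplus> (\<ominus> n) \<in> ?N"
          using un(2) nilpotents_add nilpotents_uminus by blast
        moreover have "x \<oplus> (\<ominus> n) = u" using c un(3) by algebra
        ultimately show False using un(1) disj by auto
      qed
      then show "x \<in> ?T" using cover c un(3) by blast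
    qed
  qed
  then show ?thesis unfolding generalized_t_fine_def J using cover disj by blast
qed

text \<open>The largest nil ideal. That it is all of \<open>nilpotents R\<close> when \<open>R\<close> is generalized t-fine is
  proved by showing that the quotient by it has no nonzero element of square zero.\<close>

definition upper_nil :: "'a set" where
  "upper_nil = {y \<in> carrier R. \<forall>r\<in>carrier R. r \<otimes> y \<in> nilpotents R}"

lemma upper_nilI: "y \<in> carrier R \<Longrightarrow> (\<And>r. r \<in> carrier R \<Longrightarrow> r \<otimes> y \<in> nilpotents R) \<Longrightarrow> y \<in> upper_nil"
  by (simp add: upper_nil_def)

lemma upper_nil_carrier: "y \<in> upper_nil \<Longrightarrow> y \<in> carrier R"
  by (simp add: upper_nil_def)

lemma upper_nil_nilpotent: "y \<in> upper_nil \<Longrightarrow> y \<in> nilpotents R"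
  unfolding upper_nil_def by (metis (no_types, lifting) l_one mem_Collect_eq one_closed)

lemma upper_nil_add: "x \<in> upper_nil \<Longrightarrow> y \<in> upper_nil \<Longrightarrow> x \<oplus> y \<in> upper_nil"
  by (auto simp: upper_nil_def r_distr nilpotents_add)

lemma upper_nil_lmult: "a \<in> carrier R \<Longrightarrow> y \<in> upper_nil \<Longrightarrow> a \<otimes> y \<in> upper_nil"
  by (auto simp: upper_nil_def m_assoc[symmetric])

text \<open>\<open>upper_nil\<close> is defined by left multiples; \<open>nilpotent_swap\<close>
  makes it two-sided.\<close>

lemma upper_nil_rmult:
  assumes "a \<in> carrier R" "y \<in> upper_nil"
  shows "y \<otimes> a \<in> upper_nil"
proof (rule upper_nilI)
  have y: "y \<in> carrier R" using assms upper_nil_carrier by auto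
  then show "y \<otimes> a \<in> carrier R" using assms by simp
  fix r assume r: "r \<in> carrier R"
  have "(a \<otimes> r) \<otimes> y \<in> nilpotents R" using assms r by (auto simp: upper_nil_def)
  then have "a \<otimes> (r \<otimes> y) \<in> nilpotents R" using assms r y by (simp add: m_assoc)
  then have "(r \<otimes> y) \<otimes> a \<in> nilpotents R" using nilpotent_swap[of a "r \<otimes> y"] assms r y by simp
  then show "r \<otimes> (y \<otimes> a) \<in> nilpotents R" using assms r y by (simp add: m_assoc)
qed

lemma square_upper_nil_nilpotent:
  assumes "a \<in> carrier R" "a \<otimes> a \<in> upper_nil"
  shows "a \<in> nilpotents R"
proof -
  have "a [^] (2::nat) \<in> nilpotents R"
    using upper_nil_nilpotent[OF assms(2)] assms(1) by (simp add: numeral_2_eq_2)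
  then show ?thesis using nilpotent_of_pow assms(1) by blast
qed

text \<open>Modulo \<open>upper_nil\<close> the inverse of \<open>1 + a\<close> is
  \<open>1 - a\<close>, so \<open>(1 + a) b (1 - a)\<close> is a conjugate of \<open>b\<close>.
  Subtracting \<open>b\<close> and adding the nilpotent \<open>a b a\<close> leaves the commutator
  \<open>c = a b - b a\<close>, which is thus nilpotent, and the powers of \<open>a b\<close> are
  controlled by those of \<open>c\<close>.\<close>

lemma square_upper_nil_mult:
  assumes a: "a \<in> carrier R" "a \<otimes> a \<in> upper_nil" and b: "b \<in> nilpotents R"
  shows "a \<otimes> b \<in> nilpotents R"
proof -
  have bc: "b \<in> carrier R" using b nilpotents_carrier by auto
  obtain w where w: "w \<in> carrier R" "w \<otimes> (\<one> \<oplus> a) = \<one>"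
    using one_plus_nilpotent_unit[OF square_upper_nil_nilpotent[OF a]] by blast
  have "w \<otimes> ((\<one> \<oplus> a) \<otimes> (\<one> \<ominus> a)) = \<one> \<ominus> a"
    using w a(1) by (simp add: m_assoc[symmetric])
  moreover have "(\<one> \<oplus> a) \<otimes> (\<one> \<ominus> a) = \<one> \<ominus> a \<otimes> a"
    using a(1) r_one[OF a(1)] by algebra
  ultimately have "w \<otimes> (\<one> \<ominus> a \<otimes> a) = \<one> \<ominus> a" by simp
  \<comment> \<open>The exact inverse \<open>w\<close> differs from \<open>1 - a\<close> by
    \<open>w a a\<close>, an element of \<open>upper_nil\<close>.\<close>
  moreover have "w = w \<otimes> (\<one> \<ominus> a \<otimes> a) \<oplus> w \<otimes> (a \<otimes> a)"
    using w(1) a(1) r_one[OF w(1)] by algebra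
  ultimately have w': "w = (\<one> \<ominus> a) \<oplus> w \<otimes> (a \<otimes> a)" by simp
  have conj: "(\<one> \<oplus> a) \<otimes> b \<otimes> w \<in> nilpotents R"
    using nilpotent_conj[OF b _ w(1) w(2)] a(1) by simp
  have "(\<one> \<oplus> a) \<otimes> b \<otimes> (w \<otimes> (a \<otimes> a)) \<in> nilpotents R"
    using a(1) bc by (intro upper_nil_nilpotent upper_nil_lmult[OF _ upper_nil_lmult[OF w(1) a(2)]]) auto
  then have "(\<one> \<oplus> a) \<otimes> b \<otimes> w \<ominus> (\<one> \<oplus> a) \<otimes> b \<otimes> (w \<otimes> (a \<otimes> a)) \<in> nilpotents R"
    by (intro nilpotents_minus conj)
  moreover have "(\<one> \<oplus> a) \<otimes> b \<otimes> w \<ominus> (\<one> \<oplus> a) \<otimes> b \<otimes> (w \<otimes> (a \<otimes> a))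
    = (\<one> \<oplus> a) \<otimes> b \<otimes> (w \<ominus> w \<otimes> (a \<otimes> a))" using a(1) bc w(1) by algebra
  moreover have "w \<ominus> w \<otimes> (a \<otimes> a) = \<one> \<ominus> a"
  proof -
    have "((\<one> \<ominus> a) \<oplus> w \<otimes> (a \<otimes> a)) \<ominus> w \<otimes> (a \<otimes> a) = \<one> \<ominus> a" using a(1) w(1) by algebra
    then show ?thesis using w' by simp
  qed
  ultimately have 1: "(\<one> \<oplus> a) \<otimes> b \<otimes> (\<one> \<ominus> a) \<in> nilpotents R" by simp
  have "(a \<otimes> b \<otimes> a) \<otimes> (a \<otimes> b \<otimes> a) = (a \<otimes> b) \<otimes> (a \<otimes> a) \<otimes> (b \<otimes> a)"
    using a(1) bc by (simp add: m_assoc)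
  moreover have "(a \<otimes> b) \<otimes> (a \<otimes> a) \<otimes> (b \<otimes> a) \<in> upper_nil"
    using a(1) bc by (intro upper_nil_rmult[OF _ upper_nil_lmult[OF _ a(2)]]) auto
  ultimately have 2: "a \<otimes> b \<otimes> a \<in> nilpotents R"
    using square_upper_nil_nilpotent[of "a \<otimes> b \<otimes> a"] a(1) bc by simp
  define c where "c = a \<otimes> b \<ominus> b \<otimes> a"
  have cc: "c \<in> carrier R" using a(1) bc by (simp add: c_def)
  have "(\<one> \<oplus> a) \<otimes> b \<otimes> (\<one> \<ominus> a) \<ominus> b \<oplus> a \<otimes> b \<otimes> a \<in> nilpotents R"
    by (intro nilpotents_add nilpotents_minus 1 2 b)
  moreover have "(\<one> \<oplus> a) \<otimes> b \<otimes> (\<one> \<ominus> a) \<ominus> b \<oplus> a \<otimes> b \<otimes> a = c"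
    unfolding c_def using a(1) bc r_one[OF bc] r_one[OF m_closed[OF a(1) bc]] by algebra
  ultimately obtain n :: nat where n: "c [^] n = \<zero>" by (auto simp: nilpotents_iff)
  \<comment> \<open>modulo \<open>upper_nil\<close>, \<open>(a b)\<^sup>2 = c (a b)\<close> since \<open>b a a b\<close> vanishes\<close>
  have pow: "\<exists>i\<in>upper_nil. (a \<otimes> b) [^] Suc k = c [^] k \<otimes> (a \<otimes> b) \<oplus> i" for k :: nat
  proof (induction k)
    case 0
    have "\<zero> \<in> upper_nil" by (auto intro!: upper_nilI)
    then show ?case using a(1) bc by (intro bexI[of _ \<zero>]) auto
  next
    case (Suc k)
    then obtain i where i: "i \<in> upper_nil" "(a \<otimes> b) [^] Suc k = c [^] k \<otimes> (a \<otimes> b) \<oplus> i" by auto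
    have ic: "i \<in> carrier R" using i upper_nil_carrier by auto
    define C where "C = c [^] k"
    have Cc: "C \<in> carrier R" using cc by (simp add: C_def)
    let ?j = "C \<otimes> (b \<otimes> (a \<otimes> a) \<otimes> b) \<oplus> i \<otimes> (a \<otimes> b)"
    have "(a \<otimes> b) [^] Suc (Suc k) = (C \<otimes> (a \<otimes> b) \<oplus> i) \<otimes> (a \<otimes> b)"
      using i(2) unfolding C_def by simp
    also have "\<dots> = (C \<otimes> c) \<otimes> (a \<otimes> b) \<oplus> ?j"
      unfolding c_def using a(1) bc ic Cc by algebra
    finally have "(a \<otimes> b) [^] Suc (Suc k) = c [^] Suc k \<otimes> (a \<otimes> b) \<oplus> ?j" by (simp add: C_def)
    moreover have "?j \<in> upper_nil"
      using upper_nil_lmult[OF Cc upper_nil_rmult[OF bc upper_nil_lmult[OF bc a(2)]]]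
        upper_nil_rmult[OF m_closed[OF a(1) bc] i(1)] by (rule upper_nil_add)
    ultimately show ?case by blast
  qed
  obtain i where "i \<in> upper_nil" "(a \<otimes> b) [^] Suc n = c [^] n \<otimes> (a \<otimes> b) \<oplus> i" using pow by blast
  then have "(a \<otimes> b) [^] Suc n \<in> nilpotents R"
    using n a(1) bc upper_nil_nilpotent upper_nil_carrier by simp
  then show ?thesis using nilpotent_of_pow a(1) bc by blast
qed

text \<open>Collect the factors \<open>u\<close> of \<open>(u a)^k\<close> on the right. The
  remaining factor stays nilpotent: one more step turns \<open>n\<close> into the conjugate
  \<open>u (a n) u^(-1)\<close>, and \<open>a n\<close> is nilpotent by
  \<open>square_upper_nil_mult\<close>. At the order of \<open>u\<close> the collected power is
  \<open>1\<close>.\<close>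

lemma square_upper_nil_torsion_mult:
  assumes a: "a \<in> carrier R" "a \<otimes> a \<in> upper_nil" and u: "u \<in> torsion_units R"
  shows "u \<otimes> a \<in> nilpotents R"
proof -
  obtain m :: nat where m: "m \<ge> 1" "u [^] m = \<one>" and U: "u \<in> Units R"
    using u by (auto simp: torsion_units_def)
  have uc: "u \<in> carrier R" "inv u \<in> carrier R" "inv u \<otimes> u = \<one>" using U by auto
  have "\<exists>n\<in>nilpotents R. (u \<otimes> a) [^] Suc k = n \<otimes> u [^] Suc k" for k :: nat
  proof (induction k)
    case 0
    have "u \<otimes> a \<otimes> inv u \<in> nilpotents R"
      using nilpotent_conj[OF square_upper_nil_nilpotent[OF a]] uc by blast
    moreover have "u \<otimes> a = u \<otimes> a \<otimes> inv u \<otimes> u" using a(1) uc by (simp add: m_assoc)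
    ultimately show ?case using a(1) uc by (intro bexI[of _ "u \<otimes> a \<otimes> inv u"]) auto
  next
    case (Suc k)
    then obtain n where n: "n \<in> nilpotents R" "(u \<otimes> a) [^] Suc k = n \<otimes> u [^] Suc k" by auto
    have nc: "n \<in> carrier R" using n nilpotents_carrier by auto
    have "u \<otimes> (a \<otimes> n) \<otimes> inv u \<in> nilpotents R"
      using nilpotent_conj[OF square_upper_nil_mult[OF a n(1)]] uc by blast
    moreover have "(u \<otimes> a) [^] Suc (Suc k) = (u \<otimes> (a \<otimes> n) \<otimes> inv u) \<otimes> u [^] Suc (Suc k)"
    proof -
      have "(u \<otimes> a) [^] Suc (Suc k) = (u \<otimes> a) \<otimes> (n \<otimes> u [^] Suc k)"
        using nat_pow_Suc2[of "u \<otimes> a" "Suc k"] n(2) a(1) uc by simp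
      also have "\<dots> = (u \<otimes> (a \<otimes> n)) \<otimes> (inv u \<otimes> u) \<otimes> u [^] Suc k"
        using a(1) uc nc by (simp add: m_assoc)
      also have "\<dots> = (u \<otimes> (a \<otimes> n) \<otimes> inv u) \<otimes> (u \<otimes> u [^] Suc k)"
        using a(1) uc(1,2) nc by (simp only: m_assoc m_closed nat_pow_closed)
      also have "u \<otimes> u [^] Suc k = u [^] Suc (Suc k)" using nat_pow_Suc2[OF uc(1)] by metis
      finally show ?thesis .
    qed
    ultimately show ?case by blast
  qed
  from this[of "m - 1"] m have "(u \<otimes> a) [^] m \<in> nilpotents R"
    using nilpotents_carrier by auto
  then show ?thesis using nilpotent_of_pow a(1) uc by blast
qed

end

text \<open>Besides \<open>1 \<noteq> 0\<close> this asks only for decompositions outside the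
  radical, which is what the augmentation hands down from \<open>RG\<close>. The converse inclusion
  is recovered later through \<open>generalized_t_fineI\<close>.\<close>

locale t_fine_ring = nr_ring +
  assumes one_not_zero: "\<one> \<noteq> \<zero>"
    and torsion_plus_nilpotent: "x \<in> carrier R \<Longrightarrow> x \<notin> jacobson_radical R \<Longrightarrow>
      \<exists>u\<in>torsion_units R. \<exists>n\<in>nilpotents R. x = u \<oplus> n"
begin

lemma square_upper_nil_imp_upper_nil:
  assumes a: "a \<in> carrier R" "a \<otimes> a \<in> upper_nil"
  shows "a \<in> upper_nil"
proof -
  have outside: "r \<otimes> a \<in> nilpotents R" if r: "r \<in> carrier R" "r \<notin> jacobson_radical R" for r
  proof -
    obtain u n where un: "u \<in> torsion_units R" "n \<in> nilpotents R" "r = u \<oplus> n"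
      using torsion_plus_nilpotent[OF r] by auto
    have c: "u \<in> carrier R" "n \<in> carrier R" using un nilpotents_carrier by (auto simp: torsion_units_def)
    have "n \<otimes> a \<in> nilpotents R"
      using nilpotent_swap[OF a(1) c(2)] square_upper_nil_mult[OF a un(2)] by blast
    then show ?thesis
      using square_upper_nil_torsion_mult[OF a un(1)] un(3) c a(1) by (simp add: l_distr nilpotents_add)
  qed
  show ?thesis
  proof (rule upper_nilI)
    fix r assume r: "r \<in> carrier R"
    show "r \<otimes> a \<in> nilpotents R"
    proof (cases "r \<in> jacobson_radical R")
      case True
      \<comment> \<open>\<open>1 + r\<close> is outside the radical, where the claim is known; the
        extra \<open>a\<close> is nilpotent and is subtracted.\<close>
      then have "(\<one> \<oplus> r) \<otimes> a \<in> nilpotents R"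
        using outside one_plus_not_in_jacobson_radical one_not_zero r by simp
      then have "(\<one> \<oplus> r) \<otimes> a \<ominus> a \<in> nilpotents R"
        using square_upper_nil_nilpotent[OF a] nilpotents_minus by blast
      moreover have "(\<one> \<oplus> r) \<otimes> a \<ominus> a = r \<otimes> a" using r a(1) by algebra
      ultimately show ?thesis by simp
    qed (use outside r in auto)
  qed (rule a(1))
qed

text \<open>\<open>upper_nil\<close> is closed under square roots: start from a vanishing power with
  exponent \<open>2^n\<close> and halve the exponent repeatedly.\<close>

lemma upper_nil_eq: "upper_nil = nilpotents R"
proof
  show "upper_nil \<subseteq> nilpotents R" using upper_nil_nilpotent by auto
  show "nilpotents R \<subseteq> upper_nil"
  proof
    fix a assume "a \<in> nilpotents R"
    then obtain n :: nat where a: "a \<in> carrier R" and n: "a [^] n = \<zero>" by (auto simp: nilpotents_iff)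
    have "a [^] (2 ^ k :: nat) \<in> upper_nil \<Longrightarrow> a \<in> upper_nil" for k :: nat
    proof (induction k)
      case (Suc k)
      have "a [^] (2 ^ k :: nat) \<otimes> a [^] (2 ^ k :: nat) = a [^] (2 ^ Suc k :: nat)"
        using a by (simp add: nat_pow_mult mult_2)
      then show ?case using Suc square_upper_nil_imp_upper_nil[of "a [^] (2 ^ k :: nat)"] a by simp
    qed (use a in simp)
    moreover have "a [^] (2 ^ n :: nat) = \<zero>" using pow_zero_mono[OF a n] less_exp less_imp_le by metis
    moreover have "\<zero> \<in> upper_nil" by (auto intro!: upper_nilI)
    ultimately show "a \<in> upper_nil" by metis
  qed
qed

lemma nilpotents_lmult: "a \<in> carrier R \<Longrightarrow> x \<in> nilpotents R \<Longrightarrow> a \<otimes> x \<in> nilpotents R"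
  using upper_nil_lmult by (simp add: upper_nil_eq)

lemma nilpotents_rmult: "a \<in> carrier R \<Longrightarrow> x \<in> nilpotents R \<Longrightarrow> x \<otimes> a \<in> nilpotents R"
  using upper_nil_rmult by (simp add: upper_nil_eq)

text \<open>The nilpotents are now a two-sided ideal, so modulo them \<open>x\<close> is the torsion
  unit \<open>u\<close>.\<close>

lemma power_minus_one_nilpotent:
  assumes "x \<in> carrier R" "x \<notin> jacobson_radical R"
  shows "\<exists>m\<ge>1. x [^] (m::nat) \<ominus> \<one> \<in> nilpotents R"
proof -
  obtain u n where un: "u \<in> torsion_units R" "n \<in> nilpotents R" "x = u \<oplus> n"
    using torsion_plus_nilpotent[OF assms] by auto
  have c: "u \<in> carrier R" "n \<in> carrier R" using un nilpotents_carrier by (auto simp: torsion_units_def)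
  have "x [^] k \<ominus> u [^] k \<in> nilpotents R" for k :: nat
  proof (induction k)
    case (Suc k)
    define y where "y = x [^] k"
    define v where "v = u [^] k"
    have yv: "y \<in> carrier R" "v \<in> carrier R" using assms(1) c by (auto simp: y_def v_def)
    have "(y \<ominus> v) \<otimes> u \<oplus> y \<otimes> n \<in> nilpotents R"
      using nilpotents_rmult[OF c(1) Suc] nilpotents_lmult[OF yv(1) un(2)]
      unfolding y_def v_def by (rule nilpotents_add)
    moreover have "(y \<ominus> v) \<otimes> u \<oplus> y \<otimes> n = y \<otimes> (u \<oplus> n) \<ominus> v \<otimes> u" using yv c by algebra
    ultimately show ?case using un(3) by (simp add: y_def v_def)
  qed (simp add: r_neg minus_eq)
  moreover obtain m :: nat where "m \<ge> 1" "u [^] m = \<one>" using un(1) by (auto simp: torsion_units_def)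
  ultimately show ?thesis by metis
qed

lemma inverse_outside_jacobson_radical:
  assumes x: "x \<in> carrier R" "x \<notin> jacobson_radical R"
  shows "\<exists>y\<in>carrier R. x \<otimes> y = \<one>"
proof -
  obtain m :: nat where m: "m \<ge> 1" "x [^] m \<ominus> \<one> \<in> nilpotents R"
    using power_minus_one_nilpotent[OF x] by blast
  then obtain w where w: "w \<in> carrier R" "(\<one> \<oplus> (x [^] m \<ominus> \<one>)) \<otimes> w = \<one>"
    using one_plus_nilpotent_unit by blast
  obtain k where k: "m = Suc k" using m(1) by (cases m) auto
  have "\<one> \<oplus> (x [^] m \<ominus> \<one>) = x [^] m"
  proof -
    have "x [^] m \<in> carrier R" using x by simp
    then show ?thesis by algebra
  qed
  also have "x [^] m = x \<otimes> x [^] k" using nat_pow_Suc2 x k by metis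
  finally have "x \<otimes> (x [^] k \<otimes> w) = \<one>" using w x by (simp add: m_assoc)
  then show ?thesis using x w by blast
qed

section \<open>Integers in the radical, a nilpotent prime, and the dichotomy\<close>

lemma jacobson_add: "x \<in> jacobson_radical R \<Longrightarrow> y \<in> jacobson_radical R \<Longrightarrow> x \<oplus> y \<in> jacobson_radical R"
  using left_ideal_jacobson_radical unfolding left_ideal_def by (auto intro: additive_subgroup.a_closed)

lemma jacobson_lmult: "a \<in> carrier R \<Longrightarrow> y \<in> jacobson_radical R \<Longrightarrow> a \<otimes> y \<in> jacobson_radical R"
  using left_ideal_jacobson_radical unfolding left_ideal_def by auto

text \<open>\<open>2\<close> and \<open>3\<close> are not both in the radical, as their difference
  is \<open>1\<close>. For the one outside, some \<open>t^m - 1\<close> is nilpotent, and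
  \<open>t \<ge> 2\<close> makes this integer positive.\<close>

lemma positive_int_nilpotent: "\<exists>N::nat. N \<ge> 1 \<and> int_embed (int N) \<in> nilpotents R"
proof -
  have "\<exists>t\<in>{2, 3::nat}. int_embed (int t) \<notin> jacobson_radical R"
  proof (rule ccontr)
    assume "\<not> ?thesis"
    then have "int_embed 2 \<in> jacobson_radical R" "int_embed 3 \<in> jacobson_radical R" by auto
    then have "int_embed 3 \<oplus> int_embed (-1) \<otimes> int_embed 2 \<in> jacobson_radical R"
      by (intro jacobson_add jacobson_lmult) auto
    moreover have "int_embed 3 \<oplus> int_embed (-1) \<otimes> int_embed 2 = int_embed 1"
      by (simp only: of_int_mult[symmetric] of_int_add[symmetric]) simp
    ultimately show False using one_not_in_jacobson_radical one_not_zero by simp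
  qed
  then obtain t :: nat where "t \<in> {2, 3}" and t': "int_embed (int t) \<notin> jacobson_radical R" by blast
  then have t: "t \<ge> 2" by auto
  then obtain m :: nat where m: "m \<ge> 1" "int_embed (int t) [^] m \<ominus> \<one> \<in> nilpotents R"
    using power_minus_one_nilpotent[of "int_embed (int t)"] t' by auto
  have "t \<le> t ^ m" using t m(1) by (intro self_le_power) auto
  then have "t ^ m \<ge> 2" using t by linarith
  have "int_embed (int t) [^] m \<ominus> \<one> = int_embed (int t ^ m + (-1))"
    by (simp only: of_int_power of_int_add) (simp add: minus_eq add.int_pow_neg)
  also have "int t ^ m + (-1) = int (t ^ m - 1)" using \<open>t ^ m \<ge> 2\<close> by (simp add: of_nat_diff)
  finally show ?thesis using m(2) \<open>t ^ m \<ge> 2\<close> by (intro exI[of _ "t ^ m - 1"]) simp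
qed

text \<open>Let \<open>N = p b\<close> be the least positive nilpotent integer. Outside the radical
  \<open>p\<close> could be cancelled, making the smaller \<open>b\<close> nilpotent; so
  \<open>p\<close> is in the radical. If \<open>p\<close> divides \<open>b\<close>, then
  \<open>b^2\<close> is a multiple of \<open>N\<close> and again \<open>b\<close> is nilpotent.
  Otherwise Bezout puts \<open>b\<close> outside the radical, and cancelling \<open>b\<close> leaves
  \<open>p\<close>.\<close>

lemma prime_nilpotent: "\<exists>p::nat. Factorial_Ring.prime p \<and> int_embed (int p) \<in> nilpotents R"
proof -
  let ?P = "\<lambda>N::nat. N \<ge> 1 \<and> int_embed (int N) \<in> nilpotents R"
  define N where "N = (LEAST N. ?P N)"
  have N: "N \<ge> 1" "int_embed (int N) \<in> nilpotents R"
    using LeastI_ex[OF positive_int_nilpotent] unfolding N_def by auto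
  have min: "N \<le> M" if "M \<ge> 1" "int_embed (int M) \<in> nilpotents R" for M
    using that unfolding N_def by (intro Least_le) auto
  have "N \<noteq> 1"
    using N(2) not_nilpotent_of_left_inverse[of \<one> \<one>] one_not_zero by auto
  then obtain p where p: "Factorial_Ring.prime p" "p dvd N" using prime_factor_nat by blast
  then obtain b where b: "N = p * b" by (elim dvdE)
  have p2: "p \<ge> 2" using p(1) prime_ge_2_nat by blast
  have "b \<noteq> 0" using b N(1) by (intro notI) simp
  then have b1: "b \<ge> 1" "b < N" using p2 unfolding b by simp_all
  have cancel: "int_embed (int c) \<in> nilpotents R"
    if h: "int_embed (int (a * c)) \<in> nilpotents R" "int_embed (int a) \<notin> jacobson_radical R" for a c
  proof -
    obtain y where y: "y \<in> carrier R" "int_embed (int a) \<otimes> y = \<one>"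
      using inverse_outside_jacobson_radical[OF _ h(2)] by auto
    have "int_embed (int (a * c)) \<otimes> y \<in> nilpotents R" using h(1) y(1) by (rule of_int_nilpotent_mult)
    moreover have "int_embed (int (a * c)) \<otimes> y = int_embed (int c)"
      using y of_int_mult[of "int c" "int a"] by (simp add: mult.commute m_assoc)
    ultimately show ?thesis by simp
  qed
  have pJ: "int_embed (int p) \<in> jacobson_radical R"
  proof (rule ccontr)
    assume "\<not> ?thesis"
    then have "int_embed (int b) \<in> nilpotents R" using cancel[of p b] N(2) b by simp
    then show False using min[of b] b1 by linarith
  qed
  show ?thesis
  proof (cases "p dvd b")
    case True
    then obtain c where c: "b = p * c" by (elim dvdE)
    have "int_embed (int b) [^] (2::nat) = int_embed (int N) \<otimes> int_embed (int c)"
      by (simp only: of_int_power[symmetric] of_int_mult[symmetric]) (simp add: b c power2_eq_square ac_simps)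
    then have "int_embed (int b) [^] (2::nat) \<in> nilpotents R"
      using of_int_nilpotent_mult[OF N(2), of "int_embed (int c)"] by simp
    then have "int_embed (int b) \<in> nilpotents R" using nilpotent_of_pow[of "int_embed (int b)"] by simp
    then show ?thesis using min[of b] b1 by linarith
  next
    case False
    then have "coprime (int p) (int b)" using p(1) by (simp add: prime_imp_coprime)
    then obtain u v where uv: "u * int p + v * int b = 1" using bezout_int[of "int p" "int b"] by auto
    have "int_embed (int b) \<notin> jacobson_radical R"
    proof
      assume "int_embed (int b) \<in> jacobson_radical R"
      then have "int_embed u \<otimes> int_embed (int p) \<oplus> int_embed v \<otimes> int_embed (int b) \<in> jacobson_radical R"
        using pJ by (intro jacobson_add jacobson_lmult) auto
      then have "int_embed (u * int p + v * int b) \<in> jacobson_radical R" by (simp only: of_int_add of_int_mult)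
      then show False using uv one_not_in_jacobson_radical one_not_zero by simp
    qed
    then have "int_embed (int p) \<in> nilpotents R" using cancel[of b p] N(2) b by (simp add: mult.commute)
    then show ?thesis using p(1) by blast
  qed
qed

lemma torsion_outside_jacobson_radical:
  assumes x: "x \<in> carrier R" "x \<notin> jacobson_radical R"
  shows "\<exists>m\<ge>1. x [^] (m::nat) = \<one>"
proof -
  obtain p where p: "Factorial_Ring.prime p" "int_embed (int p) \<in> nilpotents R" using prime_nilpotent by blast
  obtain m :: nat where m: "m \<ge> 1" "x [^] m \<ominus> \<one> \<in> nilpotents R"
    using power_minus_one_nilpotent[OF x] by blast
  then obtain k where k: "(\<one> \<oplus> (x [^] m \<ominus> \<one>)) [^] (p ^ k) = \<one>"
    using one_plus_nilpotent_torsion[OF p] by blast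
  have "\<one> \<oplus> (x [^] m \<ominus> \<one>) = x [^] m"
  proof -
    have "x [^] m \<in> carrier R" using x by simp
    then show ?thesis by algebra
  qed
  then have "x [^] (m * p ^ k) = \<one>" using k x(1) by (simp add: nat_pow_pow)
  moreover have "m * p ^ k \<ge> 1" using m(1) p(1) prime_gt_0_nat by (simp add: Suc_le_eq)
  ultimately show ?thesis by blast
qed

text \<open>\<open>1 + x\<close> is outside the radical, hence torsion, and its powers repeat.
  Frobenius transfers this to \<open>x\<close> and makes \<open>x^q (1 - x^d)\<close> nilpotent with
  \<open>d \<ge> 1\<close>. The second factor has a right inverse because \<open>x^d\<close> is in
  the radical, so it can be removed.\<close>

lemma jacobson_radical_nilpotent:
  assumes x: "x \<in> jacobson_radical R"
  shows "x \<in> nilpotents R"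
proof -
  obtain p where p: "Factorial_Ring.prime p" "int_embed (int p) \<in> nilpotents R" using prime_nilpotent by blast
  have xc: "x \<in> carrier R" using x jacobson_radical_carrier by auto
  define y where "y = \<one> \<oplus> x"
  have y: "y \<in> carrier R" "y \<notin> jacobson_radical R"
    using xc one_plus_not_in_jacobson_radical[OF one_not_zero x] by (auto simp: y_def)
  then obtain m :: nat where m: "m \<ge> 1" "y [^] m = \<one>" using torsion_outside_jacobson_radical by blast
  have red: "y [^] k = y [^] (k mod m)" for k :: nat using nat_pow_mod[OF y(1) m(2)] .
  \<comment> \<open>\<open>y\<^bsup>p^i\<^esup> = y\<^bsup>p^j\<^esup>\<close> for some \<open>i < j\<close>; by Frobenius the same holds for \<open>x\<close> modulo nilpotents\<close>
  have "\<not> inj (\<lambda>i::nat. p ^ i mod m)"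
  proof
    assume "inj (\<lambda>i::nat. p ^ i mod m)"
    moreover have "range (\<lambda>i::nat. p ^ i mod m) \<subseteq> {..<m}" using m(1) by auto
    ultimately show False by (meson finite_imageD finite_lessThan finite_subset infinite_UNIV_nat)
  qed
  then obtain i j :: nat where ij: "i < j" "p ^ i mod m = p ^ j mod m"
    unfolding inj_def by (metis nat_neq_iff)
  define q where "q = p ^ i"
  define d where "d = p ^ j - p ^ i"
  have "p ^ i < p ^ j" using ij(1) p(1) prime_gt_1_nat by (simp add: power_strict_increasing)
  then have d: "d \<ge> 1" "p ^ j = q + d" by (auto simp: d_def q_def)
  have yy: "y [^] (p ^ i) = y [^] (p ^ j)" using red ij(2) by metis
  obtain r where r: "r \<in> carrier R" "y [^] (p ^ i) = \<one> \<oplus> x [^] (p ^ i) \<oplus> int_embed (int p) \<otimes> r"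
    using one_plus_power_prime_power[OF p(1) xc] unfolding y_def by blast
  obtain s where s: "s \<in> carrier R" "y [^] (p ^ j) = \<one> \<oplus> x [^] (p ^ j) \<oplus> int_embed (int p) \<otimes> s"
    using one_plus_power_prime_power[OF p(1) xc] unfolding y_def by blast
  define c where "c = int_embed (int p)"
  define V where "V = x [^] q"
  define Y where "Y = x [^] d"
  have cc: "c \<in> carrier R" "V \<in> carrier R" "Y \<in> carrier R" using xc by (auto simp: c_def V_def Y_def)
  have "x [^] (p ^ j) = V \<otimes> Y" using d(2) xc by (simp add: V_def Y_def nat_pow_mult)
  then have eq: "\<one> \<oplus> V \<oplus> c \<otimes> r = \<one> \<oplus> V \<otimes> Y \<oplus> c \<otimes> s"
    using r(2) s(2) yy unfolding c_def V_def q_def by simp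
  have "V \<otimes> (\<one> \<ominus> Y) = (\<one> \<oplus> V \<oplus> c \<otimes> r) \<ominus> (\<one> \<oplus> V \<otimes> Y \<oplus> c \<otimes> s) \<oplus> c \<otimes> (s \<ominus> r)"
    using cc r(1) s(1) r_one[OF cc(2)] by algebra
  also have "(\<one> \<oplus> V \<oplus> c \<otimes> r) \<ominus> (\<one> \<oplus> V \<otimes> Y \<oplus> c \<otimes> s) = \<zero>"
    unfolding eq using cc s(1) by (simp add: minus_eq r_neg)
  finally have "V \<otimes> (\<one> \<ominus> Y) = c \<otimes> (s \<ominus> r)" using cc r(1) s(1) by simp
  then have XY: "V \<otimes> (\<one> \<ominus> Y) \<in> nilpotents R"
    using of_int_nilpotent_mult[OF p(2), of "s \<ominus> r"] r(1) s(1) by (simp add: c_def)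
  obtain e where e: "d = Suc e" using d(1) by (cases d) auto
  have "\<ominus> (x [^] e) \<otimes> x \<in> jacobson_radical R" using x xc by (intro jacobson_lmult) auto
  moreover have "\<ominus> (x [^] e) \<otimes> x = \<ominus> Y" using xc by (simp add: Y_def e l_minus)
  ultimately have "\<one> \<ominus> Y \<notin> jacobson_radical R"
    using one_plus_not_in_jacobson_radical[OF one_not_zero, of "\<ominus> Y"] by (simp add: minus_eq)
  then obtain z where z: "z \<in> carrier R" "(\<one> \<ominus> Y) \<otimes> z = \<one>"
    using inverse_outside_jacobson_radical[of "\<one> \<ominus> Y"] cc(3) by auto
  have "V \<otimes> (\<one> \<ominus> Y) \<otimes> z \<in> nilpotents R" using z(1) XY by (rule nilpotents_rmult)
  then have "V \<in> nilpotents R" using z cc by (simp add: m_assoc)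
  then show ?thesis using nilpotent_of_pow xc unfolding V_def by blast
qed

lemma carrier_eq_torsion_Un_nilpotent: "carrier R = torsion_units R \<union> nilpotents R"
proof
  show "carrier R \<subseteq> torsion_units R \<union> nilpotents R"
    using jacobson_radical_nilpotent torsion_outside_jacobson_radical torsion_unitI by blast
  show "torsion_units R \<union> nilpotents R \<subseteq> carrier R"
    using nilpotents_carrier by (auto simp: torsion_units_def)
qed

end

section \<open>The group ring\<close>

lemma (in abelian_monoid) finsum_swap:
  assumes "finite A" "finite B" "\<And>x y. x \<in> A \<Longrightarrow> y \<in> B \<Longrightarrow> f x y \<in> carrier G"
  shows "(\<Oplus>x\<in>A. \<Oplus>y\<in>B. f x y) = (\<Oplus>y\<in>B. \<Oplus>x\<in>A. f x y)"
  using assms(1,3)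
proof (induction A rule: finite_induct)
  case (insert a A)
  have "(\<Oplus>x\<in>insert a A. \<Oplus>y\<in>B. f x y) = (\<Oplus>y\<in>B. f a y) \<oplus> (\<Oplus>x\<in>A. \<Oplus>y\<in>B. f x y)"
    using insert(1,2,4) assms(2) by (intro finsum_insert) (auto intro!: finsum_closed)
  also have "\<dots> = (\<Oplus>y\<in>B. f a y) \<oplus> (\<Oplus>y\<in>B. \<Oplus>x\<in>A. f x y)" using insert(3,4) by simp
  also have "\<dots> = (\<Oplus>y\<in>B. f a y \<oplus> (\<Oplus>x\<in>A. f x y))"
    using insert(1,2,4) assms(2) by (intro finsum_addf[symmetric]) (auto intro!: finsum_closed)
  also have "\<dots> = (\<Oplus>y\<in>B. \<Oplus>x\<in>insert a A. f x y)"
  proof (rule finsum_cong')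
    fix y assume "y \<in> B"
    then show "f a y \<oplus> (\<Oplus>x\<in>A. f x y) = (\<Oplus>x\<in>insert a A. f x y)"
      using insert(1,2,4) assms(2) by (intro finsum_insert[symmetric]) auto
  qed (use insert(1,2,4) assms(2) in \<open>auto intro!: finsum_closed\<close>)
  finally show ?case .
qed simp

text \<open>The monomial \<open>c g\<close>: with \<open>g\<close> the identity it embeds the
  scalars, with \<open>c = 1\<close> the group.\<close>

definition group_ring_single :: "('a, 'm) ring_scheme \<Rightarrow> 'g \<Rightarrow> 'a \<Rightarrow> 'g \<Rightarrow> 'a" where
  "group_ring_single R g c = (\<lambda>x. if x = g then c else \<zero>\<^bsub>R\<^esub>)"

definition augmentation :: "('a, 'm) ring_scheme \<Rightarrow> ('g, 'n) monoid_scheme \<Rightarrow> ('g \<Rightarrow> 'a) \<Rightarrow> 'a" where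
  "augmentation R G f = (\<Oplus>\<^bsub>R\<^esub>x\<in>{x \<in> carrier G. f x \<noteq> \<zero>\<^bsub>R\<^esub>}. f x)"

locale group_over_ring = R: ring R + G: group G for R (structure) and G (structure)
begin

abbreviation RG where "RG \<equiv> group_ring R G"
abbreviation single where "single \<equiv> group_ring_single R"
abbreviation supp where "supp f \<equiv> {x \<in> carrier G. f x \<noteq> \<zero>}"

lemma group_ring_carrier_iff: "f \<in> carrier RG \<longleftrightarrow>
    (\<forall>g\<in>carrier G. f g \<in> carrier R) \<and> (\<forall>g. g \<notin> carrier G \<longrightarrow> f g = \<zero>) \<and> finite (supp f)"
  by (simp add: group_ring_def)

lemma group_ring_carrierI:
  assumes "\<And>g. g \<in> carrier G \<Longrightarrow> f g \<in> carrier R" "\<And>g. g \<notin> carrier G \<Longrightarrow> f g = \<zero>" "finite (supp f)"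
  shows "f \<in> carrier RG"
  using assms by (simp add: group_ring_carrier_iff)

lemma group_ring_coeff_outside: "f \<in> carrier RG \<Longrightarrow> g \<notin> carrier G \<Longrightarrow> f g = \<zero>"
  by (simp add: group_ring_carrier_iff)

lemma group_ring_finite_supp: "f \<in> carrier RG \<Longrightarrow> finite (supp f)"
  by (simp add: group_ring_carrier_iff)

lemma group_ring_coeff: "f \<in> carrier RG \<Longrightarrow> f g \<in> carrier R"
  by (cases "g \<in> carrier G") (auto simp: group_ring_carrier_iff)

lemma group_ring_mult_def: "(f \<otimes>\<^bsub>RG\<^esub> h) x =
    (if x \<in> carrier G then \<Oplus>y\<in>supp f. f y \<otimes> h (inv\<^bsub>G\<^esub> y \<otimes>\<^bsub>G\<^esub> x) else \<zero>)"
  by (simp add: group_ring_def)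

lemma group_ring_zero: "\<zero>\<^bsub>RG\<^esub> = (\<lambda>x. \<zero>)"
  unfolding group_ring_def ring.simps ..

lemma group_ring_one: "\<one>\<^bsub>RG\<^esub> = single \<one>\<^bsub>G\<^esub> \<one>"
  unfolding group_ring_def group_ring_single_def monoid.simps ..

lemma group_ring_add_apply:
  assumes "f \<in> carrier RG" "h \<in> carrier RG"
  shows "(f \<oplus>\<^bsub>RG\<^esub> h) x = f x \<oplus> h x"
  using assms group_ring_coeff_outside[of f x] group_ring_coeff_outside[of h x]
    group_ring_coeff[of f x] group_ring_coeff[of h x]
  by (simp add: group_ring_def)

declare group_ring_coeff [simp]

text \<open>The defining sum runs over the exact support, which changes under addition and
  multiplication; a common finite superset lets sums be combined.\<close>

lemma group_ring_mult_apply: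
  assumes "f \<in> carrier RG" "h \<in> carrier RG" "finite Y" "supp f \<subseteq> Y" "Y \<subseteq> carrier G" "x \<in> carrier G"
  shows "(f \<otimes>\<^bsub>RG\<^esub> h) x = (\<Oplus>y\<in>Y. f y \<otimes> h (inv\<^bsub>G\<^esub> y \<otimes>\<^bsub>G\<^esub> x))"
proof -
  have "(f \<otimes>\<^bsub>RG\<^esub> h) x = (\<Oplus>y\<in>supp f. f y \<otimes> h (inv\<^bsub>G\<^esub> y \<otimes>\<^bsub>G\<^esub> x))"
    using assms(6) by (simp only: group_ring_mult_def if_True)
  also have "\<dots> = (\<Oplus>y\<in>Y. f y \<otimes> h (inv\<^bsub>G\<^esub> y \<otimes>\<^bsub>G\<^esub> x))"
  proof (rule R.add.finprod_mono_neutral_cong_left)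
    show "f y \<otimes> h (inv\<^bsub>G\<^esub> y \<otimes>\<^bsub>G\<^esub> x) = \<zero>" if "y \<in> Y - supp f" for y
      using that assms by auto
  qed (use assms in auto)
  finally show ?thesis .
qed

lemma group_ring_mult_outside: "x \<notin> carrier G \<Longrightarrow> (f \<otimes>\<^bsub>RG\<^esub> h) x = \<zero>"
  by (simp only: group_ring_mult_def if_False)

lemma group_ring_eqI:
  assumes "f \<in> carrier RG" "h \<in> carrier RG" "\<And>x. x \<in> carrier G \<Longrightarrow> f x = h x"
  shows "f = h"
proof
  show "f x = h x" for x
    using assms(3) group_ring_coeff_outside[OF assms(1), of x] group_ring_coeff_outside[OF assms(2), of x]
    by (cases "x \<in> carrier G") auto
qed

lemma single_apply: "single g c x = (if x = g then c else \<zero>)"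
  by (simp add: group_ring_single_def)

lemma group_ring_zero_closed: "\<zero>\<^bsub>RG\<^esub> \<in> carrier RG"
  by (rule group_ring_carrierI) (simp_all add: group_ring_zero)

lemma single_closed [simp, intro]:
  assumes "g \<in> carrier G" "c \<in> carrier R"
  shows "single g c \<in> carrier RG"
proof -
  have "supp (single g c) \<subseteq> {g}" by (auto simp: single_apply)
  then have "finite (supp (single g c))" by (rule finite_subset) simp
  then show ?thesis using assms by (intro group_ring_carrierI) (auto simp: single_apply)
qed

lemma group_ring_add_closed:
  assumes "f \<in> carrier RG" "h \<in> carrier RG"
  shows "f \<oplus>\<^bsub>RG\<^esub> h \<in> carrier RG"
proof -
  have "supp (f \<oplus>\<^bsub>RG\<^esub> h) \<subseteq> supp f \<union> supp h"
    using group_ring_add_apply[OF assms] by auto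
  then have "finite (supp (f \<oplus>\<^bsub>RG\<^esub> h))"
    by (rule finite_subset) (use assms group_ring_finite_supp in auto)
  then show ?thesis
    using assms group_ring_coeff_outside[OF assms(1)] group_ring_coeff_outside[OF assms(2)]
    by (intro group_ring_carrierI) (auto simp: group_ring_add_apply)
qed

lemma supp_mult:
  assumes "f \<in> carrier RG" "h \<in> carrier RG"
  shows "supp (f \<otimes>\<^bsub>RG\<^esub> h) \<subseteq> (\<lambda>(y, z). y \<otimes>\<^bsub>G\<^esub> z) ` (supp f \<times> supp h)"
proof
  fix x assume x: "x \<in> supp (f \<otimes>\<^bsub>RG\<^esub> h)"
  then have xG: "x \<in> carrier G" by simp
  have "\<exists>y\<in>supp f. h (inv\<^bsub>G\<^esub> y \<otimes>\<^bsub>G\<^esub> x) \<noteq> \<zero>"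
  proof (rule ccontr)
    assume "\<not> ?thesis"
    then have "(\<Oplus>y\<in>supp f. f y \<otimes> h (inv\<^bsub>G\<^esub> y \<otimes>\<^bsub>G\<^esub> x)) = (\<Oplus>y\<in>supp f. \<zero>)"
      using assms by (intro R.finsum_cong') auto
    then show False
      using x xG group_ring_mult_apply[OF assms, of "supp f" x] group_ring_finite_supp[OF assms(1)] by simp
  qed
  then obtain y where y: "y \<in> supp f" "h (inv\<^bsub>G\<^esub> y \<otimes>\<^bsub>G\<^esub> x) \<noteq> \<zero>" by auto
  then have "x = y \<otimes>\<^bsub>G\<^esub> (inv\<^bsub>G\<^esub> y \<otimes>\<^bsub>G\<^esub> x)" using xG by (simp add: G.m_assoc[symmetric])
  then show "x \<in> (\<lambda>(y, z). y \<otimes>\<^bsub>G\<^esub> z) ` (supp f \<times> supp h)" using y xG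
    by (intro image_eqI[of _ _ "(y, inv\<^bsub>G\<^esub> y \<otimes>\<^bsub>G\<^esub> x)"]) auto
qed

lemma finite_supp_product:
  assumes "f \<in> carrier RG" "h \<in> carrier RG"
  shows "finite ((\<lambda>(y, z). y \<otimes>\<^bsub>G\<^esub> z) ` (supp f \<times> supp h))"
  using assms group_ring_finite_supp by auto

lemma group_ring_mult_closed:
  assumes "f \<in> carrier RG" "h \<in> carrier RG"
  shows "f \<otimes>\<^bsub>RG\<^esub> h \<in> carrier RG"
proof -
  have "(f \<otimes>\<^bsub>RG\<^esub> h) x \<in> carrier R" if "x \<in> carrier G" for x
    using group_ring_mult_apply[OF assms group_ring_finite_supp[OF assms(1)] order_refl _ that] assms
    by (auto intro!: R.finsum_closed)
  moreover have "finite (supp (f \<otimes>\<^bsub>RG\<^esub> h))"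
    using supp_mult[OF assms] finite_supp_product[OF assms] by (rule finite_subset)
  ultimately show ?thesis using group_ring_mult_outside by (intro group_ring_carrierI) auto
qed

lemma single_mult_apply:
  assumes "g \<in> carrier G" "c \<in> carrier R" "f \<in> carrier RG" "x \<in> carrier G"
  shows "(single g c \<otimes>\<^bsub>RG\<^esub> f) x = c \<otimes> f (inv\<^bsub>G\<^esub> g \<otimes>\<^bsub>G\<^esub> x)"
proof -
  have "(single g c \<otimes>\<^bsub>RG\<^esub> f) x = (\<Oplus>y\<in>{g}. single g c y \<otimes> f (inv\<^bsub>G\<^esub> y \<otimes>\<^bsub>G\<^esub> x))"
    using assms by (intro group_ring_mult_apply) (auto simp: single_apply)
  then show ?thesis using assms by (simp add: single_apply)
qed

lemma mult_single_apply:
  assumes "g \<in> carrier G" "c \<in> carrier R" "f \<in> carrier RG" "x \<in> carrier G"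
  shows "(f \<otimes>\<^bsub>RG\<^esub> single g c) x = f (x \<otimes>\<^bsub>G\<^esub> inv\<^bsub>G\<^esub> g) \<otimes> c"
proof -
  let ?h = "x \<otimes>\<^bsub>G\<^esub> inv\<^bsub>G\<^esub> g"
  \<comment> \<open>Only the index \<open>x g^(-1)\<close> contributes; it is inserted because it
    may lie outside the support of \<open>f\<close>.\<close>
  have "(f \<otimes>\<^bsub>RG\<^esub> single g c) x = (\<Oplus>y\<in>insert ?h (supp f). f y \<otimes> single g c (inv\<^bsub>G\<^esub> y \<otimes>\<^bsub>G\<^esub> x))"
    using assms group_ring_finite_supp by (intro group_ring_mult_apply) auto
  also have "\<dots> = (\<Oplus>y\<in>{?h}. f y \<otimes> single g c (inv\<^bsub>G\<^esub> y \<otimes>\<^bsub>G\<^esub> x))"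
  proof (rule R.add.finprod_mono_neutral_cong_right)
    fix y assume y: "y \<in> insert ?h (supp f) - {?h}"
    then have yG: "y \<in> carrier G" using assms by auto
    have "inv\<^bsub>G\<^esub> y \<otimes>\<^bsub>G\<^esub> x \<noteq> g"
    proof
      assume "inv\<^bsub>G\<^esub> y \<otimes>\<^bsub>G\<^esub> x = g"
      then have "y \<otimes>\<^bsub>G\<^esub> g = x" using yG assms by (simp add: G.m_assoc[symmetric] flip: \<open>_ = g\<close>)
      then have "y = ?h" using yG assms by (simp add: G.m_assoc flip: \<open>_ = x\<close>)
      then show False using y by auto
    qed
    then show "f y \<otimes> single g c (inv\<^bsub>G\<^esub> y \<otimes>\<^bsub>G\<^esub> x) = \<zero>" using assms yG by (simp add: single_apply)
  qed (use assms group_ring_finite_supp in \<open>auto simp: single_apply\<close>)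
  also have "\<dots> = f ?h \<otimes> c"
    using assms by (simp add: single_apply G.inv_mult_group G.m_assoc)
  finally show ?thesis .
qed

lemma finsum_translate:
  assumes "y \<in> carrier G" "Z \<subseteq> carrier G" "\<And>w. w \<in> carrier G \<Longrightarrow> F w \<in> carrier R"
  shows "(\<Oplus>z\<in>Z. F (inv\<^bsub>G\<^esub> y \<otimes>\<^bsub>G\<^esub> z)) = (\<Oplus>w\<in>(\<lambda>z. inv\<^bsub>G\<^esub> y \<otimes>\<^bsub>G\<^esub> z) ` Z. F w)"
proof (rule R.finsum_reindex[symmetric])
  show "inj_on (\<lambda>z. inv\<^bsub>G\<^esub> y \<otimes>\<^bsub>G\<^esub> z) Z"
    using assms by (auto intro!: inj_onI) (metis G.inv_closed G.l_cancel subsetD)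
qed (use assms in auto)

text \<open>The translated product set is thus an admissible summation set for \<open>h\<close>,
  which is what reindexing by \<open>z = y w\<close> requires.\<close>

lemma supp_translate:
  assumes "y \<in> supp f"
  shows "supp h \<subseteq> (\<lambda>z. inv\<^bsub>G\<^esub> y \<otimes>\<^bsub>G\<^esub> z) ` ((\<lambda>(y, z). y \<otimes>\<^bsub>G\<^esub> z) ` (supp f \<times> supp h))"
proof
  fix w assume w: "w \<in> supp h"
  then have "w = inv\<^bsub>G\<^esub> y \<otimes>\<^bsub>G\<^esub> (y \<otimes>\<^bsub>G\<^esub> w)" using assms by (simp add: G.m_assoc[symmetric])
  then show "w \<in> (\<lambda>z. inv\<^bsub>G\<^esub> y \<otimes>\<^bsub>G\<^esub> z) ` ((\<lambda>(y, z). y \<otimes>\<^bsub>G\<^esub> z) ` (supp f \<times> supp h))"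
    using w assms by (auto intro!: image_eqI[of _ _ "y \<otimes>\<^bsub>G\<^esub> w"] image_eqI[of _ _ "(y, w)"])
qed

text \<open>Sum over the finite set of products of support elements, interchange the two sums, and
  reindex the inner one by the translation \<open>z \<mapsto> y^(-1) z\<close>.\<close>

lemma group_ring_assoc:
  assumes f: "f \<in> carrier RG" and h: "h \<in> carrier RG" and k: "k \<in> carrier RG"
  shows "(f \<otimes>\<^bsub>RG\<^esub> h) \<otimes>\<^bsub>RG\<^esub> k = f \<otimes>\<^bsub>RG\<^esub> (h \<otimes>\<^bsub>RG\<^esub> k)"
proof (rule group_ring_eqI)
  fix x assume x: "x \<in> carrier G"
  let ?Z = "(\<lambda>(y, z). y \<otimes>\<^bsub>G\<^esub> z) ` (supp f \<times> supp h)"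
  have Z: "finite ?Z" "?Z \<subseteq> carrier G" using finite_supp_product[OF f h] by auto
  have F: "finite (supp f)" by (rule group_ring_finite_supp[OF f])
  have fh: "(f \<otimes>\<^bsub>RG\<^esub> h) z = (\<Oplus>y\<in>supp f. f y \<otimes> h (inv\<^bsub>G\<^esub> y \<otimes>\<^bsub>G\<^esub> z))" if "z \<in> carrier G" for z
    using group_ring_mult_apply[OF f h F order_refl _ that] by auto
  have "((f \<otimes>\<^bsub>RG\<^esub> h) \<otimes>\<^bsub>RG\<^esub> k) x = (\<Oplus>z\<in>?Z. (f \<otimes>\<^bsub>RG\<^esub> h) z \<otimes> k (inv\<^bsub>G\<^esub> z \<otimes>\<^bsub>G\<^esub> x))"
    by (rule group_ring_mult_apply[OF group_ring_mult_closed[OF f h] k Z(1) supp_mult[OF f h] Z(2) x])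
  also have "\<dots> = (\<Oplus>z\<in>?Z. \<Oplus>y\<in>supp f. f y \<otimes> (h (inv\<^bsub>G\<^esub> y \<otimes>\<^bsub>G\<^esub> z) \<otimes> k (inv\<^bsub>G\<^esub> z \<otimes>\<^bsub>G\<^esub> x)))"
  proof (rule R.finsum_cong')
    fix z assume "z \<in> ?Z"
    then have z: "z \<in> carrier G" using Z(2) by auto
    show "(f \<otimes>\<^bsub>RG\<^esub> h) z \<otimes> k (inv\<^bsub>G\<^esub> z \<otimes>\<^bsub>G\<^esub> x)
        = (\<Oplus>y\<in>supp f. f y \<otimes> (h (inv\<^bsub>G\<^esub> y \<otimes>\<^bsub>G\<^esub> z) \<otimes> k (inv\<^bsub>G\<^esub> z \<otimes>\<^bsub>G\<^esub> x)))"
      using f h k F fh[OF z] by (simp add: R.finsum_ldistr R.m_assoc Pi_def)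
  qed (use f h k in \<open>auto intro!: R.finsum_closed\<close>)
  also have "\<dots> = (\<Oplus>y\<in>supp f. \<Oplus>z\<in>?Z. f y \<otimes> (h (inv\<^bsub>G\<^esub> y \<otimes>\<^bsub>G\<^esub> z) \<otimes> k (inv\<^bsub>G\<^esub> z \<otimes>\<^bsub>G\<^esub> x)))"
    using Z F f h k by (intro R.finsum_swap) auto
  also have "\<dots> = (\<Oplus>y\<in>supp f. f y \<otimes> (h \<otimes>\<^bsub>RG\<^esub> k) (inv\<^bsub>G\<^esub> y \<otimes>\<^bsub>G\<^esub> x))"
  proof (rule R.finsum_cong')
    fix y assume y: "y \<in> supp f"
    then have yG: "y \<in> carrier G" by auto
    let ?W = "(\<lambda>z. inv\<^bsub>G\<^esub> y \<otimes>\<^bsub>G\<^esub> z) ` ?Z"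
    have "(\<Oplus>z\<in>?Z. f y \<otimes> (h (inv\<^bsub>G\<^esub> y \<otimes>\<^bsub>G\<^esub> z) \<otimes> k (inv\<^bsub>G\<^esub> z \<otimes>\<^bsub>G\<^esub> x)))
        = f y \<otimes> (\<Oplus>z\<in>?Z. h (inv\<^bsub>G\<^esub> y \<otimes>\<^bsub>G\<^esub> z) \<otimes> k (inv\<^bsub>G\<^esub> z \<otimes>\<^bsub>G\<^esub> x))"
      using f h k Z by (intro R.finsum_rdistr[symmetric]) auto
    also have "(\<Oplus>z\<in>?Z. h (inv\<^bsub>G\<^esub> y \<otimes>\<^bsub>G\<^esub> z) \<otimes> k (inv\<^bsub>G\<^esub> z \<otimes>\<^bsub>G\<^esub> x))
        = (\<Oplus>z\<in>?Z. (\<lambda>w. h w \<otimes> k (inv\<^bsub>G\<^esub> w \<otimes>\<^bsub>G\<^esub> (inv\<^bsub>G\<^esub> y \<otimes>\<^bsub>G\<^esub> x))) (inv\<^bsub>G\<^esub> y \<otimes>\<^bsub>G\<^esub> z))"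
    proof (rule R.finsum_cong')
      fix z assume "z \<in> ?Z"
      then have z: "z \<in> carrier G" using Z(2) by auto
      have "inv\<^bsub>G\<^esub> (inv\<^bsub>G\<^esub> y \<otimes>\<^bsub>G\<^esub> z) \<otimes>\<^bsub>G\<^esub> (inv\<^bsub>G\<^esub> y \<otimes>\<^bsub>G\<^esub> x) = inv\<^bsub>G\<^esub> z \<otimes>\<^bsub>G\<^esub> (y \<otimes>\<^bsub>G\<^esub> inv\<^bsub>G\<^esub> y) \<otimes>\<^bsub>G\<^esub> x"
        using yG z x by (simp only: G.inv_mult_group G.inv_inv G.m_assoc G.m_closed G.inv_closed)
      then show "h (inv\<^bsub>G\<^esub> y \<otimes>\<^bsub>G\<^esub> z) \<otimes> k (inv\<^bsub>G\<^esub> z \<otimes>\<^bsub>G\<^esub> x)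
          = (\<lambda>w. h w \<otimes> k (inv\<^bsub>G\<^esub> w \<otimes>\<^bsub>G\<^esub> (inv\<^bsub>G\<^esub> y \<otimes>\<^bsub>G\<^esub> x))) (inv\<^bsub>G\<^esub> y \<otimes>\<^bsub>G\<^esub> z)"
        using yG z x by simp
    qed (use h k in auto)
    also have "\<dots> = (\<Oplus>w\<in>?W. h w \<otimes> k (inv\<^bsub>G\<^esub> w \<otimes>\<^bsub>G\<^esub> (inv\<^bsub>G\<^esub> y \<otimes>\<^bsub>G\<^esub> x)))"
      using yG Z(2) h k by (intro finsum_translate) auto
    also have "\<dots> = (h \<otimes>\<^bsub>RG\<^esub> k) (inv\<^bsub>G\<^esub> y \<otimes>\<^bsub>G\<^esub> x)"
      using Z yG x by (intro group_ring_mult_apply[symmetric] h k supp_translate y) auto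
    finally show "(\<Oplus>z\<in>?Z. f y \<otimes> (h (inv\<^bsub>G\<^esub> y \<otimes>\<^bsub>G\<^esub> z) \<otimes> k (inv\<^bsub>G\<^esub> z \<otimes>\<^bsub>G\<^esub> x)))
        = f y \<otimes> (h \<otimes>\<^bsub>RG\<^esub> k) (inv\<^bsub>G\<^esub> y \<otimes>\<^bsub>G\<^esub> x)" .
  qed (use f group_ring_mult_closed[OF h k] in auto)
  also have "\<dots> = (f \<otimes>\<^bsub>RG\<^esub> (h \<otimes>\<^bsub>RG\<^esub> k)) x"
    using F x by (intro group_ring_mult_apply[symmetric] f group_ring_mult_closed h k) auto
  finally show "((f \<otimes>\<^bsub>RG\<^esub> h) \<otimes>\<^bsub>RG\<^esub> k) x = (f \<otimes>\<^bsub>RG\<^esub> (h \<otimes>\<^bsub>RG\<^esub> k)) x" .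
qed (use assms in \<open>auto intro!: group_ring_mult_closed\<close>)

lemma group_ring_l_distr:
  assumes f: "f \<in> carrier RG" and h: "h \<in> carrier RG" and k: "k \<in> carrier RG"
  shows "(f \<oplus>\<^bsub>RG\<^esub> h) \<otimes>\<^bsub>RG\<^esub> k = f \<otimes>\<^bsub>RG\<^esub> k \<oplus>\<^bsub>RG\<^esub> h \<otimes>\<^bsub>RG\<^esub> k"
proof (rule group_ring_eqI)
  fix x assume x: "x \<in> carrier G"
  let ?Y = "supp f \<union> supp h"
  have Y: "finite ?Y" "?Y \<subseteq> carrier G" using f h group_ring_finite_supp by auto
  have "supp (f \<oplus>\<^bsub>RG\<^esub> h) \<subseteq> ?Y" using group_ring_add_apply[OF f h] by auto
  then have "((f \<oplus>\<^bsub>RG\<^esub> h) \<otimes>\<^bsub>RG\<^esub> k) x = (\<Oplus>y\<in>?Y. (f \<oplus>\<^bsub>RG\<^esub> h) y \<otimes> k (inv\<^bsub>G\<^esub> y \<otimes>\<^bsub>G\<^esub> x))"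
    using Y x by (intro group_ring_mult_apply group_ring_add_closed f h k) auto
  also have "\<dots> = (\<Oplus>y\<in>?Y. f y \<otimes> k (inv\<^bsub>G\<^esub> y \<otimes>\<^bsub>G\<^esub> x) \<oplus> h y \<otimes> k (inv\<^bsub>G\<^esub> y \<otimes>\<^bsub>G\<^esub> x))"
    using f h k by (intro R.finsum_cong') (auto simp: group_ring_add_apply R.l_distr)
  also have "\<dots> = (\<Oplus>y\<in>?Y. f y \<otimes> k (inv\<^bsub>G\<^esub> y \<otimes>\<^bsub>G\<^esub> x)) \<oplus> (\<Oplus>y\<in>?Y. h y \<otimes> k (inv\<^bsub>G\<^esub> y \<otimes>\<^bsub>G\<^esub> x))"
    using f h k by (intro R.finsum_addf) auto
  also have "\<dots> = (f \<otimes>\<^bsub>RG\<^esub> k) x \<oplus> (h \<otimes>\<^bsub>RG\<^esub> k) x"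
    using group_ring_mult_apply[OF f k Y(1) _ Y(2) x] group_ring_mult_apply[OF h k Y(1) _ Y(2) x] by simp
  also have "\<dots> = (f \<otimes>\<^bsub>RG\<^esub> k \<oplus>\<^bsub>RG\<^esub> h \<otimes>\<^bsub>RG\<^esub> k) x"
    using f h k by (simp add: group_ring_add_apply group_ring_mult_closed)
  finally show "((f \<oplus>\<^bsub>RG\<^esub> h) \<otimes>\<^bsub>RG\<^esub> k) x = (f \<otimes>\<^bsub>RG\<^esub> k \<oplus>\<^bsub>RG\<^esub> h \<otimes>\<^bsub>RG\<^esub> k) x" .
qed (use assms in \<open>auto intro!: group_ring_mult_closed group_ring_add_closed\<close>)

lemma group_ring_r_distr:
  assumes f: "f \<in> carrier RG" and h: "h \<in> carrier RG" and k: "k \<in> carrier RG"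
  shows "k \<otimes>\<^bsub>RG\<^esub> (f \<oplus>\<^bsub>RG\<^esub> h) = k \<otimes>\<^bsub>RG\<^esub> f \<oplus>\<^bsub>RG\<^esub> k \<otimes>\<^bsub>RG\<^esub> h"
proof (rule group_ring_eqI)
  fix x assume x: "x \<in> carrier G"
  have K: "finite (supp k)" "supp k \<subseteq> carrier G" using k group_ring_finite_supp by auto
  have "(k \<otimes>\<^bsub>RG\<^esub> (f \<oplus>\<^bsub>RG\<^esub> h)) x = (\<Oplus>y\<in>supp k. k y \<otimes> (f \<oplus>\<^bsub>RG\<^esub> h) (inv\<^bsub>G\<^esub> y \<otimes>\<^bsub>G\<^esub> x))"
    using K x by (intro group_ring_mult_apply group_ring_add_closed f h k) auto
  also have "\<dots> = (\<Oplus>y\<in>supp k. k y \<otimes> f (inv\<^bsub>G\<^esub> y \<otimes>\<^bsub>G\<^esub> x) \<oplus> k y \<otimes> h (inv\<^bsub>G\<^esub> y \<otimes>\<^bsub>G\<^esub> x))"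
    using f h k by (intro R.finsum_cong') (auto simp: group_ring_add_apply R.r_distr)
  also have "\<dots> = (\<Oplus>y\<in>supp k. k y \<otimes> f (inv\<^bsub>G\<^esub> y \<otimes>\<^bsub>G\<^esub> x)) \<oplus> (\<Oplus>y\<in>supp k. k y \<otimes> h (inv\<^bsub>G\<^esub> y \<otimes>\<^bsub>G\<^esub> x))"
    using f h k by (intro R.finsum_addf) auto
  also have "\<dots> = (k \<otimes>\<^bsub>RG\<^esub> f) x \<oplus> (k \<otimes>\<^bsub>RG\<^esub> h) x"
    using group_ring_mult_apply[OF k f K(1) _ K(2) x] group_ring_mult_apply[OF k h K(1) _ K(2) x] by simp
  also have "\<dots> = (k \<otimes>\<^bsub>RG\<^esub> f \<oplus>\<^bsub>RG\<^esub> k \<otimes>\<^bsub>RG\<^esub> h) x"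
    using f h k by (simp add: group_ring_add_apply group_ring_mult_closed)
  finally show "(k \<otimes>\<^bsub>RG\<^esub> (f \<oplus>\<^bsub>RG\<^esub> h)) x = (k \<otimes>\<^bsub>RG\<^esub> f \<oplus>\<^bsub>RG\<^esub> k \<otimes>\<^bsub>RG\<^esub> h) x" .
qed (use assms in \<open>auto intro!: group_ring_mult_closed group_ring_add_closed\<close>)

lemma ring_group_ring: "ring RG"
proof (rule ringI)
  show "abelian_group RG"
  proof (rule abelian_groupI)
    fix f assume f: "f \<in> carrier RG"
    show "\<exists>h\<in>carrier RG. h \<oplus>\<^bsub>RG\<^esub> f = \<zero>\<^bsub>RG\<^esub>"
    proof (rule bexI[of _ "\<lambda>x. \<ominus> f x"])
      have "\<ominus> f x = \<zero> \<longleftrightarrow> f x = \<zero>" for x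
        using f by (metis R.minus_minus R.minus_zero group_ring_coeff)
      then show c: "(\<lambda>x. \<ominus> f x) \<in> carrier RG"
        using f group_ring_finite_supp[OF f] group_ring_coeff_outside[OF f]
        by (intro group_ring_carrierI) simp_all
      show "(\<lambda>x. \<ominus> f x) \<oplus>\<^bsub>RG\<^esub> f = \<zero>\<^bsub>RG\<^esub>"
        by (rule ext) (use f c in \<open>simp add: group_ring_add_apply group_ring_zero R.l_neg\<close>)
    qed
  next
    fix f h assume "f \<in> carrier RG" "h \<in> carrier RG"
    then show "f \<oplus>\<^bsub>RG\<^esub> h = h \<oplus>\<^bsub>RG\<^esub> f"
      by (intro ext) (simp add: group_ring_add_apply R.a_comm)
  next
    fix f assume "f \<in> carrier RG"
    then show "\<zero>\<^bsub>RG\<^esub> \<oplus>\<^bsub>RG\<^esub> f = f"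
      using group_ring_zero_closed by (intro ext) (simp add: group_ring_add_apply group_ring_zero)
  next
    fix f h k assume "f \<in> carrier RG" "h \<in> carrier RG" "k \<in> carrier RG"
    then show "f \<oplus>\<^bsub>RG\<^esub> h \<oplus>\<^bsub>RG\<^esub> k = f \<oplus>\<^bsub>RG\<^esub> (h \<oplus>\<^bsub>RG\<^esub> k)"
      by (intro ext) (simp add: group_ring_add_apply group_ring_add_closed R.a_assoc)
  qed (use group_ring_add_closed group_ring_zero_closed in auto)
next
  show "monoid RG"
  proof (rule monoidI)
    fix f assume f: "f \<in> carrier RG"
    show "\<one>\<^bsub>RG\<^esub> \<otimes>\<^bsub>RG\<^esub> f = f"
      by (rule group_ring_eqI)
        (use f in \<open>auto simp: group_ring_one single_mult_apply group_ring_mult_closed\<close>)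
    show "f \<otimes>\<^bsub>RG\<^esub> \<one>\<^bsub>RG\<^esub> = f"
      by (rule group_ring_eqI)
        (use f in \<open>auto simp: group_ring_one mult_single_apply group_ring_mult_closed\<close>)
  qed (use group_ring_mult_closed group_ring_assoc in \<open>auto simp: group_ring_one\<close>)
qed (use group_ring_l_distr group_ring_r_distr in auto)

sublocale A: ring "group_ring R G"
  by (rule ring_group_ring)

lemma single_mult:
  assumes "g \<in> carrier G" "h \<in> carrier G" "c \<in> carrier R" "d \<in> carrier R"
  shows "single g c \<otimes>\<^bsub>RG\<^esub> single h d = single (g \<otimes>\<^bsub>G\<^esub> h) (c \<otimes> d)"
proof (rule group_ring_eqI)
  fix x assume x: "x \<in> carrier G"
  have "inv\<^bsub>G\<^esub> g \<otimes>\<^bsub>G\<^esub> x = h \<longleftrightarrow> x = g \<otimes>\<^bsub>G\<^esub> h"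
    using assms x by (metis G.inv_solve_left)
  then show "(single g c \<otimes>\<^bsub>RG\<^esub> single h d) x = single (g \<otimes>\<^bsub>G\<^esub> h) (c \<otimes> d) x"
    using assms x by (simp add: single_mult_apply) (simp add: single_apply)
qed (use assms in auto)

lemma single_add:
  assumes "g \<in> carrier G" "c \<in> carrier R" "d \<in> carrier R"
  shows "single g c \<oplus>\<^bsub>RG\<^esub> single g d = single g (c \<oplus> d)"
  using assms by (intro ext) (simp add: group_ring_add_apply, simp add: single_apply)

lemma single_zero: "single g \<zero> = \<zero>\<^bsub>RG\<^esub>"
  by (intro ext) (simp add: single_apply group_ring_zero)

lemma one_plus_single_minus_one: "\<one>\<^bsub>RG\<^esub> \<oplus>\<^bsub>RG\<^esub> single \<one>\<^bsub>G\<^esub> (\<ominus> \<one>) = \<zero>\<^bsub>RG\<^esub>"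
  by (simp add: group_ring_one single_add R.r_neg single_zero)

lemma single_pow:
  assumes "g \<in> carrier G"
  shows "single g \<one> [^]\<^bsub>RG\<^esub> (n::nat) = single (g [^]\<^bsub>G\<^esub> n) \<one>"
  by (induction n) (use assms in \<open>simp_all add: group_ring_one single_mult\<close>)

lemma scalar_hom: "single \<one>\<^bsub>G\<^esub> \<in> ring_hom R RG"
  by (rule ring_hom_memI) (auto simp: single_mult single_add group_ring_one)

text \<open>The set \<open>L\<close> keeps every adjoined group element inside the support one
  started from, as needed when only elements of one subgroup are under control.\<close>

lemma group_ring_induct [consumes 2, case_names zero add]:
  assumes f: "f \<in> carrier RG" "supp f \<subseteq> L"
    and zero: "P \<zero>\<^bsub>RG\<^esub>"
    and add: "\<And>f g c. f \<in> carrier RG \<Longrightarrow> g \<in> carrier G \<Longrightarrow> g \<in> L \<Longrightarrow> c \<in> carrier R \<Longrightarrow> P f \<Longrightarrow>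
      P (f \<oplus>\<^bsub>RG\<^esub> single g c)"
  shows "P f"
  using f
proof (induction "card (supp f)" arbitrary: f)
  case 0
  then have "supp f = {}" using group_ring_finite_supp[OF 0(2)] by simp
  then have "f = \<zero>\<^bsub>RG\<^esub>" using 0 by (intro group_ring_eqI group_ring_zero_closed) (auto simp: group_ring_zero)
  then show ?case using zero by simp
next
  case (Suc n)
  have "supp f \<noteq> {}" using Suc(2) by (metis card.empty nat.distinct(1))
  then obtain g where g: "g \<in> supp f" by blast
  let ?h = "f(g := \<zero>)"
  have s: "supp ?h = supp f - {g}" by auto
  have h: "?h \<in> carrier RG"
  proof (rule group_ring_carrierI)
    show "finite (supp ?h)" unfolding s using group_ring_finite_supp[OF Suc(3)] by simp
  qed (use Suc(3) group_ring_coeff_outside[OF Suc(3)] in auto)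
  have "f = ?h \<oplus>\<^bsub>RG\<^esub> single g (f g)"
    by (rule ext) (use h g Suc(3) in \<open>simp add: group_ring_add_apply, simp add: single_apply\<close>)
  moreover have "P ?h"
  proof (rule Suc(1))
    show "n = card (supp ?h)" unfolding s using g Suc(2) by simp
  qed (use h s Suc(4) in auto)
  then have "P (?h \<oplus>\<^bsub>RG\<^esub> single g (f g))" using g Suc(3,4) h by (intro add) auto
  ultimately show ?case by simp
qed

section \<open>The augmentation homomorphism\<close>

abbreviation aug where "aug \<equiv> augmentation R G"

lemma augmentation_eq:
  assumes "f \<in> carrier RG" "finite Y" "supp f \<subseteq> Y" "Y \<subseteq> carrier G"
  shows "aug f = (\<Oplus>x\<in>Y. f x)"
  unfolding augmentation_def
proof (rule R.add.finprod_mono_neutral_cong_left)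
  show "f i = \<zero>" if "i \<in> Y - supp f" for i
    using that assms by auto
qed (use assms in auto)

lemma augmentation_closed [simp, intro]: "f \<in> carrier RG \<Longrightarrow> aug f \<in> carrier R"
  unfolding augmentation_def by (auto intro!: R.finsum_closed)

lemma augmentation_add:
  assumes "f \<in> carrier RG" "h \<in> carrier RG"
  shows "aug (f \<oplus>\<^bsub>RG\<^esub> h) = aug f \<oplus> aug h"
proof -
  let ?Y = "supp f \<union> supp h"
  have Y: "finite ?Y" "?Y \<subseteq> carrier G" using assms group_ring_finite_supp by auto
  have "aug (f \<oplus>\<^bsub>RG\<^esub> h) = (\<Oplus>x\<in>?Y. f x \<oplus> h x)"
  proof -
    have "aug (f \<oplus>\<^bsub>RG\<^esub> h) = (\<Oplus>x\<in>?Y. (f \<oplus>\<^bsub>RG\<^esub> h) x)"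
      using assms Y by (intro augmentation_eq) (auto simp: group_ring_add_apply)
    then show ?thesis using assms by (simp only: group_ring_add_apply)
  qed
  also have "\<dots> = (\<Oplus>x\<in>?Y. f x) \<oplus> (\<Oplus>x\<in>?Y. h x)"
    using assms by (intro R.finsum_addf) auto
  finally show ?thesis using augmentation_eq[of f ?Y] augmentation_eq[of h ?Y] assms Y by simp
qed

lemma augmentation_single:
  assumes "g \<in> carrier G" "c \<in> carrier R"
  shows "aug (single g c) = c"
proof -
  have "supp (single g c) \<subseteq> {g}" by (auto simp: single_apply split: if_splits)
  then have "aug (single g c) = (\<Oplus>x\<in>{g}. single g c x)"
    using assms by (intro augmentation_eq) auto
  then show ?thesis using assms by (simp add: single_apply)
qed

lemma augmentation_mult:
  assumes f: "f \<in> carrier RG" and h: "h \<in> carrier RG"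
  shows "aug (f \<otimes>\<^bsub>RG\<^esub> h) = aug f \<otimes> aug h"
proof -
  let ?Z = "(\<lambda>(y, z). y \<otimes>\<^bsub>G\<^esub> z) ` (supp f \<times> supp h)"
  have Z: "finite ?Z" "?Z \<subseteq> carrier G" using finite_supp_product[OF f h] by auto
  have F: "finite (supp f)" by (rule group_ring_finite_supp[OF f])
  have "aug (f \<otimes>\<^bsub>RG\<^esub> h) = (\<Oplus>z\<in>?Z. (f \<otimes>\<^bsub>RG\<^esub> h) z)"
    using f h Z supp_mult[OF f h] by (intro augmentation_eq) auto
  also have "\<dots> = (\<Oplus>z\<in>?Z. \<Oplus>y\<in>supp f. f y \<otimes> h (inv\<^bsub>G\<^esub> y \<otimes>\<^bsub>G\<^esub> z))"
  proof (rule R.finsum_cong')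
    fix z assume "z \<in> ?Z"
    then have "z \<in> carrier G" using Z(2) by auto
    then show "(f \<otimes>\<^bsub>RG\<^esub> h) z = (\<Oplus>y\<in>supp f. f y \<otimes> h (inv\<^bsub>G\<^esub> y \<otimes>\<^bsub>G\<^esub> z))"
      using f h F by (intro group_ring_mult_apply) auto
  qed (use f h in \<open>auto intro!: R.finsum_closed\<close>)
  also have "\<dots> = (\<Oplus>y\<in>supp f. \<Oplus>z\<in>?Z. f y \<otimes> h (inv\<^bsub>G\<^esub> y \<otimes>\<^bsub>G\<^esub> z))"
    using Z F f h by (intro R.finsum_swap) auto
  also have "\<dots> = (\<Oplus>y\<in>supp f. f y \<otimes> aug h)"
  proof (rule R.finsum_cong')
    fix y assume y: "y \<in> supp f"
    have "(\<Oplus>z\<in>?Z. f y \<otimes> h (inv\<^bsub>G\<^esub> y \<otimes>\<^bsub>G\<^esub> z)) = f y \<otimes> (\<Oplus>z\<in>?Z. h (inv\<^bsub>G\<^esub> y \<otimes>\<^bsub>G\<^esub> z))"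
      using f h Z by (intro R.finsum_rdistr[symmetric]) auto
    also have "(\<Oplus>z\<in>?Z. h (inv\<^bsub>G\<^esub> y \<otimes>\<^bsub>G\<^esub> z)) = (\<Oplus>w\<in>(\<lambda>z. inv\<^bsub>G\<^esub> y \<otimes>\<^bsub>G\<^esub> z) ` ?Z. h w)"
      using y Z(2) h by (intro finsum_translate) auto
    also have "\<dots> = aug h"
      using y Z h supp_translate[OF y, of h] by (intro augmentation_eq[symmetric]) auto
    finally show "(\<Oplus>z\<in>?Z. f y \<otimes> h (inv\<^bsub>G\<^esub> y \<otimes>\<^bsub>G\<^esub> z)) = f y \<otimes> aug h" .
  qed (use f h in auto)
  also have "\<dots> = aug f \<otimes> aug h"
    using f h F unfolding augmentation_def[of R G f] by (intro R.finsum_ldistr[symmetric]) auto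
  finally show ?thesis .
qed

lemma augmentation_hom: "aug \<in> ring_hom RG R"
  by (rule ring_hom_memI)
    (auto simp: augmentation_mult augmentation_add group_ring_one augmentation_single)

end

section \<open>Group rings that are generalized t-fine\<close>

context
  fixes A (structure) and B (structure) and h
  assumes A: "ring A" and B: "ring B" and hom: "h \<in> ring_hom A B"
begin

interpretation A: ring A by (rule A)
interpretation B: ring B by (rule B)
interpretation h: ring_hom_ring A B h
  by (intro ring_hom_ringI2 A B hom)

lemma ring_hom_nat_pow:
  assumes "x \<in> carrier A"
  shows "h (x [^]\<^bsub>A\<^esub> (n::nat)) = h x [^]\<^bsub>B\<^esub> n"
  by (induction n) (use assms in auto)

lemma ring_hom_nilpotents:
  assumes "x \<in> nilpotents A"
  shows "h x \<in> nilpotents B"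
proof -
  obtain n :: nat where "x \<in> carrier A" "x [^]\<^bsub>A\<^esub> n = \<zero>\<^bsub>A\<^esub>"
    using assms by (auto simp: A.nilpotents_iff)
  then show ?thesis using ring_hom_nat_pow[of x n] by (auto simp: B.nilpotents_iff)
qed

lemma ring_hom_torsion_units:
  assumes "x \<in> torsion_units A"
  shows "h x \<in> torsion_units B"
proof -
  obtain m :: nat where m: "x \<in> carrier A" "m \<ge> 1" "x [^]\<^bsub>A\<^esub> m = \<one>\<^bsub>A\<^esub>"
    using assms by (auto simp: torsion_units_def)
  then have "h x [^]\<^bsub>B\<^esub> m = \<one>\<^bsub>B\<^esub>" using ring_hom_nat_pow[of x m] by simp
  then show ?thesis using m(1,2) by (intro B.torsion_unitI[of "h x" m]) auto
qed

lemma ring_hom_of_nat: "h (add_pow A (n::nat) \<one>\<^bsub>A\<^esub>) = add_pow B n \<one>\<^bsub>B\<^esub>"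
  by (induction n) auto

lemma ring_hom_int_embed: "h (add_pow A (k::int) \<one>\<^bsub>A\<^esub>) = add_pow B k \<one>\<^bsub>B\<^esub>"
  by (cases "k \<ge> 0") (simp_all add: add_pow_int_ge add_pow_int_lt ring_hom_of_nat)

lemma ring_hom_poly_eval:
  assumes "x \<in> carrier A"
  shows "h (poly_eval A x P) = poly_eval B (h x) P"
  by (induction P) (use assms in \<open>auto simp: A.poly_eval_pCons B.poly_eval_pCons ring_hom_int_embed\<close>)

text \<open>The left inverses of all \<open>1 + a x\<close> are mapped forward; surjectivity makes
  the images of \<open>a\<close> exhaust the multipliers in \<open>B\<close>.\<close>

lemma ring_hom_jacobson_radical:
  assumes surj: "carrier B \<subseteq> h ` carrier A" and x: "x \<in> jacobson_radical A"
  shows "h x \<in> jacobson_radical B"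
proof (rule B.jacobson_radicalI)
  have xc: "x \<in> carrier A" using x A.jacobson_radical_carrier by auto
  then show "h x \<in> carrier B" by simp
  fix b assume "b \<in> carrier B"
  then obtain a where a: "a \<in> carrier A" "b = h a" using surj by auto
  have "a \<otimes>\<^bsub>A\<^esub> x \<in> jacobson_radical A"
    using A.left_ideal_jacobson_radical a(1) x by (auto simp: left_ideal_def)
  then obtain y where y: "y \<in> carrier A" "y \<otimes>\<^bsub>A\<^esub> (\<one>\<^bsub>A\<^esub> \<oplus>\<^bsub>A\<^esub> a \<otimes>\<^bsub>A\<^esub> x) = \<one>\<^bsub>A\<^esub>"
    using A.jacobson_radical_left_inverse by blast
  then have "h (y \<otimes>\<^bsub>A\<^esub> (\<one>\<^bsub>A\<^esub> \<oplus>\<^bsub>A\<^esub> a \<otimes>\<^bsub>A\<^esub> x)) = \<one>\<^bsub>B\<^esub>" by simp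
  then have "h y \<otimes>\<^bsub>B\<^esub> (\<one>\<^bsub>B\<^esub> \<oplus>\<^bsub>B\<^esub> b \<otimes>\<^bsub>B\<^esub> h x) = \<one>\<^bsub>B\<^esub>"
    using y(1) a xc by simp
  then show "\<exists>y\<in>carrier B. y \<otimes>\<^bsub>B\<^esub> (\<one>\<^bsub>B\<^esub> \<oplus>\<^bsub>B\<^esub> b \<otimes>\<^bsub>B\<^esub> h x) = \<one>\<^bsub>B\<^esub>"
    using y(1) by (intro bexI[of _ "h y"]) auto
qed

end

lemma (in ring) poly_eval_one: "poly_eval R \<one> P = int_embed (poly P 1)"
  by (induction P) (auto simp: poly_eval_pCons of_int_add)

lemma prime_power_of_unique_prime_divisor:
  fixes n p :: nat
  assumes "n > 0" "Factorial_Ring.prime p" "\<And>q. Factorial_Ring.prime q \<Longrightarrow> q dvd n \<Longrightarrow> q = p"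
  shows "\<exists>k. n = p ^ k"
proof -
  obtain m where m: "n = p ^ multiplicity p n * m" "\<not> p dvd m"
    using multiplicity_decompose'[of n p] assms(1,2) not_prime_unit by blast
  have "m = 1"
  proof (rule ccontr)
    assume "m \<noteq> 1"
    then obtain q where "Factorial_Ring.prime q" "q dvd m" using prime_factor_nat by blast
    then show False using assms(3)[of q] m by (metis dvd_mult)
  qed
  then show ?thesis using m(1) by auto
qed

context group_over_ring
begin

lemmas augmentation_nat_pow = ring_hom_nat_pow[OF ring_group_ring R.ring_axioms augmentation_hom]
  and augmentation_nilpotents = ring_hom_nilpotents[OF ring_group_ring R.ring_axioms augmentation_hom]
  and augmentation_torsion_units = ring_hom_torsion_units[OF ring_group_ring R.ring_axioms augmentation_hom]
  and augmentation_poly_eval = ring_hom_poly_eval[OF ring_group_ring R.ring_axioms augmentation_hom]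
  and augmentation_jacobson_radical =
    ring_hom_jacobson_radical[OF ring_group_ring R.ring_axioms augmentation_hom]

section \<open>Necessary conditions on the ring and on the group\<close>

context
  assumes gtf: "generalized_t_fine RG"
begin

lemma gtf_decomposition:
  assumes "f \<in> carrier RG" "f \<notin> jacobson_radical RG"
  shows "\<exists>u\<in>torsion_units RG. \<exists>n\<in>nilpotents RG. f = u \<oplus>\<^bsub>RG\<^esub> n"
proof -
  have "f \<in> torsion_units RG <+>\<^bsub>RG\<^esub> nilpotents RG"
    using assms gtf unfolding generalized_t_fine_def by blast
  then show ?thesis by (auto simp: set_add_def')
qed

text \<open>In the zero ring \<open>1\<close> would be in the radical and also be a torsion unit
  plus a nilpotent.\<close>

lemma gtf_one_not_zero: "\<one> \<noteq> \<zero>"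
proof
  assume "\<one> = \<zero>"
  then have "\<one>\<^bsub>RG\<^esub> = \<zero>\<^bsub>RG\<^esub>" by (intro ext) (simp add: group_ring_one group_ring_zero single_apply)
  then have "\<one>\<^bsub>RG\<^esub> \<in> jacobson_radical RG" using A.zero_in_jacobson_radical by simp
  moreover have "\<one>\<^bsub>RG\<^esub> \<in> torsion_units RG" by (rule A.torsion_unitI[of _ 1]) auto
  then have "\<one>\<^bsub>RG\<^esub> \<oplus>\<^bsub>RG\<^esub> \<zero>\<^bsub>RG\<^esub> \<in> torsion_units RG <+>\<^bsub>RG\<^esub> nilpotents RG"
    using A.zero_nilpotent unfolding set_add_def' by blast
  then have "\<one>\<^bsub>RG\<^esub> \<notin> jacobson_radical RG"
    using gtf unfolding generalized_t_fine_def by auto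
  ultimately show False by simp
qed

lemma augmentation_kernel_in_jacobson_radical:
  assumes z: "z \<in> carrier RG" "aug z = \<zero>"
  shows "z \<in> jacobson_radical RG"
proof (rule ccontr)
  assume "z \<notin> jacobson_radical RG"
  then obtain u n where un: "u \<in> torsion_units RG" "n \<in> nilpotents RG" "z = u \<oplus>\<^bsub>RG\<^esub> n"
    using gtf_decomposition z(1) by blast
  have c: "u \<in> carrier RG" "n \<in> carrier RG"
    using un A.nilpotents_carrier by (auto simp: torsion_units_def)
  have u: "aug u \<in> torsion_units R"
    using augmentation_torsion_units[OF un(1)] .
  have n: "aug n \<in> nilpotents R"
    using augmentation_nilpotents[OF un(2)] .
  have "aug u \<oplus> aug n = \<zero>" using z(2) un(3) c augmentation_add by simp
  then have "aug u = (\<ominus> \<one>) \<otimes> aug n" using c by (simp add: R.minus_equality R.l_minus)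
  also have "\<ominus> \<one> = R.int_embed (-1)" by (simp add: R.add.int_pow_neg)
  \<comment> \<open>\<open>R\<close> is only a ring in this context, so nilpotence of the negative
    comes from the centrality of \<open>-1\<close> rather than from a subgroup property.\<close>
  also have "R.int_embed (-1) \<otimes> aug n \<in> nilpotents R"
  proof -
    obtain k :: nat where k: "aug n [^] k = \<zero>" using n by (auto simp: R.nilpotents_iff)
    have "(R.int_embed (-1) \<otimes> aug n) [^] k = R.int_embed (-1) [^] k \<otimes> aug n [^] k"
      using c by (intro R.pow_mult_distrib R.of_int_central) auto
    then show ?thesis using k c unfolding R.nilpotents_iff by (auto intro!: exI[of _ k])
  qed
  finally have "aug u \<in> nilpotents R" .
  then show False using R.torsion_unit_not_nilpotent[OF u] gtf_one_not_zero by blast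
qed

text \<open>Decompose the constant \<open>r\<close> in \<open>RG\<close> and apply the augmentation.
  The constant is outside the radical of \<open>RG\<close>, since the surjective augmentation maps
  that radical into the one of \<open>R\<close>.\<close>

lemma gtf_coefficients:
  assumes r: "r \<in> carrier R" "r \<notin> jacobson_radical R"
  shows "\<exists>u\<in>torsion_units R. \<exists>n\<in>nilpotents R. r = u \<oplus> n"
proof -
  let ?f = "single \<one>\<^bsub>G\<^esub> r"
  have f: "?f \<in> carrier RG" "aug ?f = r" using r(1) by (auto simp: augmentation_single)
  have "carrier R \<subseteq> aug ` carrier RG"
  proof
    fix a assume "a \<in> carrier R"
    then show "a \<in> aug ` carrier RG"
      by (intro image_eqI[of _ _ "single \<one>\<^bsub>G\<^esub> a"]) (auto simp: augmentation_single)
  qed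
  then have "?f \<notin> jacobson_radical RG"
    using augmentation_jacobson_radical r(2) f(2) by metis
  then obtain u n where un: "u \<in> torsion_units RG" "n \<in> nilpotents RG" "?f = u \<oplus>\<^bsub>RG\<^esub> n"
    using gtf_decomposition f(1) by blast
  have c: "u \<in> carrier RG" "n \<in> carrier RG"
    using un A.nilpotents_carrier by (auto simp: torsion_units_def)
  have "r = aug u \<oplus> aug n" using f(2) un(3) c augmentation_add by simp
  then show ?thesis
    using augmentation_torsion_units[OF un(1)]
      augmentation_nilpotents[OF un(2)] by blast
qed

lemma augmentation_kernel_left_inverse:
  assumes "z \<in> carrier RG" "aug z = \<zero>"
  shows "\<exists>y\<in>carrier RG. y \<otimes>\<^bsub>RG\<^esub> (\<one>\<^bsub>RG\<^esub> \<oplus>\<^bsub>RG\<^esub> z) = \<one>\<^bsub>RG\<^esub>"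
  using A.jacobson_radical_left_inverse augmentation_kernel_in_jacobson_radical[OF assms] by blast

text \<open>In an infinite cyclic group \<open>\<one> - g + g\<^sup>2\<close> has no left inverse: compare the
  lowest and the highest coefficients of the product.\<close>

lemma gtf_torsion_group:
  assumes g: "g \<in> carrier G"
  shows "G.ord g \<noteq> 0"
proof
  assume ord: "G.ord g = 0"
  let ?g2 = "g \<otimes>\<^bsub>G\<^esub> g"
  let ?z = "single g (\<ominus> \<one>) \<oplus>\<^bsub>RG\<^esub> single ?g2 \<one>"
  have z: "?z \<in> carrier RG" using g by auto
  have "aug ?z = \<zero>" using g by (simp add: augmentation_add augmentation_single R.l_neg)
  then obtain y where y: "y \<in> carrier RG" "y \<otimes>\<^bsub>RG\<^esub> (\<one>\<^bsub>RG\<^esub> \<oplus>\<^bsub>RG\<^esub> ?z) = \<one>\<^bsub>RG\<^esub>"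
    using augmentation_kernel_left_inverse z by blast
  have expand: "y \<oplus>\<^bsub>RG\<^esub> (y \<otimes>\<^bsub>RG\<^esub> single g (\<ominus> \<one>) \<oplus>\<^bsub>RG\<^esub> y \<otimes>\<^bsub>RG\<^esub> single ?g2 \<one>) = \<one>\<^bsub>RG\<^esub>"
    using y z g by (simp add: A.r_distr)
  \<comment> \<open>\<open>y\<close> may have support off the powers of \<open>g\<close>, but right
    multiplication by a polynomial in \<open>g\<close> does not mix cosets of the cyclic group, so
    these coefficients satisfy a recurrence of their own.\<close>
  define c where "c k = y (g [^]\<^bsub>G\<^esub> (k::int))" for k
  have cc: "c k \<in> carrier R" for k using y(1) by (simp add: c_def)
  have inj: "g [^]\<^bsub>G\<^esub> (j::int) = g [^]\<^bsub>G\<^esub> (k::int) \<Longrightarrow> j = k" for j k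
    using G.int_pow_eq[OF g, of j k] ord by auto
  have eq: "c k \<oplus> (\<ominus> c (k - 1) \<oplus> c (k - 2)) = (if k = 0 then \<one> else \<zero>)" for k
  proof -
    let ?x = "g [^]\<^bsub>G\<^esub> k"
    have "?x \<otimes>\<^bsub>G\<^esub> inv\<^bsub>G\<^esub> g = g [^]\<^bsub>G\<^esub> (k - 1)" using g by (simp add: G.int_pow_diff)
    moreover have "?x \<otimes>\<^bsub>G\<^esub> inv\<^bsub>G\<^esub> ?g2 = g [^]\<^bsub>G\<^esub> (k - 2)"
    proof -
      have "g [^]\<^bsub>G\<^esub> (2::int) = ?g2" using g G.int_pow_mult[OF g, of 1 1] by simp
      then show ?thesis using g by (simp add: G.int_pow_diff)
    qed
    moreover have "?x = \<one>\<^bsub>G\<^esub> \<longleftrightarrow> k = 0" using inj[of k 0] by auto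
    moreover have "(y \<oplus>\<^bsub>RG\<^esub> (y \<otimes>\<^bsub>RG\<^esub> single g (\<ominus> \<one>) \<oplus>\<^bsub>RG\<^esub> y \<otimes>\<^bsub>RG\<^esub> single ?g2 \<one>)) ?x = \<one>\<^bsub>RG\<^esub> ?x"
      using expand by simp
    ultimately show ?thesis
      using g y(1) by (simp add: group_ring_add_apply mult_single_apply group_ring_one single_apply
          R.r_minus c_def)
  qed
  let ?K = "{k. c k \<noteq> \<zero>}"
  have "(\<lambda>k::int. g [^]\<^bsub>G\<^esub> k) ` ?K \<subseteq> supp y" using g by (auto simp: c_def)
  then have "finite ((\<lambda>k::int. g [^]\<^bsub>G\<^esub> k) ` ?K)"
    by (rule finite_subset) (rule group_ring_finite_supp[OF y(1)])
  then have fin: "finite ?K" by (rule finite_imageD) (auto intro!: inj_onI inj)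
  have ne: "?K \<noteq> {}"
  proof
    assume "?K = {}"
    then have "\<And>k. c k = \<zero>" by auto
    then show False using eq[of 0] gtf_one_not_zero by simp
  qed
  define a where "a = Min ?K"
  define b where "b = Max ?K"
  have a: "c a \<noteq> \<zero>" using Min_in[OF fin ne] by (simp add: a_def)
  have b: "c b \<noteq> \<zero>" using Max_in[OF fin ne] by (simp add: b_def)
  have low: "a \<le> k" and high: "k \<le> b" if "c k \<noteq> \<zero>" for k
    using Min_le[OF fin, of k] Max_ge[OF fin, of k] that by (simp_all add: a_def b_def)
  \<comment> \<open>At the lowest index only the constant term of \<open>1 - g + g^2\<close>
    contributes, so this index must be that of the identity.\<close>
  have "c (a - 1) = \<zero>" "c (a - 2) = \<zero>" using low[of "a - 1"] low[of "a - 2"] by auto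
  then have "c a = (if a = 0 then \<one> else \<zero>)" using eq[of a] cc by simp
  then have "a = 0" using a by presburger
  \<comment> \<open>At \<open>b + 2\<close> only the term \<open>g^2\<close> contributes, which
    forces \<open>b = -2\<close>, below the lowest index \<open>0\<close>.\<close>
  have "c (b + 1) = \<zero>" "c (b + 2) = \<zero>" using high[of "b + 1"] high[of "b + 2"] by auto
  then have "c b = (if b + 2 = 0 then \<one> else \<zero>)" using eq[of "b + 2"] cc by (simp add: add.commute)
  then have "b + 2 = 0" using b by presburger
  then show False using \<open>a = 0\<close> low[OF b] by linarith
qed

text \<open>The scaled sum \<open>s\<close> of the powers of \<open>h\<close> has augmentation
  \<open>1\<close>, so it is one plus a kernel element and left invertible. But
  \<open>s (h - 1) = 0\<close>, which leaves only \<open>h = 1\<close>.\<close>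

lemma gtf_prime_order:
  assumes p: "Factorial_Ring.prime p" "R.int_embed (int p) \<in> nilpotents R"
    and q: "Factorial_Ring.prime q" "q \<noteq> p"
    and h: "h \<in> carrier G" "h [^]\<^bsub>G\<^esub> q = \<one>\<^bsub>G\<^esub>"
  shows "h = \<one>\<^bsub>G\<^esub>"
proof (rule ccontr)
  assume h1: "h \<noteq> \<one>\<^bsub>G\<^esub>"
  obtain k :: nat where k: "R.int_embed (int p) [^] k = \<zero>" using p(2) by (auto simp: R.nilpotents_iff)
  have "coprime (int q) (int p ^ k)" using p(1) q by (simp add: primes_coprime)
  \<comment> \<open>\<open>a\<close> inverts \<open>q\<close> modulo \<open>p^k\<close>, and
    \<open>p^k\<close> is zero in \<open>R\<close>; hence \<open>a q\<close> becomes
    \<open>1\<close> there.\<close>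
  then obtain a b where ab: "a * int q + b * int p ^ k = 1"
    using bezout_int[of "int q" "int p ^ k"] by (auto simp: coprime_iff_gcd_eq_1)
  define S where "S = smult a (\<Sum>i<q. [:0, 1:] ^ i)"
  define e where "e = single h \<one>"
  define s where "s = poly_eval RG e S"
  have e: "e \<in> carrier RG" "aug e = \<one>" using h by (auto simp: e_def augmentation_single)
  have s: "s \<in> carrier RG" using e by (auto simp: s_def)
  have "aug s = poly_eval R \<one> S"
    using augmentation_poly_eval[OF e(1)] e(2) by (simp add: s_def)
  also have "\<dots> = R.int_embed (a * int q)" by (simp add: R.poly_eval_one S_def poly_sum)
  also have "\<dots> = R.int_embed (a * int q) \<oplus> R.int_embed b \<otimes> R.int_embed (int p) [^] k"
    using k by simp
  also have "\<dots> = R.int_embed (a * int q + b * int p ^ k)"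
    by (simp only: R.of_int_add R.of_int_mult R.of_int_power)
  finally have "aug s = \<one>" using ab by simp
  then have aug0: "aug (s \<oplus>\<^bsub>RG\<^esub> single \<one>\<^bsub>G\<^esub> (\<ominus> \<one>)) = \<zero>"
    using s by (simp add: augmentation_add augmentation_single R.r_neg)
  have "s \<oplus>\<^bsub>RG\<^esub> single \<one>\<^bsub>G\<^esub> (\<ominus> \<one>) \<in> carrier RG" using s by auto
  from augmentation_kernel_left_inverse[OF this aug0] obtain y where y: "y \<in> carrier RG"
    "y \<otimes>\<^bsub>RG\<^esub> (\<one>\<^bsub>RG\<^esub> \<oplus>\<^bsub>RG\<^esub> (s \<oplus>\<^bsub>RG\<^esub> single \<one>\<^bsub>G\<^esub> (\<ominus> \<one>))) = \<one>\<^bsub>RG\<^esub>"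
    by blast
  have "\<one>\<^bsub>RG\<^esub> \<oplus>\<^bsub>RG\<^esub> (s \<oplus>\<^bsub>RG\<^esub> single \<one>\<^bsub>G\<^esub> (\<ominus> \<one>)) = s"
    using s one_plus_single_minus_one by (subst A.a_lcomm) auto
  then have ys: "y \<otimes>\<^bsub>RG\<^esub> s = \<one>\<^bsub>RG\<^esub>" using y(2) by simp
  have "S * ([:0, 1:] - 1) = smult a ([:0, 1:] ^ q - 1)"
    unfolding S_def using power_diff_1_eq[of "[:0, 1:] :: int poly" q] by (simp add: mult.commute)
  then have "poly_eval RG e (S * ([:0, 1:] - 1)) = poly_eval RG e (smult a ([:0, 1:] ^ q - 1))" by simp
  then have "s \<otimes>\<^bsub>RG\<^esub> (e \<ominus>\<^bsub>RG\<^esub> \<one>\<^bsub>RG\<^esub>) = A.int_embed a \<otimes>\<^bsub>RG\<^esub> (e [^]\<^bsub>RG\<^esub> q \<ominus>\<^bsub>RG\<^esub> \<one>\<^bsub>RG\<^esub>)"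
    using e(1) unfolding s_def
    by (simp only: A.poly_eval_mult A.poly_eval_diff A.poly_eval_smult A.poly_eval_X_power
        A.poly_eval_X A.poly_eval_1)
  also have "e [^]\<^bsub>RG\<^esub> q = \<one>\<^bsub>RG\<^esub>" using h by (simp add: e_def single_pow group_ring_one)
  finally have "s \<otimes>\<^bsub>RG\<^esub> (e \<ominus>\<^bsub>RG\<^esub> \<one>\<^bsub>RG\<^esub>) = \<zero>\<^bsub>RG\<^esub>" by (simp add: A.r_neg A.minus_eq)
  then have "y \<otimes>\<^bsub>RG\<^esub> s \<otimes>\<^bsub>RG\<^esub> (e \<ominus>\<^bsub>RG\<^esub> \<one>\<^bsub>RG\<^esub>) = \<zero>\<^bsub>RG\<^esub>"
    using y(1) s e(1) by (simp add: A.m_assoc)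
  then have "e \<ominus>\<^bsub>RG\<^esub> \<one>\<^bsub>RG\<^esub> = \<zero>\<^bsub>RG\<^esub>" using ys e(1) by simp
  then have "e = \<one>\<^bsub>RG\<^esub>" using e(1) by simp
  then have "e h = \<one>\<^bsub>RG\<^esub> h" by simp
  then show False using h1 gtf_one_not_zero by (simp add: e_def group_ring_one single_apply)
qed

lemma gtf_p_group:
  assumes p: "Factorial_Ring.prime p" "R.int_embed (int p) \<in> nilpotents R"
  shows "p_group p G"
  unfolding p_group_def
proof (intro conjI ballI G.group_axioms)
  fix g assume g: "g \<in> carrier G"
  have n: "G.ord g > 0" using gtf_torsion_group[OF g] by simp
  have "q = p" if q: "Factorial_Ring.prime q" "q dvd G.ord g" for q
  proof (rule ccontr)
    assume "q \<noteq> p"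
    obtain m where m: "G.ord g = q * m" using q(2) by (elim dvdE)
    let ?h = "g [^]\<^bsub>G\<^esub> m"
    have "?h [^]\<^bsub>G\<^esub> q = \<one>\<^bsub>G\<^esub>" using g m G.pow_ord_eq_1[OF g] by (simp add: G.nat_pow_pow mult.commute)
    then have "?h = \<one>\<^bsub>G\<^esub>" using gtf_prime_order[OF p q(1) \<open>q \<noteq> p\<close>] g by simp
    then have "G.ord g dvd m" using G.pow_eq_id g by blast
    then have "q * m \<le> m" using m n by (metis dvd_imp_le mult_eq_0_iff neq0_conv)
    then show False using m n prime_gt_1_nat[OF q(1)] by simp
  qed
  then show "\<exists>k. G.ord g = p ^ k" using prime_power_of_unique_prime_divisor n p(1) by blast
qed

end

end

section \<open>Derived subgroups of finitely generated torsion groups\<close>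

context group
begin

lemma commutator_in_derived:
  assumes "subgroup L G" "x \<in> L" "y \<in> L"
  shows "x \<otimes> y \<otimes> inv x \<otimes> inv y \<in> derived G L"
  unfolding derived_def using assms by (intro generate.incl) blast

text \<open>A conjugate of \<open>h\<close> is a commutator times \<open>h\<close>, so any subgroup
  between \<open>derived G L\<close> and \<open>L\<close> is normal in \<open>L\<close>.\<close>

lemma conj_in_subgroup_above_derived:
  assumes L: "subgroup L G" and H: "subgroup H G" "derived G L \<subseteq> H" "H \<subseteq> L"
    and "x \<in> L" "h \<in> H"
  shows "x \<otimes> h \<otimes> inv x \<in> H"
proof -
  have c: "x \<in> carrier G" "h \<in> carrier G" using assms subgroup.subset by blast+
  have "x \<otimes> h \<otimes> inv x \<otimes> inv h \<in> H" using commutator_in_derived[OF L] assms by blast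
  then have "(x \<otimes> h \<otimes> inv x \<otimes> inv h) \<otimes> h \<in> H" using subgroup.m_closed[OF H(1)] \<open>h \<in> H\<close> by blast
  then show ?thesis using c by (simp add: m_assoc)
qed

lemma subgroup_nat_pow_closed:
  "subgroup H G \<Longrightarrow> h \<in> H \<Longrightarrow> h [^] (n::nat) \<in> H"
  by (induction n) (auto simp: subgroup.one_closed subgroup.m_closed)

text \<open>The product of \<open>H\<close> with the powers of \<open>t\<close>. Natural exponents
  reach the inverses because \<open>t\<close> will have finite order.\<close>

definition cyclic_extension :: "'a set \<Rightarrow> 'a \<Rightarrow> 'a set" where
  "cyclic_extension H t = {h \<otimes> t [^] i |h (i::nat). h \<in> H}"

lemma subgroup_cyclic_extension:
  assumes L: "subgroup L G" and H: "subgroup H G" "derived G L \<subseteq> H" "H \<subseteq> L"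
    and t: "t \<in> L" "t [^] (m::nat) = \<one>" "m \<ge> 1"
  shows "subgroup (cyclic_extension H t) G"
proof (rule subgroupI)
  have tc: "t \<in> carrier G" and Hc: "H \<subseteq> carrier G" using t L H subgroup.subset by blast+
  have pow: "t [^] (i::nat) \<in> L" for i using subgroup_nat_pow_closed[OF L t(1)] .
  have conj: "t [^] (i::nat) \<otimes> h \<otimes> inv (t [^] i) \<in> H" if "h \<in> H" for i h
    using conj_in_subgroup_above_derived[OF L H pow that] .
  show "cyclic_extension H t \<subseteq> carrier G" using tc Hc by (auto simp: cyclic_extension_def)
  show "cyclic_extension H t \<noteq> {}"
    using subgroup.one_closed[OF H(1)] by (auto simp: cyclic_extension_def)
  fix a assume "a \<in> cyclic_extension H t"
  then obtain h i where a: "h \<in> H" "a = h \<otimes> t [^] (i::nat)" by (auto simp: cyclic_extension_def)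
  have hc: "h \<in> carrier G" using a Hc by auto
  {
    \<comment> \<open>\<open>j + i\<close> is the multiple \<open>m * i\<close> of the exponent, so
      \<open>t [^] j\<close> inverts \<open>t [^] i\<close>.\<close>
    define j where "j = (m - 1) * i"
    have "t [^] j \<otimes> t [^] i = (t [^] m) [^] i"
    proof -
      have "j + i = m * i" using t(3) unfolding j_def by (cases m) auto
      then show ?thesis using tc by (simp add: nat_pow_mult nat_pow_pow)
    qed
    then have inv_pow: "inv (t [^] i) = t [^] j" using t(2) tc by (simp add: inv_equality)
    then have inv_pow': "inv (t [^] j) = t [^] i" using tc by (metis inv_inv nat_pow_closed)
    have ij: "t [^] i \<otimes> t [^] j = \<one>" using inv_pow tc by (metis nat_pow_closed r_inv)
    have "inv a = (t [^] j \<otimes> inv h \<otimes> inv (t [^] j)) \<otimes> t [^] j"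
      using a(2) hc tc inv_pow inv_pow' ij by (simp add: inv_mult_group m_assoc)
    moreover have "t [^] j \<otimes> inv h \<otimes> inv (t [^] j) \<in> H"
      using conj subgroup.m_inv_closed[OF H(1) a(1)] by blast
    ultimately show "inv a \<in> cyclic_extension H t" unfolding cyclic_extension_def by blast
  }
  fix b assume "b \<in> cyclic_extension H t"
  then obtain h' j where b: "h' \<in> H" "b = h' \<otimes> t [^] (j::nat)" by (auto simp: cyclic_extension_def)
  have hc': "h' \<in> carrier G" using b Hc by auto
  have "inv (t [^] i) \<otimes> (t [^] i \<otimes> t [^] j) = t [^] j" using tc by (simp add: m_assoc[symmetric])
  then have "a \<otimes> b = (h \<otimes> (t [^] i \<otimes> h' \<otimes> inv (t [^] i))) \<otimes> (t [^] i \<otimes> t [^] j)"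
    using a(2) b(2) hc hc' tc by (simp add: m_assoc)
  also have "t [^] i \<otimes> t [^] j = t [^] (i + j)" using tc by (simp add: nat_pow_mult)
  finally show "a \<otimes> b \<in> cyclic_extension H t"
    using subgroup.m_closed[OF H(1) a(1) conj[OF b(1), of i]] unfolding cyclic_extension_def by blast
qed

lemma cyclic_extension_contains:
  assumes "subgroup H G" "t \<in> carrier G"
  shows "H \<subseteq> cyclic_extension H t" "t \<in> cyclic_extension H t"
proof -
  have Hc: "H \<subseteq> carrier G" using assms(1) by (rule subgroup.subset)
  show "H \<subseteq> cyclic_extension H t"
  proof
    fix h assume "h \<in> H"
    then have "h = h \<otimes> t [^] (0::nat)" using Hc by auto
    then show "h \<in> cyclic_extension H t" using \<open>h \<in> H\<close> unfolding cyclic_extension_def by blast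
  qed
  have "t = \<one> \<otimes> t [^] (1::nat)" using assms(2) by simp
  then show "t \<in> cyclic_extension H t"
    using subgroup.one_closed[OF assms(1)] unfolding cyclic_extension_def by blast
qed

lemma cyclic_extension_subset:
  assumes "subgroup L G" "H \<subseteq> L" "t \<in> L"
  shows "cyclic_extension H t \<subseteq> L"
  using assms subgroup_nat_pow_closed[OF assms(1,3)]
  by (auto simp: cyclic_extension_def intro!: subgroup.m_closed)

text \<open>Adjoin the elements of \<open>S\<close> one by one; all intermediate subgroups contain
  \<open>derived G L\<close> and are normal in \<open>L\<close>. The property is a parameter because
  the chain serves twice: for the finite index of the derived subgroup and for nilpotence of
  augmentation ideals.\<close>

lemma cyclic_extension_chain:
  assumes torsion: "\<And>x. x \<in> carrier G \<Longrightarrow> \<exists>m::nat. m \<ge> 1 \<and> x [^] m = \<one>"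
    and L: "subgroup L G" and K: "subgroup K G" "derived G L \<subseteq> K" "K \<subseteq> L"
    and base: "\<Phi> K"
    and step: "\<And>H t. subgroup H G \<Longrightarrow> derived G L \<subseteq> H \<Longrightarrow> H \<subseteq> L \<Longrightarrow> t \<in> L \<Longrightarrow> \<Phi> H \<Longrightarrow>
      \<Phi> (cyclic_extension H t)"
    and S: "finite S" "S \<subseteq> L"
  shows "\<exists>H. subgroup H G \<and> derived G L \<subseteq> H \<and> H \<subseteq> L \<and> S \<subseteq> H \<and> \<Phi> H"
  using S
proof (induction S rule: finite_induct)
  case empty
  then show ?case using K base by blast
next
  case (insert t S)
  then obtain H where H: "subgroup H G" "derived G L \<subseteq> H" "H \<subseteq> L" "S \<subseteq> H" "\<Phi> H" by auto
  have t: "t \<in> L" "t \<in> carrier G" using insert subgroup.subset[OF L] by auto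
  obtain m :: nat where m: "m \<ge> 1" "t [^] m = \<one>" using torsion t(2) by blast
  show ?case
    using subgroup_cyclic_extension[OF L H(1-3) t(1) m(2,1)] cyclic_extension_contains[OF H(1) t(2)]
      cyclic_extension_subset[OF L H(3) t(1)] step[OF H(1-3) t(1) H(5)] H(2,4)
    by (intro exI[of _ "cyclic_extension H t"]) auto
qed

text \<open>Schreier's lemma with a finite covering set \<open>U\<close> in place of an exact
  transversal. A word is read letter by letter, and each \<open>u s\<close> is rewritten as
  \<open>k v\<close> with \<open>k\<close> in the finite set \<open>T\<close>.\<close>

lemma schreier:
  assumes S: "finite S" "S \<subseteq> carrier G" and K: "subgroup K G" "K \<subseteq> generate G S"
    and U: "finite U" "U \<subseteq> carrier G" "\<one> \<in> U"
    and cover: "\<And>x. x \<in> generate G S \<Longrightarrow> \<exists>k\<in>K. \<exists>u\<in>U. x = k \<otimes> u" and UL: "U \<subseteq> generate G S"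
  shows "\<exists>T. finite T \<and> T \<subseteq> carrier G \<and> K = generate G T"
proof -
  let ?L = "generate G S"
  define W where "W = {\<one>} \<union> S \<union> (\<lambda>s. inv s) ` S"
  define T where "T = K \<inter> (\<lambda>(u, s, v). u \<otimes> s \<otimes> inv v) ` (U \<times> W \<times> U)"
  have L: "subgroup ?L G" using S(2) by (rule generate_is_subgroup)
  have Kc: "K \<subseteq> carrier G" using K(1) by (rule subgroup.subset)
  have W: "finite W" "W \<subseteq> carrier G" "W \<subseteq> ?L"
    using S by (auto simp: W_def generate.one intro: generate.incl generate.inv)
  have T: "finite T" "T \<subseteq> carrier G" "T \<subseteq> K" using U W Kc by (auto simp: T_def)
  have GT: "subgroup (generate G T) G" using T(2) by (rule generate_is_subgroup)
  have GTc: "generate G T \<subseteq> carrier G" using GT by (rule subgroup.subset)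
  have move: "\<exists>g\<in>generate G T. \<exists>v\<in>U. u \<otimes> s = g \<otimes> v" if u: "u \<in> U" and s: "s \<in> W" for u s
  proof -
    have "u \<otimes> s \<in> ?L" using subgroup.m_closed[OF L] u s UL W(3) by blast
    then obtain k v where kv: "k \<in> K" "v \<in> U" "u \<otimes> s = k \<otimes> v" using cover by blast
    have c: "u \<in> carrier G" "s \<in> carrier G" "k \<in> carrier G" "v \<in> carrier G"
      using u s kv U(2) W(2) Kc by auto
    have "k = u \<otimes> s \<otimes> inv v" using kv(3) c by (simp add: m_assoc)
    then have "k \<in> T" using kv u s unfolding T_def by force
    then show ?thesis using kv generate.incl by metis
  qed
  have all: "\<exists>g\<in>generate G T. \<exists>v\<in>U. u \<otimes> x = g \<otimes> v" if "x \<in> ?L" "u \<in> U" for x u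
    using that
  proof (induction x arbitrary: u rule: generate.induct)
    case one
    then show ?case using move[of u \<one>] by (simp add: W_def)
  next
    case (incl s)
    then show ?case using move[of u s] by (simp add: W_def)
  next
    case (inv s)
    then show ?case using move[of u "inv s"] by (simp add: W_def)
  next
    case (eng x y)
    obtain g v where gv: "g \<in> generate G T" "v \<in> U" "u \<otimes> x = g \<otimes> v" using eng by blast
    obtain g' v' where gv': "g' \<in> generate G T" "v' \<in> U" "v \<otimes> y = g' \<otimes> v'" using eng gv(2) by blast
    have c: "u \<in> carrier G" "x \<in> carrier G" "y \<in> carrier G" "g \<in> carrier G" "g' \<in> carrier G"
      "v \<in> carrier G" "v' \<in> carrier G"
      using eng gv gv' U(2) GTc subgroup.subset[OF L] by auto
    have "u \<otimes> (x \<otimes> y) = g \<otimes> (v \<otimes> y)" using c gv(3) by (metis m_assoc)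
    also have "\<dots> = (g \<otimes> g') \<otimes> v'" using c gv'(3) by (simp add: m_assoc)
    finally show ?case using subgroup.m_closed[OF GT gv(1) gv'(1)] gv'(2) by blast
  qed
  have "K \<subseteq> generate G T"
  proof
    fix k assume k: "k \<in> K"
    then have kc: "k \<in> carrier G" using Kc by auto
    obtain g v where gv: "g \<in> generate G T" "v \<in> U" "k = g \<otimes> v"
      using all[of k \<one>] k K(2) U(3) kc by auto
    have c: "g \<in> carrier G" "v \<in> carrier G" using gv U(2) GTc by auto
    have gK: "g \<in> K" using gv(1) generate_subgroup_incl[OF T(3) K(1)] by auto
    have "v = inv g \<otimes> k" using gv(3) c by (simp add: m_assoc[symmetric])
    then have "v \<in> K" using subgroup.m_closed[OF K(1) subgroup.m_inv_closed[OF K(1) gK] k] by simp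
    \<comment> \<open>The leftover representative lies in \<open>K\<close> and is itself one of the
      generators, with the letter \<open>1\<close> of \<open>W\<close>.\<close>
    moreover have "v = (\<lambda>(u, s, v). u \<otimes> s \<otimes> inv v) (v, \<one>, \<one>)" using c by simp
    ultimately have "v \<in> T" using gv(2) U(3) unfolding T_def W_def by blast
    then show "k \<in> generate G T" using gv(1,3) subgroup.m_closed[OF GT] generate.incl by metis
  qed
  moreover have "generate G T \<subseteq> K" by (rule generate_subgroup_incl[OF T(3) K(1)])
  ultimately show ?thesis using T by blast
qed

text \<open>The abelianization is generated by finitely many torsion elements, hence finite:
  exponents reduced modulo the orders give finitely many representatives, as \<open>\<Phi>\<close>
  records along the chain. Then \<open>schreier\<close> applies.\<close>

lemma derived_finitely_generated:
  assumes torsion: "\<And>x. x \<in> carrier G \<Longrightarrow> \<exists>m::nat. m \<ge> 1 \<and> x [^] m = \<one>"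
    and S: "finite S" "S \<subseteq> carrier G"
  shows "\<exists>T. finite T \<and> T \<subseteq> carrier G \<and> derived G (generate G S) = generate G T"
proof -
  let ?L = "generate G S"
  let ?K = "derived G ?L"
  define \<Phi> where "\<Phi> H \<longleftrightarrow>
    (\<exists>U. finite U \<and> U \<subseteq> ?L \<and> \<one> \<in> U \<and> (\<forall>x\<in>H. \<exists>k\<in>?K. \<exists>u\<in>U. x = k \<otimes> u))" for H
  have L: "subgroup ?L G" using S(2) by (rule generate_is_subgroup)
  have Lc: "?L \<subseteq> carrier G" using L by (rule subgroup.subset)
  have K: "subgroup ?K G" using Lc by (rule derived_is_subgroup)
  have KL: "?K \<subseteq> ?L" using L by (rule derived_incl[OF order_refl])
  have Kc: "?K \<subseteq> carrier G" using K by (rule subgroup.subset)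
  have "\<exists>H. subgroup H G \<and> ?K \<subseteq> H \<and> H \<subseteq> ?L \<and> S \<subseteq> H \<and> \<Phi> H"
  proof (rule cyclic_extension_chain[OF torsion L K order_refl KL _ _ S(1)])
    show "S \<subseteq> ?L" by (auto intro: generate.incl)
    have "\<forall>x\<in>?K. x = x \<otimes> \<one>" using Kc by auto
    then show "\<Phi> ?K" unfolding \<Phi>_def using generate.one[of G S] by (intro exI[of _ "{\<one>}"]) auto
  next
    fix H t assume H: "subgroup H G" "H \<subseteq> ?L" and t: "t \<in> ?L" and "\<Phi> H"
    then obtain U where U: "finite U" "U \<subseteq> ?L" "\<one> \<in> U" "\<forall>x\<in>H. \<exists>k\<in>?K. \<exists>u\<in>U. x = k \<otimes> u"
      unfolding \<Phi>_def by blast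
    have tc: "t \<in> carrier G" using t Lc by auto
    obtain m :: nat where m: "m \<ge> 1" "t [^] m = \<one>" using torsion tc by blast
    define V where "V = (\<lambda>(u, i). u \<otimes> t [^] i) ` (U \<times> {..<m})"
    have V1: "finite V" using U(1) by (simp add: V_def)
    have V2: "V \<subseteq> ?L"
      using U(2) subgroup_nat_pow_closed[OF L t] by (auto simp: V_def intro!: subgroup.m_closed[OF L])
    have V3: "\<one> \<in> V"
      unfolding V_def using U(3) m(1) by (intro image_eqI[of _ _ "(\<one>, 0)"]) auto
    have V4: "\<exists>k\<in>?K. \<exists>u\<in>V. x = k \<otimes> u" if "x \<in> cyclic_extension H t" for x
    proof -
      obtain h i where hi: "h \<in> H" "x = h \<otimes> t [^] (i::nat)" using \<open>x \<in> _\<close> by (auto simp: cyclic_extension_def)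
      obtain k u where ku: "k \<in> ?K" "u \<in> U" "h = k \<otimes> u" using U(4) hi(1) by blast
      have c: "k \<in> carrier G" "u \<in> carrier G" using ku U(2) Lc Kc by auto
      have "x = k \<otimes> (u \<otimes> t [^] (i mod m))"
        using hi(2) ku(3) c tc nat_pow_mod[OF tc m(2), of i] by (simp add: m_assoc)
      moreover have "u \<otimes> t [^] (i mod m) \<in> V"
        unfolding V_def using ku(2) m(1) by (intro image_eqI[of _ _ "(u, i mod m)"]) auto
      ultimately show ?thesis using ku(1) by blast
    qed
    show "\<Phi> (cyclic_extension H t)"
      unfolding \<Phi>_def by (intro exI[of _ V] conjI ballI V1 V2 V3 V4)
  qed
  then obtain H where H: "subgroup H G" "S \<subseteq> H" "\<Phi> H" by blast
  then obtain U where U: "finite U" "U \<subseteq> ?L" "\<one> \<in> U" "\<forall>x\<in>H. \<exists>k\<in>?K. \<exists>u\<in>U. x = k \<otimes> u"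
    unfolding \<Phi>_def by blast
  have LH: "?L \<subseteq> H" using generate_subgroup_incl[OF H(2,1)] .
  have Uc: "U \<subseteq> carrier G" using U(2) Lc by auto
  have cover: "\<exists>k\<in>?K. \<exists>u\<in>U. x = k \<otimes> u" if "x \<in> ?L" for x using U(4) LH that by auto
  show ?thesis by (rule schreier[OF S K KL U(1) Uc U(3) cover U(2)])
qed

end

section \<open>The augmentation ideal over a locally solvable p-group\<close>

context group_over_ring
begin

definition delta :: "'c \<Rightarrow> 'c \<Rightarrow> 'a" where
  "delta g = single g \<one> \<ominus>\<^bsub>RG\<^esub> \<one>\<^bsub>RG\<^esub>"

lemma delta_closed [simp]: "g \<in> carrier G \<Longrightarrow> delta g \<in> carrier RG"
  by (simp add: delta_def)

lemma delta_mult: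
  assumes "g \<in> carrier G" "x \<in> carrier RG"
  shows "single g \<one> \<otimes>\<^bsub>RG\<^esub> x = x \<oplus>\<^bsub>RG\<^esub> delta g \<otimes>\<^bsub>RG\<^esub> x"
proof -
  have "single g \<one> \<in> carrier RG" using assms by simp
  then show ?thesis unfolding delta_def using assms(2) by algebra
qed

text \<open>The \<open>n\<close>-th level is the set of all elements annihilated from the left by every product of
  \<open>n\<close> factors \<open>h - 1\<close> with \<open>h \<in> H\<close>.\<close>

fun aug_filtration :: "'c set \<Rightarrow> nat \<Rightarrow> ('c \<Rightarrow> 'a) set" where
  "aug_filtration H 0 = {\<zero>\<^bsub>RG\<^esub>}"
| "aug_filtration H (Suc n) = {x \<in> carrier RG. \<forall>h\<in>H. delta h \<otimes>\<^bsub>RG\<^esub> x \<in> aug_filtration H n}"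

lemma aug_filtration_carrier: "x \<in> aug_filtration H n \<Longrightarrow> x \<in> carrier RG"
  by (cases n) auto

context
  fixes H assumes H: "subgroup H G"
begin

lemma subgroup_elt: "h \<in> H \<Longrightarrow> h \<in> carrier G"
  using subgroup.mem_carrier[OF H] .

lemma aug_filtration_zero: "\<zero>\<^bsub>RG\<^esub> \<in> aug_filtration H n"
  by (induction n) (auto simp: subgroup_elt)

lemma aug_filtration_add: "x \<in> aug_filtration H n \<Longrightarrow> y \<in> aug_filtration H n \<Longrightarrow> x \<oplus>\<^bsub>RG\<^esub> y \<in> aug_filtration H n"
  by (induction n arbitrary: x y) (auto simp: A.r_distr subgroup_elt)

text \<open>Scalars commute with group elements in \<open>RG\<close>, even if \<open>R\<close> is
  not commutative.\<close>

lemma aug_filtration_scalar: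
  assumes c: "c \<in> carrier R"
  shows "x \<in> aug_filtration H n \<Longrightarrow> single \<one>\<^bsub>G\<^esub> c \<otimes>\<^bsub>RG\<^esub> x \<in> aug_filtration H n"
proof (induction n arbitrary: x)
  case (Suc n)
  have x: "x \<in> carrier RG" using Suc(2) by simp
  have "delta h \<otimes>\<^bsub>RG\<^esub> (single \<one>\<^bsub>G\<^esub> c \<otimes>\<^bsub>RG\<^esub> x) \<in> aug_filtration H n" if h: "h \<in> H" for h
  proof -
    have hc: "h \<in> carrier G" using h subgroup_elt by auto
    have "single h \<one> \<otimes>\<^bsub>RG\<^esub> single \<one>\<^bsub>G\<^esub> c = single \<one>\<^bsub>G\<^esub> c \<otimes>\<^bsub>RG\<^esub> single h \<one>"
      using hc c by (simp add: single_mult)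
    then have "delta h \<otimes>\<^bsub>RG\<^esub> single \<one>\<^bsub>G\<^esub> c = single \<one>\<^bsub>G\<^esub> c \<otimes>\<^bsub>RG\<^esub> delta h"
      unfolding delta_def using hc c by (simp add: A.minus_eq A.l_distr A.r_distr A.l_minus A.r_minus)
    then have "delta h \<otimes>\<^bsub>RG\<^esub> (single \<one>\<^bsub>G\<^esub> c \<otimes>\<^bsub>RG\<^esub> x) = single \<one>\<^bsub>G\<^esub> c \<otimes>\<^bsub>RG\<^esub> (delta h \<otimes>\<^bsub>RG\<^esub> x)"
      using hc c x by (simp add: A.m_assoc[symmetric])
    then show ?thesis using Suc h by simp
  qed
  then show ?case using x c by simp
qed (use c in simp)

lemma aug_filtration_minus: "x \<in> aug_filtration H n \<Longrightarrow> y \<in> aug_filtration H n \<Longrightarrow> x \<ominus>\<^bsub>RG\<^esub> y \<in> aug_filtration H n"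
proof -
  assume xy: "x \<in> aug_filtration H n" "y \<in> aug_filtration H n"
  have "single \<one>\<^bsub>G\<^esub> (\<ominus> \<one>) = \<ominus>\<^bsub>RG\<^esub> \<one>\<^bsub>RG\<^esub>"
    by (metis one_plus_single_minus_one A.a_comm A.minus_equality A.one_closed G.one_closed R.a_inv_closed R.one_closed single_closed)
  then have "x \<ominus>\<^bsub>RG\<^esub> y = x \<oplus>\<^bsub>RG\<^esub> single \<one>\<^bsub>G\<^esub> (\<ominus> \<one>) \<otimes>\<^bsub>RG\<^esub> y"
    using xy aug_filtration_carrier by (simp add: A.minus_eq A.l_minus)
  moreover have "single \<one>\<^bsub>G\<^esub> (\<ominus> \<one>) \<otimes>\<^bsub>RG\<^esub> y \<in> aug_filtration H n" using xy(2) by (intro aug_filtration_scalar) auto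
  ultimately show ?thesis using aug_filtration_add[OF xy(1)] by simp
qed

lemma aug_filtration_Suc: "x \<in> aug_filtration H n \<Longrightarrow> x \<in> aug_filtration H (Suc n)"
  by (induction n arbitrary: x) (auto simp: subgroup_elt)

text \<open>\<open>(h - 1) t = t (t^(-1) h t - 1)\<close>, and the conjugate of \<open>h\<close>
  stays in \<open>H\<close>.\<close>

lemma aug_filtration_normalizer:
  assumes t: "t \<in> carrier G" "\<And>h. h \<in> H \<Longrightarrow> inv\<^bsub>G\<^esub> t \<otimes>\<^bsub>G\<^esub> h \<otimes>\<^bsub>G\<^esub> t \<in> H"
  shows "x \<in> aug_filtration H n \<Longrightarrow> single t \<one> \<otimes>\<^bsub>RG\<^esub> x \<in> aug_filtration H n"
proof (induction n arbitrary: x)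
  case (Suc n)
  have x: "x \<in> carrier RG" using Suc(2) by simp
  have "delta h \<otimes>\<^bsub>RG\<^esub> (single t \<one> \<otimes>\<^bsub>RG\<^esub> x) \<in> aug_filtration H n" if h: "h \<in> H" for h
  proof -
    let ?k = "inv\<^bsub>G\<^esub> t \<otimes>\<^bsub>G\<^esub> h \<otimes>\<^bsub>G\<^esub> t"
    have hc: "h \<in> carrier G" "?k \<in> carrier G" using h t subgroup_elt by auto
    have "t \<otimes>\<^bsub>G\<^esub> ?k = h \<otimes>\<^bsub>G\<^esub> t"
      using hc(1) t(1) by (simp add: G.m_assoc[symmetric])
    then have "single h \<one> \<otimes>\<^bsub>RG\<^esub> single t \<one> = single t \<one> \<otimes>\<^bsub>RG\<^esub> single ?k \<one>"
      using hc t(1) by (simp add: single_mult)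
    then have "delta h \<otimes>\<^bsub>RG\<^esub> single t \<one> = single t \<one> \<otimes>\<^bsub>RG\<^esub> delta ?k"
      unfolding delta_def using hc t(1) by (simp add: A.minus_eq A.l_distr A.r_distr A.l_minus A.r_minus)
    then have "delta h \<otimes>\<^bsub>RG\<^esub> (single t \<one> \<otimes>\<^bsub>RG\<^esub> x) = single t \<one> \<otimes>\<^bsub>RG\<^esub> (delta ?k \<otimes>\<^bsub>RG\<^esub> x)"
      using hc t(1) x by (simp add: A.m_assoc[symmetric])
    then show ?thesis using Suc t(2)[OF h] by simp
  qed
  then show ?case using x t by simp
qed (use t in simp)

end

text \<open>Applied to the element \<open>1\<close> of the carrier, this says that every product of
  \<open>N\<close> factors \<open>h - 1\<close> with \<open>h \<in> H\<close> is zero: the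
  augmentation ideal of \<open>H\<close> is nilpotent.\<close>

definition augmentation_nilpotent :: "'c set \<Rightarrow> bool" where
  "augmentation_nilpotent H \<longleftrightarrow> (\<exists>N. carrier RG \<subseteq> aug_filtration H N)"

lemma augmentation_nilpotent_trivial: "augmentation_nilpotent {\<one>\<^bsub>G\<^esub>}"
proof -
  have "delta \<one>\<^bsub>G\<^esub> = \<zero>\<^bsub>RG\<^esub>" by (simp add: delta_def group_ring_one[symmetric] A.minus_eq A.r_neg)
  then have "carrier RG \<subseteq> aug_filtration {\<one>\<^bsub>G\<^esub>} 1" by auto
  then show ?thesis unfolding augmentation_nilpotent_def by blast
qed

text \<open>The step between two consecutive levels for \<open>H\<close> is refined by powers of \<open>t - 1\<close>, which acts
  nilpotently; every \<open>h t\<^sup>j - 1\<close> lowers the refined level by one.\<close>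

lemma augmentation_nilpotent_cyclic_extension:
  assumes H: "subgroup H G" and Q: "augmentation_nilpotent H"
    and t: "t \<in> carrier G" "\<And>h. h \<in> H \<Longrightarrow> inv\<^bsub>G\<^esub> t \<otimes>\<^bsub>G\<^esub> h \<otimes>\<^bsub>G\<^esub> t \<in> H"
    and nil: "delta t [^]\<^bsub>RG\<^esub> (M::nat) = \<zero>\<^bsub>RG\<^esub>"
  shows "augmentation_nilpotent (G.cyclic_extension H t)"
proof -
  let ?H = "G.cyclic_extension H t"
  let ?e = "single t \<one>"
  have e: "?e \<in> carrier RG" using t by simp
  \<comment> \<open>These sets interpolate between two levels for \<open>H\<close>:
    \<open>V i 0\<close> lies in level \<open>i\<close>, and \<open>V i M\<close> contains level
    \<open>Suc i\<close> because \<open>(t - 1)^M = 0\<close>.\<close>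
  define V where "V i m = {z \<in> aug_filtration H (Suc i). delta t [^]\<^bsub>RG\<^esub> (m::nat) \<otimes>\<^bsub>RG\<^esub> z \<in> aug_filtration H i}" for i m
  have Vc: "z \<in> carrier RG" if "z \<in> V i m" for z i m
    using that aug_filtration_carrier unfolding V_def by blast
  have dp: "delta t [^]\<^bsub>RG\<^esub> (m::nat) \<in> carrier RG" for m using t by simp
  have V_add: "y \<oplus>\<^bsub>RG\<^esub> z \<in> V i m" if "y \<in> V i m" "z \<in> V i m" for y z i m
    using that aug_filtration_add[OF H] Vc[OF that(1)] Vc[OF that(2)] dp
    unfolding V_def by (simp only: mem_Collect_eq A.r_distr)
  have delta_aug_filtration: "delta t [^]\<^bsub>RG\<^esub> (m::nat) \<otimes>\<^bsub>RG\<^esub> z \<in> aug_filtration H i" if "z \<in> aug_filtration H i" for z i m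
    using that
  proof (induction m arbitrary: z)
    case (Suc m)
    have z: "z \<in> carrier RG" using Suc aug_filtration_carrier by blast
    have "?e \<otimes>\<^bsub>RG\<^esub> z \<ominus>\<^bsub>RG\<^esub> z \<in> aug_filtration H i"
      using aug_filtration_minus[OF H aug_filtration_normalizer[OF H t Suc(2)] Suc(2)] .
    moreover have "?e \<otimes>\<^bsub>RG\<^esub> z \<ominus>\<^bsub>RG\<^esub> z = delta t \<otimes>\<^bsub>RG\<^esub> z" unfolding delta_def using e z by algebra
    ultimately have "delta t [^]\<^bsub>RG\<^esub> m \<otimes>\<^bsub>RG\<^esub> (delta t \<otimes>\<^bsub>RG\<^esub> z) \<in> aug_filtration H i" using Suc(1) by simp
    then show ?case using z t by (simp add: A.m_assoc)
  qed (use aug_filtration_carrier in simp)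
  have V_aug_filtration: "z \<in> V i m" if "z \<in> aug_filtration H i" for z i m
    using aug_filtration_Suc[OF H that] delta_aug_filtration[OF that] by (simp add: V_def)
  have V_t: "?e \<otimes>\<^bsub>RG\<^esub> z \<in> V i m" if z: "z \<in> V i m" for z i m
  proof -
    have "?e \<otimes>\<^bsub>RG\<^esub> delta t = delta t \<otimes>\<^bsub>RG\<^esub> ?e"
      unfolding delta_def using e by (simp add: A.minus_eq A.l_distr A.r_distr A.l_minus A.r_minus)
    then have "delta t [^]\<^bsub>RG\<^esub> m \<otimes>\<^bsub>RG\<^esub> ?e = ?e \<otimes>\<^bsub>RG\<^esub> delta t [^]\<^bsub>RG\<^esub> m"
      using e t by (intro A.group_commutes_pow) auto
    then have "delta t [^]\<^bsub>RG\<^esub> m \<otimes>\<^bsub>RG\<^esub> (?e \<otimes>\<^bsub>RG\<^esub> z) = ?e \<otimes>\<^bsub>RG\<^esub> (delta t [^]\<^bsub>RG\<^esub> m \<otimes>\<^bsub>RG\<^esub> z)"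
      using dp e Vc[OF z] by (simp add: A.m_assoc[symmetric])
    then show ?thesis using z aug_filtration_normalizer[OF H t] unfolding V_def by (metis (no_types, lifting) mem_Collect_eq)
  qed
  have V_H: "single h \<one> \<otimes>\<^bsub>RG\<^esub> z \<in> V i m" if h: "h \<in> H" and z: "z \<in> V i m" for h z i m
  proof -
    have "delta h \<otimes>\<^bsub>RG\<^esub> z \<in> aug_filtration H i" using z h by (simp add: V_def)
    then show ?thesis
      using V_add[OF z V_aug_filtration] delta_mult[OF subgroup_elt[OF H h] Vc[OF z]] by simp
  qed
  have V_pow: "delta (t [^]\<^bsub>G\<^esub> (j::nat)) \<otimes>\<^bsub>RG\<^esub> x \<in> V i m" if x: "x \<in> V i (Suc m)" for x i m j
  proof (induction j)
    case 0
    have "delta \<one>\<^bsub>G\<^esub> = \<zero>\<^bsub>RG\<^esub>" by (simp add: delta_def group_ring_one[symmetric] A.minus_eq A.r_neg)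
    then show ?case using Vc[OF x] V_aug_filtration[OF aug_filtration_zero[OF H]] by simp
  next
    case (Suc j)
    have xc: "x \<in> carrier RG" using Vc[OF x] .
    let ?g = "single (t [^]\<^bsub>G\<^esub> j) \<one>"
    have g: "?g \<in> carrier RG" using t by simp
    have "?e \<otimes>\<^bsub>RG\<^esub> x \<ominus>\<^bsub>RG\<^esub> x = delta t \<otimes>\<^bsub>RG\<^esub> x" unfolding delta_def using e xc by algebra
    moreover have "?e \<otimes>\<^bsub>RG\<^esub> x \<ominus>\<^bsub>RG\<^esub> x \<in> aug_filtration H (Suc i)"
      using x aug_filtration_minus[OF H aug_filtration_normalizer[OF H t]] unfolding V_def by blast
    moreover have "delta t [^]\<^bsub>RG\<^esub> m \<otimes>\<^bsub>RG\<^esub> (delta t \<otimes>\<^bsub>RG\<^esub> x) \<in> aug_filtration H i"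
      using x xc t unfolding V_def by (simp add: A.m_assoc)
    ultimately have "delta t \<otimes>\<^bsub>RG\<^esub> x \<in> V i m" unfolding V_def by simp
    \<comment> \<open>Here \<open>t^(j+1) - 1 = t (t^j - 1) + (t - 1)\<close>; both summands send
      \<open>x\<close> into \<open>V i m\<close>.\<close>
    then have "?e \<otimes>\<^bsub>RG\<^esub> (delta (t [^]\<^bsub>G\<^esub> j) \<otimes>\<^bsub>RG\<^esub> x) \<oplus>\<^bsub>RG\<^esub> delta t \<otimes>\<^bsub>RG\<^esub> x \<in> V i m"
      using V_add V_t Suc by blast
    moreover have "?e \<otimes>\<^bsub>RG\<^esub> (delta (t [^]\<^bsub>G\<^esub> j) \<otimes>\<^bsub>RG\<^esub> x) \<oplus>\<^bsub>RG\<^esub> delta t \<otimes>\<^bsub>RG\<^esub> x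
      = (?e \<otimes>\<^bsub>RG\<^esub> ?g \<ominus>\<^bsub>RG\<^esub> \<one>\<^bsub>RG\<^esub>) \<otimes>\<^bsub>RG\<^esub> x"
      unfolding delta_def using e g xc by algebra
    moreover have "?e \<otimes>\<^bsub>RG\<^esub> ?g = single (t [^]\<^bsub>G\<^esub> Suc j) \<one>"
      using t(1) G.nat_pow_Suc2[OF t(1), of j] by (simp add: single_mult)
    ultimately show ?case unfolding delta_def[of "t [^]\<^bsub>G\<^esub> Suc j"] by simp
  qed
  have V_sub: "V i m \<subseteq> aug_filtration ?H (M * i + m)" if IH: "aug_filtration H i \<subseteq> aug_filtration ?H (M * i)" for i m
  proof (induction m)
    case 0
    have "V i 0 \<subseteq> aug_filtration H i" using aug_filtration_carrier by (auto simp: V_def)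
    then show ?case using IH by simp
  next
    case (Suc m)
    show ?case
    proof
      fix x assume x: "x \<in> V i (Suc m)"
      have xc: "x \<in> carrier RG" using Vc[OF x] .
      have "delta g \<otimes>\<^bsub>RG\<^esub> x \<in> V i m" if "g \<in> ?H" for g
      proof -
        obtain h j where hj: "h \<in> H" "g = h \<otimes>\<^bsub>G\<^esub> t [^]\<^bsub>G\<^esub> (j::nat)"
          using \<open>g \<in> ?H\<close> by (auto simp: G.cyclic_extension_def)
        let ?h = "single h \<one>" and ?g = "single (t [^]\<^bsub>G\<^esub> j) \<one>"
        have c: "?h \<in> carrier RG" "?g \<in> carrier RG" using hj t subgroup_elt[OF H] by auto
        have "delta h \<otimes>\<^bsub>RG\<^esub> x \<in> aug_filtration H i" using x hj(1) by (simp add: V_def)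
        \<comment> \<open>Here \<open>h t^j - 1 = h (t^j - 1) + (h - 1)\<close>; the last summand
          even drops to level \<open>i\<close> for \<open>H\<close>.\<close>
        then have "?h \<otimes>\<^bsub>RG\<^esub> (delta (t [^]\<^bsub>G\<^esub> j) \<otimes>\<^bsub>RG\<^esub> x) \<oplus>\<^bsub>RG\<^esub> delta h \<otimes>\<^bsub>RG\<^esub> x \<in> V i m"
          by (intro V_add V_H hj V_pow x V_aug_filtration)
        moreover have "?h \<otimes>\<^bsub>RG\<^esub> (delta (t [^]\<^bsub>G\<^esub> j) \<otimes>\<^bsub>RG\<^esub> x) \<oplus>\<^bsub>RG\<^esub> delta h \<otimes>\<^bsub>RG\<^esub> x
          = (?h \<otimes>\<^bsub>RG\<^esub> ?g \<ominus>\<^bsub>RG\<^esub> \<one>\<^bsub>RG\<^esub>) \<otimes>\<^bsub>RG\<^esub> x"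
          unfolding delta_def using c xc by algebra
        moreover have "?h \<otimes>\<^bsub>RG\<^esub> ?g = single g \<one>"
          using hj t subgroup_elt[OF H] by (simp add: single_mult)
        ultimately show ?thesis unfolding delta_def[of g] by simp
      qed
      then show "x \<in> aug_filtration ?H (M * i + Suc m)" using Suc xc by auto
    qed
  qed
  \<comment> \<open>One level for \<open>H\<close> costs \<open>M\<close> levels for the extension,
    hence the factor \<open>M\<close>.\<close>
  have sub: "aug_filtration H i \<subseteq> aug_filtration ?H (M * i)" for i
  proof (induction i)
    case (Suc i)
    have "aug_filtration H (Suc i) \<subseteq> V i M"
    proof
      fix x assume x: "x \<in> aug_filtration H (Suc i)"
      then have "x \<in> carrier RG" by (rule aug_filtration_carrier)
      then show "x \<in> V i M" using x nil aug_filtration_zero[OF H] unfolding V_def by simp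
    qed
    also have "\<dots> \<subseteq> aug_filtration ?H (M * i + M)" using V_sub[OF Suc] .
    finally show ?case by (simp add: add.commute)
  qed simp
  obtain N where "carrier RG \<subseteq> aug_filtration H N" using Q by (auto simp: augmentation_nilpotent_def)
  then have "carrier RG \<subseteq> aug_filtration ?H (M * N)" using sub by blast
  then show ?thesis unfolding augmentation_nilpotent_def by blast
qed

section \<open>Locally solvable \<open>p\<close>-groups over a ring in which \<open>p\<close> is
  nilpotent\<close>

context
  fixes p assumes p: "Factorial_Ring.prime p" "R.int_embed (int p) \<in> nilpotents R" "p_group p G"
begin

lemma prime_nilpotent_group_ring: "A.int_embed (int p) \<in> nilpotents RG"
  using ring_hom_nilpotents[OF R.ring_axioms ring_group_ring scalar_hom p(2)]
    ring_hom_int_embed[OF R.ring_axioms ring_group_ring scalar_hom] by simp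

lemma p_group_power:
  assumes "g \<in> carrier G"
  shows "\<exists>k. g [^]\<^bsub>G\<^esub> (p ^ k) = \<one>\<^bsub>G\<^esub>"
  using p(3) G.pow_ord_eq_1[OF assms] assms unfolding p_group_def by metis

lemma p_group_torsion:
  assumes "g \<in> carrier G"
  shows "\<exists>m::nat. m \<ge> 1 \<and> g [^]\<^bsub>G\<^esub> m = \<one>\<^bsub>G\<^esub>"
proof -
  obtain k where "g [^]\<^bsub>G\<^esub> (p ^ k) = \<one>\<^bsub>G\<^esub>" using p_group_power assms by blast
  moreover have "p ^ k \<ge> 1" using prime_gt_0_nat[OF p(1)] by simp
  ultimately show ?thesis by blast
qed

text \<open>\<open>1 + delta t\<close> is a group element of \<open>p\<close>-power order, so the
  Frobenius argument applies in \<open>RG\<close>.\<close>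

lemma delta_nilpotent:
  assumes t: "t \<in> carrier G"
  shows "\<exists>M::nat. delta t [^]\<^bsub>RG\<^esub> M = \<zero>\<^bsub>RG\<^esub>"
proof -
  obtain k where k: "t [^]\<^bsub>G\<^esub> (p ^ k) = \<one>\<^bsub>G\<^esub>" using p_group_power t by blast
  have e: "single t \<one> \<in> carrier RG" using t by simp
  have "\<one>\<^bsub>RG\<^esub> \<oplus>\<^bsub>RG\<^esub> delta t = single t \<one>" unfolding delta_def using e by algebra
  then have "(\<one>\<^bsub>RG\<^esub> \<oplus>\<^bsub>RG\<^esub> delta t) [^]\<^bsub>RG\<^esub> (p ^ k) = \<one>\<^bsub>RG\<^esub>"
    using t k by (simp add: single_pow group_ring_one)
  then have "delta t \<in> nilpotents RG"
    using A.nilpotent_of_one_plus_torsion[OF p(1) prime_nilpotent_group_ring] t by simp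
  then show ?thesis by (auto simp: A.nilpotents_iff)
qed

text \<open>Induction on the derived length over all finite sets of generators. The hypothesis
  applies to the derived subgroup because that is again finitely generated; the given generators are
  then adjoined one by one.\<close>

lemma augmentation_nilpotent_solvable:
  assumes "finite S" "S \<subseteq> carrier G" "(derived G ^^ n) (generate G S) = {\<one>\<^bsub>G\<^esub>}"
  shows "augmentation_nilpotent (generate G S)"
  using assms
proof (induction n arbitrary: S)
  case 0
  then show ?case using augmentation_nilpotent_trivial by simp
next
  case (Suc n)
  let ?L = "generate G S"
  let ?K = "derived G ?L"
  have L: "subgroup ?L G" using Suc(3) by (rule G.generate_is_subgroup)
  have Lc: "?L \<subseteq> carrier G" using L by (rule subgroup.subset)
  have K: "subgroup ?K G" using Lc by (rule G.derived_is_subgroup)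
  have KL: "?K \<subseteq> ?L" using L by (rule G.derived_incl[OF order_refl])
  obtain T where T: "finite T" "T \<subseteq> carrier G" "?K = generate G T"
    using G.derived_finitely_generated[OF p_group_torsion Suc(2,3)] by blast
  have "(derived G ^^ n) (generate G T) = {\<one>\<^bsub>G\<^esub>}"
    using Suc(4) T(3) by (simp add: funpow_swap1)
  then have QK: "augmentation_nilpotent ?K" using Suc(1)[OF T(1,2)] T(3) by simp
  have "\<exists>H. subgroup H G \<and> ?K \<subseteq> H \<and> H \<subseteq> ?L \<and> S \<subseteq> H \<and> augmentation_nilpotent H"
  proof (rule G.cyclic_extension_chain[where \<Phi> = augmentation_nilpotent, OF p_group_torsion L K order_refl KL QK _ Suc(2)])
    show "S \<subseteq> ?L" by (auto intro: generate.incl)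
  next
    fix H t assume H: "subgroup H G" "?K \<subseteq> H" "H \<subseteq> ?L" and t: "t \<in> ?L" and Q: "augmentation_nilpotent H"
    have tc: "t \<in> carrier G" using t Lc by auto
    obtain M :: nat where M: "delta t [^]\<^bsub>RG\<^esub> M = \<zero>\<^bsub>RG\<^esub>" using delta_nilpotent[OF tc] by blast
    have "inv\<^bsub>G\<^esub> t \<otimes>\<^bsub>G\<^esub> h \<otimes>\<^bsub>G\<^esub> t \<in> H" if "h \<in> H" for h
      using G.conj_in_subgroup_above_derived[OF L H subgroup.m_inv_closed[OF L t] that] tc by simp
    then show "augmentation_nilpotent (G.cyclic_extension H t)"
      by (rule augmentation_nilpotent_cyclic_extension[OF H(1) Q tc _ M])
  qed
  then obtain H where H: "subgroup H G" "H \<subseteq> ?L" "S \<subseteq> H" "augmentation_nilpotent H" by blast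
  then have "?L = H" using G.generate_subgroup_incl[OF H(3,1)] by auto
  then show ?case using H(4) by simp
qed

text \<open>As its augmentation vanishes, \<open>f\<close> is a combination of elements
  \<open>g - 1\<close> with \<open>g\<close> in its support. Multiplication by \<open>f\<close>
  therefore lowers the level for the generated subgroup, and \<open>N\<close> such steps bring
  \<open>1\<close> to zero.\<close>

lemma augmentation_kernel_nilpotent:
  assumes ls: "locally_solvable G" and f: "f \<in> carrier RG" "aug f = \<zero>"
  shows "f \<in> nilpotents RG"
proof -
  let ?S = "supp f"
  let ?L = "generate G ?S"
  have S: "finite ?S" "?S \<subseteq> carrier G" using group_ring_finite_supp[OF f(1)] by auto
  have L: "subgroup ?L G" using S(2) by (rule G.generate_is_subgroup)
  let ?GL = "G\<lparr>carrier := ?L\<rparr>"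
  interpret GL: group ?GL using L G.group_axioms by (rule subgroup.subgroup_is_group)
  have "solvable ?GL" using ls S by (simp add: locally_solvable_def)
  then obtain n where n: "(derived ?GL ^^ n) ?L = {\<one>\<^bsub>G\<^esub>}"
    using GL.solvable_iff_trivial_derived_seq by auto
  \<comment> \<open>Solvability refers to the subgroup as a group of its own; its derived series has
    to be identified with the one computed in \<open>G\<close>.\<close>
  have consistent: "(derived ?GL ^^ k) ?L = (derived G ^^ k) ?L \<and> (derived G ^^ k) ?L \<subseteq> ?L" for k
  proof (induction k)
    case (Suc k)
    then show ?case
      using G.derived_consistent[OF _ L, of "(derived G ^^ k) ?L"] G.derived_incl[OF _ L] by auto
  qed simp
  have "(derived G ^^ n) ?L = {\<one>\<^bsub>G\<^esub>}" using consistent[of n] n by simp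
  then obtain N where N: "carrier RG \<subseteq> aug_filtration ?L N"
    using augmentation_nilpotent_solvable[OF S] unfolding augmentation_nilpotent_def by blast
  \<comment> \<open>Partial sums of \<open>f\<close> need not have augmentation zero, so the
    induction subtracts it.\<close>
  have lower: "\<forall>n. \<forall>x\<in>aug_filtration ?L (Suc n). (h \<ominus>\<^bsub>RG\<^esub> single \<one>\<^bsub>G\<^esub> (aug h)) \<otimes>\<^bsub>RG\<^esub> x \<in> aug_filtration ?L n"
    if h: "h \<in> carrier RG" "supp h \<subseteq> ?S" for h
    using h
  proof (induction rule: group_ring_induct)
    case zero
    have "aug \<zero>\<^bsub>RG\<^esub> = \<zero>" by (simp add: augmentation_def group_ring_zero)
    then show ?case using aug_filtration_zero[OF L] aug_filtration_carrier
      by (simp add: A.minus_eq single_zero)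
  next
    case (add h g c)
    have c: "h \<in> carrier RG" "single g c \<in> carrier RG" "single \<one>\<^bsub>G\<^esub> (aug h) \<in> carrier RG"
      "single \<one>\<^bsub>G\<^esub> c \<in> carrier RG" "single g \<one> \<in> carrier RG" using add by auto
    have gL: "g \<in> ?L" using add(3) by (rule generate.incl)
    have 1: "single \<one>\<^bsub>G\<^esub> (aug (h \<oplus>\<^bsub>RG\<^esub> single g c)) = single \<one>\<^bsub>G\<^esub> (aug h) \<oplus>\<^bsub>RG\<^esub> single \<one>\<^bsub>G\<^esub> c"
      using add by (simp add: augmentation_add augmentation_single single_add)
    have 2: "single g c = single \<one>\<^bsub>G\<^esub> c \<otimes>\<^bsub>RG\<^esub> single g \<one>" using add by (simp add: single_mult)
    show ?case
    proof (intro allI ballI)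
      fix n x assume x: "x \<in> aug_filtration ?L (Suc n)"
      then have xc: "x \<in> carrier RG" by (rule aug_filtration_carrier)
      have "(h \<ominus>\<^bsub>RG\<^esub> single \<one>\<^bsub>G\<^esub> (aug h)) \<otimes>\<^bsub>RG\<^esub> x \<oplus>\<^bsub>RG\<^esub> single \<one>\<^bsub>G\<^esub> c \<otimes>\<^bsub>RG\<^esub> (delta g \<otimes>\<^bsub>RG\<^esub> x) \<in> aug_filtration ?L n"
        using add(5) x gL by (intro aug_filtration_add[OF L] aug_filtration_scalar[OF L] add(4)) auto
      moreover have "(h \<ominus>\<^bsub>RG\<^esub> single \<one>\<^bsub>G\<^esub> (aug h)) \<otimes>\<^bsub>RG\<^esub> x \<oplus>\<^bsub>RG\<^esub> single \<one>\<^bsub>G\<^esub> c \<otimes>\<^bsub>RG\<^esub> (delta g \<otimes>\<^bsub>RG\<^esub> x)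
        = (h \<oplus>\<^bsub>RG\<^esub> single \<one>\<^bsub>G\<^esub> c \<otimes>\<^bsub>RG\<^esub> single g \<one> \<ominus>\<^bsub>RG\<^esub> (single \<one>\<^bsub>G\<^esub> (aug h) \<oplus>\<^bsub>RG\<^esub> single \<one>\<^bsub>G\<^esub> c)) \<otimes>\<^bsub>RG\<^esub> x"
        unfolding delta_def using c xc by algebra
      ultimately show "(h \<oplus>\<^bsub>RG\<^esub> single g c \<ominus>\<^bsub>RG\<^esub> single \<one>\<^bsub>G\<^esub> (aug (h \<oplus>\<^bsub>RG\<^esub> single g c))) \<otimes>\<^bsub>RG\<^esub> x \<in> aug_filtration ?L n"
        unfolding 1 unfolding 2 by simp
    qed
  qed
  have f_eq: "f \<ominus>\<^bsub>RG\<^esub> single \<one>\<^bsub>G\<^esub> (aug f) = f" using f by (simp add: A.minus_eq single_zero)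
  have f_lower: "f \<otimes>\<^bsub>RG\<^esub> x \<in> aug_filtration ?L n" if x: "x \<in> aug_filtration ?L (Suc n)" for x n
  proof -
    have "(f \<ominus>\<^bsub>RG\<^esub> single \<one>\<^bsub>G\<^esub> (aug f)) \<otimes>\<^bsub>RG\<^esub> x \<in> aug_filtration ?L n"
      using lower[OF f(1) order_refl] x by blast
    then show ?thesis by (simp only: f_eq)
  qed
  have "f [^]\<^bsub>RG\<^esub> n \<otimes>\<^bsub>RG\<^esub> x = \<zero>\<^bsub>RG\<^esub>" if "x \<in> aug_filtration ?L n" for x n
    using that
  proof (induction n arbitrary: x)
    case (Suc n)
    have "x \<in> carrier RG" using Suc(2) by (rule aug_filtration_carrier)
    then have "f [^]\<^bsub>RG\<^esub> Suc n \<otimes>\<^bsub>RG\<^esub> x = f [^]\<^bsub>RG\<^esub> n \<otimes>\<^bsub>RG\<^esub> (f \<otimes>\<^bsub>RG\<^esub> x)"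
      using f(1) by (simp add: A.m_assoc)
    then show ?case using Suc(1)[OF f_lower[OF Suc(2)]] by simp
  qed simp
  from this[of "\<one>\<^bsub>RG\<^esub>" N] N f(1) have "f [^]\<^bsub>RG\<^esub> N = \<zero>\<^bsub>RG\<^esub>" by auto
  then show ?thesis using f(1) by (auto simp: A.nilpotents_iff)
qed

end

end

section \<open>Torsion units and nilpotent elements of the group ring\<close>

lemma (in nr_ring) t_fine_ringI:
  assumes "generalized_t_fine R"
  shows "t_fine_ring R"
proof
  have "\<one> \<in> torsion_units R" by (rule torsion_unitI[of _ 1]) auto
  then have "\<one> \<oplus> \<zero> \<in> torsion_units R <+>\<^bsub>R\<^esub> nilpotents R"
    using zero_nilpotent unfolding set_add_def' by blast
  then have "\<one> \<notin> jacobson_radical R"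
    using assms unfolding generalized_t_fine_def by auto
  then show "\<one> \<noteq> \<zero>" using zero_in_jacobson_radical by auto
next
  fix x assume "x \<in> carrier R" "x \<notin> jacobson_radical R"
  then have "x \<in> torsion_units R <+>\<^bsub>R\<^esub> nilpotents R"
    using assms unfolding generalized_t_fine_def by blast
  then show "\<exists>u\<in>torsion_units R. \<exists>n\<in>nilpotents R. x = u \<oplus> n" by (auto simp: set_add_def')
qed

context group_over_ring
begin

text \<open>The kernel of the augmentation is nil, so the nilpotents of \<open>RG\<close> are the
  preimage of those of \<open>R\<close> and form a subgroup. If \<open>aug f\<close> is torsion,
  some power of \<open>f\<close> is \<open>1\<close> plus a kernel element, and a further
  \<open>p\<close>-power turns it into \<open>1\<close>.\<close>

lemma generalized_t_fine_group_ring: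
  assumes tf: "t_fine_ring R" and ls: "locally_solvable G"
    and p: "Factorial_Ring.prime p" "R.int_embed (int p) \<in> nilpotents R" "p_group p G"
  shows "generalized_t_fine RG"
proof -
  interpret T: t_fine_ring R by (rule tf)
  have nil: "f \<in> nilpotents RG \<longleftrightarrow> f \<in> carrier RG \<and> aug f \<in> nilpotents R" for f
  proof (intro iffI conjI)
    assume f: "f \<in> carrier RG \<and> aug f \<in> nilpotents R"
    then obtain k :: nat where "aug f [^] k = \<zero>" by (auto simp: R.nilpotents_iff)
    then have "aug (f [^]\<^bsub>RG\<^esub> k) = \<zero>"
      using augmentation_nat_pow f by simp
    then have "f [^]\<^bsub>RG\<^esub> k \<in> nilpotents RG"
      using f by (intro augmentation_kernel_nilpotent[OF p ls]) auto
    then show "f \<in> nilpotents RG" using A.nilpotent_of_pow f by blast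
  qed (use A.nilpotents_carrier augmentation_nilpotents in auto)
  have "\<one>\<^bsub>RG\<^esub> \<noteq> \<zero>\<^bsub>RG\<^esub>"
  proof
    assume "\<one>\<^bsub>RG\<^esub> = \<zero>\<^bsub>RG\<^esub>"
    then have "\<one>\<^bsub>RG\<^esub> \<one>\<^bsub>G\<^esub> = \<zero>\<^bsub>RG\<^esub> \<one>\<^bsub>G\<^esub>" by simp
    then show False using T.one_not_zero by (simp add: group_ring_one group_ring_zero single_apply)
  qed
  have tors: "f \<in> torsion_units RG" if f: "f \<in> carrier RG" "aug f \<notin> nilpotents R" for f
  proof -
    have "aug f \<in> torsion_units R" using T.carrier_eq_torsion_Un_nilpotent f by blast
    then obtain m :: nat where m: "m \<ge> 1" "aug f [^] m = \<one>" by (auto simp: torsion_units_def)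
    let ?z = "f [^]\<^bsub>RG\<^esub> m \<ominus>\<^bsub>RG\<^esub> \<one>\<^bsub>RG\<^esub>"
    have fm: "f [^]\<^bsub>RG\<^esub> m \<in> carrier RG" using f by simp
    have "aug (f [^]\<^bsub>RG\<^esub> m) = \<one>"
      using augmentation_nat_pow f m by simp
    moreover have "aug (?z \<oplus>\<^bsub>RG\<^esub> \<one>\<^bsub>RG\<^esub>) = aug ?z \<oplus> \<one>"
      using fm by (subst augmentation_add) (auto simp: group_ring_one augmentation_single)
    moreover have "?z \<oplus>\<^bsub>RG\<^esub> \<one>\<^bsub>RG\<^esub> = f [^]\<^bsub>RG\<^esub> m" using fm A.one_closed by algebra
    ultimately have "aug ?z \<oplus> \<one> = \<zero> \<oplus> \<one>" by simp
    then have "aug ?z = \<zero>" using fm R.add.r_cancel[of \<one> "aug ?z" \<zero>] by simp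
    then have "?z \<in> nilpotents RG" using fm by (intro augmentation_kernel_nilpotent[OF p ls]) auto
    then obtain k where "(\<one>\<^bsub>RG\<^esub> \<oplus>\<^bsub>RG\<^esub> ?z) [^]\<^bsub>RG\<^esub> (p ^ k) = \<one>\<^bsub>RG\<^esub>"
      using A.one_plus_nilpotent_torsion[OF p(1) prime_nilpotent_group_ring[OF p]] by blast
    moreover have "\<one>\<^bsub>RG\<^esub> \<oplus>\<^bsub>RG\<^esub> ?z = f [^]\<^bsub>RG\<^esub> m" using fm A.one_closed by algebra
    ultimately have "f [^]\<^bsub>RG\<^esub> (m * p ^ k) = \<one>\<^bsub>RG\<^esub>" using f by (simp add: A.nat_pow_pow)
    moreover have "m * p ^ k \<ge> 1" using m(1) prime_gt_0_nat[OF p(1)] by (simp add: Suc_le_eq)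
    ultimately show ?thesis using f by (intro A.torsion_unitI) auto
  qed
  have "aug \<zero>\<^bsub>RG\<^esub> = \<zero>" by (simp add: augmentation_def group_ring_zero)
  have neg: "\<ominus>\<^bsub>RG\<^esub> f \<in> nilpotents RG" if "f \<in> nilpotents RG" for f
  proof -
    have f: "f \<in> carrier RG" using that A.nilpotents_carrier by blast
    have "aug (\<ominus>\<^bsub>RG\<^esub> f) \<oplus> aug f = \<zero>"
      using f \<open>aug \<zero>\<^bsub>RG\<^esub> = \<zero>\<close> by (simp add: augmentation_add[symmetric] A.l_neg)
    then have "aug (\<ominus>\<^bsub>RG\<^esub> f) = \<ominus> aug f" using f by (simp add: R.minus_equality)
    then show ?thesis using that nil f T.nilpotents_uminus by simp
  qed
  have "subgroup (nilpotents RG) (add_monoid RG)"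
  proof (rule A.add.subgroupI)
    show "nilpotents RG \<noteq> {}" using A.zero_nilpotent by blast
    show "a \<oplus>\<^bsub>RG\<^esub> b \<in> nilpotents RG" if "a \<in> nilpotents RG" "b \<in> nilpotents RG" for a b
      using that unfolding nil by (simp add: augmentation_add T.nilpotents_add)
  qed (use neg A.nilpotents_carrier in \<open>auto simp: a_inv_def[symmetric]\<close>)
  then have sub: "additive_subgroup (nilpotents RG) RG" by (rule additive_subgroup.intro)
  interpret N: nr_ring RG by (intro nr_ring.intro nr_ring_axioms.intro ring_group_ring sub)
  have "carrier RG = torsion_units RG \<union> nilpotents RG"
    using tors nil by (auto simp: torsion_units_def)
  then show ?thesis using N.generalized_t_fineI \<open>\<one>\<^bsub>RG\<^esub> \<noteq> \<zero>\<^bsub>RG\<^esub>\<close> by blast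
qed

end

theorem corollary2p24:
  fixes R :: "('a, 'm) ring_scheme" and G :: "('g, 'n) monoid_scheme"
  assumes "NR_ring R"
    and "group G" and "carrier G \<noteq> {\<one>\<^bsub>G\<^esub>}" and "locally_solvable G"
  shows "generalized_t_fine (group_ring R G) \<longleftrightarrow>
    generalized_t_fine R \<and>
    (\<exists>p::nat. Factorial_Ring.prime p \<and> p_group p G \<and> [p] \<cdot>\<^bsub>R\<^esub> \<one>\<^bsub>R\<^esub> \<in> nilpotents R)"
proof -
  interpret nr_ring R
    using assms(1) by (simp add: NR_ring_def nr_ring_def nr_ring_axioms_def)
  interpret group_over_ring R G
    using ring_axioms assms(2) by (rule group_over_ring.intro)
  show ?thesis
  proof
    assume gtf: "generalized_t_fine (group_ring R G)"
    have tf: "t_fine_ring R"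
      by unfold_locales (use gtf_one_not_zero[OF gtf] gtf_coefficients[OF gtf] in auto)
    interpret T: t_fine_ring R by (rule tf)
    obtain p where p: "Factorial_Ring.prime p" "int_embed (int p) \<in> nilpotents R"
      using T.prime_nilpotent by blast
    \<comment> \<open>The equality for \<open>R\<close> is rebuilt from the dichotomy, as the
      augmentation passes down only one inclusion.\<close>
    show "generalized_t_fine R \<and>
      (\<exists>p::nat. Factorial_Ring.prime p \<and> p_group p G \<and> [p] \<cdot>\<^bsub>R\<^esub> \<one>\<^bsub>R\<^esub> \<in> nilpotents R)"
      using generalized_t_fineI[OF T.one_not_zero T.carrier_eq_torsion_Un_nilpotent]
        gtf_p_group[OF gtf p] p by (auto simp: of_int_of_nat)
  next
    assume "generalized_t_fine R \<and>
      (\<exists>p::nat. Factorial_Ring.prime p \<and> p_group p G \<and> [p] \<cdot>\<^bsub>R\<^esub> \<one>\<^bsub>R\<^esub> \<in> nilpotents R)"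
    then obtain p where p: "Factorial_Ring.prime p" "int_embed (int p) \<in> nilpotents R" "p_group p G"
      and gtf: "generalized_t_fine R" by (auto simp: of_int_of_nat)
    show "generalized_t_fine (group_ring R G)"
      by (rule generalized_t_fine_group_ring[OF t_fine_ringI[OF gtf] assms(4) p])
  qed
qed

end
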